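(* Let $(M(c),\varphi,\xi,\eta,g)$ be a conformal Kenmotsu space form and let $\acute{M}$ be a CR-hypersurface of $M(c)$ whose shape operator $A$ is recurrent. Suppose that the Lee vector field $\omega^{\sharp}$ is tangent to $\acute{M}$. Then either $\acute{M}$ is totally geodesic or $f=2(\ln\beta-\ln 2)$, where $\beta=\omega(\xi)=g(\omega^{\sharp},\xi)$ is the $\xi$-component of $\omega^{\sharp}$ on $\acute{M}$.
   Context: An almost contact metric structure $(\varphi,\xi,\eta,g)$ on a $(2n+1)$-dimensional smooth manifold $M$ consists of a $(1,1)$-tensor field $\varphi$, a vector field $\xi$, a 1-form $\eta$ and a Riemannian metric $g$ with $\varphi^2=-\mathrm{Id}+\eta\otimes\xi$, $\eta(\xi)=1$, $\varphi\xi=0$, $\eta\circ\varphi=0$, $g(\varphi X,\varphi Y)=g(X,Y)-\eta(X)\eta(Y)$, $\eta(X)=g(X,\xi)$. It is a Kenmotsu structure if $(\nabla_X\varphi)Y=-g(X,\varphi Y)\xi-\eta(Y)\varphi X$, with $\nabla$ the Levi-Civita connection of $g$. A manifold $M$ with almost contact metric structure $(\varphi,\xi,\eta,g)$ is a conformal Kenmotsu manifold if there is a positive smooth function $f:M\to\mathbb{R}$ (fixed throughout) such that $(\varphi,\ \tilde\xi=e^{-f/2}\xi,\ \tilde\eta=e^{f/2}\eta,\ \tilde g=e^{f}g)$ is a Kenmotsu structure on $M$. It is a conformal Kenmotsu space form, denoted $M(c)$, if moreover this Kenmotsu structure has constant $\varphi$-holomorphic sectional curvature $c$, i.e. the $\tilde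 g$-sectional curvature of $\mathrm{span}\{X,\varphi X\}$ equals the constant $c$ for all nonzero $X$ orthogonal to $\tilde\xi$. The 1-form $\omega$ is $\omega(X)=X(f)$, and the Lee vector field is $\omega^{\sharp}=\mathrm{grad} f$ (gradient with respect to $g$). A CR-hypersurface of $M$ is a $2n$-dimensional embedded submanifold $\acute{M}$ such that $\xi$ is tangent to $\acute{M}$ and $T\acute{M}$ is an orthogonal direct sum of distributions $D\oplus D^{\perp}$ with $\varphi(D_p)\subset D_p$ and $\varphi(D^{\perp}_p)\subset T_p^{\perp}\acute{M}$ for all $p\in\acute M$. With $N$ a unit normal vector field of $\acute{M}$ and $U=-\varphi N$, one takes $D^{\perp}=\mathrm{span}\{U,\xi\}$ and $D$ its orthogonal complement in $T\acute{M}$. $\acute\nabla$ is the Levi-Civita connection of the metric induced on $\acute M$, and $A$ is the shape operator: $AX=-\nabla_XN$ for $X\in T\acute M$, where $\nabla$ is the Levi-Civita connection of $g$. $A$ is recurrent if there exists a 1-form $\theta$ on $\acute{M}$ such that $(\acute\nabla_XA)Y=\theta(X)AY$ for all $X,Y$ tangent to $\acute{M}$. Totally geodesic means $A=0$.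
   Formalization: The CR-hypersurface is assumed connected; without this, different components can realize different alternatives (one totally geodesic, another with f = 2(ln β − ln 2) and A nonzero), so the global either/or fails. *)

theory Defs
  imports "HOL-Analysis.Analysis" "HOL-Library.Function_Algebras"
begin

section \<open>Functions as a real vector space\<close>

text \<open>
  Tangent vectors are operators on real-valued functions and vector fields are functions into
  tangent vectors; both are added and scaled pointwise.
\<close>

instantiation "fun" :: (type, real_vector) real_vector
begin

definition scaleR_fun :: "real \<Rightarrow> ('a \<Rightarrow> 'b) \<Rightarrow> 'a \<Rightarrow> 'b"
  where "scaleR_fun r f = (\<lambda>x. r *\<^sub>R f x)"

instance
  by standard (auto simp: scaleR_fun_def fun_eq_iff algebra_simps)

end

section \<open>Smooth maps between open subsets of Euclidean spaces\<close>

text \<open>\<open>C_k k S f\<close> is meant for open \<open>S\<close>: all iterated directional derivatives of \<open>f\<close> up to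
  order \<open>k\<close> exist and are continuous on \<open>S\<close>.\<close>

primrec C_k :: "nat \<Rightarrow> 'e::euclidean_space set \<Rightarrow> ('e \<Rightarrow> 'b::real_normed_vector) \<Rightarrow> bool" where
  "C_k 0 S f \<longleftrightarrow> continuous_on S f"
| "C_k (Suc k) S f \<longleftrightarrow> (\<forall>x\<in>S. f differentiable (at x)) \<and>
     (\<forall>v. C_k k S (\<lambda>x. frechet_derivative f (at x) v))"

definition C_inf :: "'e::euclidean_space set \<Rightarrow> ('e \<Rightarrow> 'b::real_normed_vector) \<Rightarrow> bool"
  where "C_inf S f \<longleftrightarrow> (\<forall>k. C_k k S f)"

section \<open>Smooth manifolds\<close>

text \<open>A chart is a pair of its domain and its coordinate map; the dimension of a manifold is the
  dimension of the Euclidean space \<open>'e\<close> in which its charts take values.\<close>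

type_synonym ('a, 'e) chart = "'a set \<times> ('a \<Rightarrow> 'e)"

record ('a, 'e) mfd =
  mtop :: "'a topology"
  atlas :: "('a, 'e) chart set"

abbreviation pts :: "('a, 'e) mfd \<Rightarrow> 'a set"
  where "pts M \<equiv> topspace (mtop M)"

definition is_chart :: "'a topology \<Rightarrow> ('a, 'e::euclidean_space) chart \<Rightarrow> bool" where
  "is_chart T = (\<lambda>(U, x). openin T U \<and> open (x ` U) \<and>
     homeomorphic_map (subtopology T U) (top_of_set (x ` U)) x)"

definition compatible ::
    "('a, 'e::euclidean_space) chart \<Rightarrow> ('a, 'e) chart \<Rightarrow> bool" where
  "compatible = (\<lambda>(U, x) (V, y).
     C_inf (x ` (U \<inter> V)) (y \<circ> inv_into U x) \<and> C_inf (y ` (U \<inter> V)) (x \<circ> inv_into V y))"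

definition smooth_manifold :: "('a, 'e::euclidean_space) mfd \<Rightarrow> bool" where
  "smooth_manifold M \<longleftrightarrow>
     Hausdorff_space (mtop M) \<and> second_countable (mtop M) \<and>
     (\<forall>c\<in>atlas M. is_chart (mtop M) c) \<and>
     (\<forall>c\<in>atlas M. \<forall>d\<in>atlas M. compatible c d) \<and>
     \<Union> (fst ` atlas M) = pts M"

text \<open>The charts of the maximal atlas.\<close>

definition charts :: "('a, 'e::euclidean_space) mfd \<Rightarrow> ('a, 'e) chart set" where
  "charts M = {c. is_chart (mtop M) c \<and> (\<forall>d\<in>atlas M. compatible c d)}"

definition smooth_fun :: "('a, 'e::euclidean_space) mfd \<Rightarrow> 'a set \<Rightarrow> ('a \<Rightarrow> real) \<Rightarrow> bool" where
  "smooth_fun M U F \<longleftrightarrow> (\<forall>(V, x)\<in>atlas M. C_inf (x ` (U \<inter> V)) (F \<circ> inv_into V x))"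

definition smooth_at :: "('a, 'e::euclidean_space) mfd \<Rightarrow> 'a \<Rightarrow> ('a \<Rightarrow> real) \<Rightarrow> bool" where
  "smooth_at M p F \<longleftrightarrow> (\<exists>U. openin (mtop M) U \<and> p \<in> U \<and> smooth_fun M U F)"

section \<open>Tangent vectors and vector fields\<close>

text \<open>
  A tangent vector at \<open>p\<close> is the operator \<open>F \<mapsto> (F \<circ> \<gamma>)'(0)\<close> given by a smooth curve \<open>\<gamma>\<close> with
  \<open>\<gamma>(0) = p\<close>, acting on the functions that are smooth near \<open>p\<close>.  To make equality of tangent
  vectors equality of operators, they are set to \<open>0\<close> on all other functions.
\<close>

type_synonym 'a tvec = "('a \<Rightarrow> real) \<Rightarrow> real"
type_synonym 'a vfield = "'a \<Rightarrow> 'a tvec"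

definition smooth_curve ::
    "('a, 'e::euclidean_space) mfd \<Rightarrow> real set \<Rightarrow> (real \<Rightarrow> 'a) \<Rightarrow> bool" where
  "smooth_curve M I \<gamma> \<longleftrightarrow> continuous_map (top_of_set I) (mtop M) \<gamma> \<and>
     (\<forall>(V, x)\<in>atlas M. C_inf {t\<in>I. \<gamma> t \<in> V} (x \<circ> \<gamma>))"

definition velocity :: "('a, 'e::euclidean_space) mfd \<Rightarrow> (real \<Rightarrow> 'a) \<Rightarrow> 'a tvec" where
  "velocity M \<gamma> = (\<lambda>F. if smooth_at M (\<gamma> 0) F then deriv (\<lambda>t. F (\<gamma> t)) 0 else 0)"

definition tangent_space :: "('a, 'e::euclidean_space) mfd \<Rightarrow> 'a \<Rightarrow> 'a tvec set" where
  "tangent_space M p =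
     {velocity M \<gamma> |\<gamma> e. 0 < e \<and> smooth_curve M {-e<..<e} \<gamma> \<and> \<gamma> 0 = p}"

text \<open>\<open>vector_field M U X\<close>: \<open>X\<close> is a smooth vector field on the open set \<open>U\<close> (its values outside
  \<open>U\<close> are irrelevant).\<close>

definition vector_field ::
    "('a, 'e::euclidean_space) mfd \<Rightarrow> 'a set \<Rightarrow> 'a vfield \<Rightarrow> bool" where
  "vector_field M U X \<longleftrightarrow> (\<forall>p\<in>U. X p \<in> tangent_space M p) \<and>
     (\<forall>V F. openin (mtop M) V \<and> V \<subseteq> U \<and> smooth_fun M V F \<longrightarrow> smooth_fun M V (\<lambda>p. X p F))"

definition lie_bracket ::
    "('a, 'e::euclidean_space) mfd \<Rightarrow> 'a vfield \<Rightarrow> 'a vfield \<Rightarrow> 'a vfield" where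
  "lie_bracket M X Y = (\<lambda>p F. if smooth_at M p F
     then X p (\<lambda>q. Y q F) - Y p (\<lambda>q. X q F) else 0)"

section \<open>Tensor fields\<close>

text \<open>Smoothness of a tensor field is tested on smooth local vector fields.\<close>

definition linear_over :: "'v::real_vector set \<Rightarrow> ('v \<Rightarrow> 'w::real_vector) \<Rightarrow> bool" where
  "linear_over T h \<longleftrightarrow> (\<forall>u\<in>T. \<forall>v\<in>T. h (u + v) = h u + h v) \<and>
     (\<forall>a. \<forall>v\<in>T. h (a *\<^sub>R v) = a *\<^sub>R h v)"

definition one_form ::
    "('a, 'e::euclidean_space) mfd \<Rightarrow> ('a \<Rightarrow> 'a tvec \<Rightarrow> real) \<Rightarrow> bool" where
  "one_form M \<theta> \<longleftrightarrow> (\<forall>p\<in>pts M. linear_over (tangent_space M p) (\<theta> p)) \<and>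
     (\<forall>U X. openin (mtop M) U \<and> vector_field M U X \<longrightarrow> smooth_fun M U (\<lambda>p. \<theta> p (X p)))"

definition tensor11 ::
    "('a, 'e::euclidean_space) mfd \<Rightarrow> ('a \<Rightarrow> 'a tvec \<Rightarrow> 'a tvec) \<Rightarrow> bool" where
  "tensor11 M \<phi> \<longleftrightarrow>
     (\<forall>p\<in>pts M. linear_over (tangent_space M p) (\<phi> p) \<and>
        \<phi> p ` tangent_space M p \<subseteq> tangent_space M p) \<and>
     (\<forall>U X. openin (mtop M) U \<and> vector_field M U X \<longrightarrow> vector_field M U (\<lambda>p. \<phi> p (X p)))"

type_synonym 'a metric_tensor = "'a \<Rightarrow> 'a tvec \<Rightarrow> 'a tvec \<Rightarrow> real"

definition riemannian_metric ::
    "('a, 'e::euclidean_space) mfd \<Rightarrow> 'a metric_tensor \<Rightarrow> bool" where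
  "riemannian_metric M g \<longleftrightarrow>
     (\<forall>p\<in>pts M. \<forall>u\<in>tangent_space M p.
        linear_over (tangent_space M p) (g p u) \<and>
        (\<forall>v\<in>tangent_space M p. g p u v = g p v u) \<and>
        (u \<noteq> 0 \<longrightarrow> 0 < g p u u)) \<and>
     (\<forall>U X Y. openin (mtop M) U \<and> vector_field M U X \<and> vector_field M U Y \<longrightarrow>
        smooth_fun M U (\<lambda>p. g p (X p) (Y p)))"

section \<open>Levi-Civita connection and curvature\<close>

text \<open>A connection is an operator on local vector fields, with the axioms required over every open
  set.  (Locality in both arguments follows, as the multiplying function \<open>h\<close> may be the
  indicator of the open set.)\<close>

type_synonym 'a conn = "'a vfield \<Rightarrow> 'a vfield \<Rightarrow> 'a vfield"

definition connection :: "('a, 'e::euclidean_space) mfd \<Rightarrow> 'a conn \<Rightarrow> bool" where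
  "connection M nabla \<longleftrightarrow>
     (\<forall>U X Y Z h. openin (mtop M) U \<and> vector_field M U X \<and> vector_field M U Y \<and>
        vector_field M U Z \<and> smooth_fun M U h \<longrightarrow>
        vector_field M U (nabla X Y) \<and>
        (\<forall>p\<in>U.
          nabla (X + Y) Z p = nabla X Z p + nabla Y Z p \<and>
          nabla (\<lambda>q. h q *\<^sub>R X q) Y p = h p *\<^sub>R nabla X Y p \<and>
          nabla X (Y + Z) p = nabla X Y p + nabla X Z p \<and>
          nabla X (\<lambda>q. h q *\<^sub>R Y q) p = X p h *\<^sub>R Y p + h p *\<^sub>R nabla X Y p))"

definition levi_civita ::
    "('a, 'e::euclidean_space) mfd \<Rightarrow> 'a metric_tensor \<Rightarrow> 'a conn \<Rightarrow> bool" where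
  "levi_civita M g nabla \<longleftrightarrow> connection M nabla \<and>
     (\<forall>U X Y Z. openin (mtop M) U \<and> vector_field M U X \<and> vector_field M U Y \<and>
        vector_field M U Z \<longrightarrow>
        (\<forall>p\<in>U.
          nabla X Y p - nabla Y X p = lie_bracket M X Y p \<and>
          X p (\<lambda>q. g q (Y q) (Z q)) = g p (nabla X Y p) (Z p) + g p (Y p) (nabla X Z p)))"

definition curvature ::
    "('a, 'e::euclidean_space) mfd \<Rightarrow> 'a conn \<Rightarrow> 'a vfield \<Rightarrow> 'a vfield \<Rightarrow> 'a vfield \<Rightarrow> 'a vfield" where
  "curvature M nabla X Y Z =
     nabla X (nabla Y Z) - nabla Y (nabla X Z) - nabla (lie_bracket M X Y) Z"

definition sectional_curvature ::
    "('a, 'e::euclidean_space) mfd \<Rightarrow> 'a metric_tensor \<Rightarrow> 'a conn \<Rightarrow> 'a vfield \<Rightarrow> 'a vfield \<Rightarrow> 'a \<Rightarrow> real" where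
  "sectional_curvature M g nabla X Y p =
     g p (curvature M nabla X Y Y p) (X p) /
     (g p (X p) (X p) * g p (Y p) (Y p) - (g p (X p) (Y p))\<^sup>2)"

section \<open>Almost contact metric, Kenmotsu and conformal Kenmotsu structures\<close>

definition almost_contact_metric ::
    "('a, 'e::euclidean_space) mfd \<Rightarrow> ('a \<Rightarrow> 'a tvec \<Rightarrow> 'a tvec) \<Rightarrow> 'a vfield \<Rightarrow>
     ('a \<Rightarrow> 'a tvec \<Rightarrow> real) \<Rightarrow> 'a metric_tensor \<Rightarrow> bool" where
  "almost_contact_metric M \<phi> \<xi> \<eta> g \<longleftrightarrow>
     tensor11 M \<phi> \<and> vector_field M (pts M) \<xi> \<and> one_form M \<eta> \<and> riemannian_metric M g \<and>
     (\<forall>p\<in>pts M.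
        \<eta> p (\<xi> p) = 1 \<and> \<phi> p (\<xi> p) = 0 \<and>
        (\<forall>u\<in>tangent_space M p.
           \<phi> p (\<phi> p u) = - u + \<eta> p u *\<^sub>R \<xi> p \<and> \<eta> p (\<phi> p u) = 0 \<and> \<eta> p u = g p u (\<xi> p) \<and>
           (\<forall>v\<in>tangent_space M p. g p (\<phi> p u) (\<phi> p v) = g p u v - \<eta> p u * \<eta> p v)))"

text \<open>The left-hand side below is \<open>(\<nabla>\<^sub>X \<phi>) Y\<close>.\<close>

definition kenmotsu ::
    "('a, 'e::euclidean_space) mfd \<Rightarrow> ('a \<Rightarrow> 'a tvec \<Rightarrow> 'a tvec) \<Rightarrow> 'a vfield \<Rightarrow>
     ('a \<Rightarrow> 'a tvec \<Rightarrow> real) \<Rightarrow> 'a metric_tensor \<Rightarrow> bool" where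
  "kenmotsu M \<phi> \<xi> \<eta> g \<longleftrightarrow> almost_contact_metric M \<phi> \<xi> \<eta> g \<and>
     (\<exists>nabla. levi_civita M g nabla \<and>
       (\<forall>U X Y. openin (mtop M) U \<and> vector_field M U X \<and> vector_field M U Y \<longrightarrow>
         (\<forall>p\<in>U. nabla X (\<lambda>q. \<phi> q (Y q)) p - \<phi> p (nabla X Y p) =
            - (g p (X p) (\<phi> p (Y p)) *\<^sub>R \<xi> p) - \<eta> p (Y p) *\<^sub>R \<phi> p (X p))))"

definition const_phi_sectional_curvature ::
    "('a, 'e::euclidean_space) mfd \<Rightarrow> ('a \<Rightarrow> 'a tvec \<Rightarrow> 'a tvec) \<Rightarrow> 'a vfield \<Rightarrow>
     'a metric_tensor \<Rightarrow> real \<Rightarrow> bool" where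
  "const_phi_sectional_curvature M \<phi> \<xi> g c \<longleftrightarrow>
     (\<exists>nabla. levi_civita M g nabla \<and>
       (\<forall>U X. openin (mtop M) U \<and> vector_field M U X \<longrightarrow>
         (\<forall>p\<in>U. X p \<noteq> 0 \<and> g p (X p) (\<xi> p) = 0 \<longrightarrow>
            sectional_curvature M g nabla X (\<lambda>q. \<phi> q (X q)) p = c)))"

definition conformal_kenmotsu_space_form ::
    "('a, 'e::euclidean_space) mfd \<Rightarrow> ('a \<Rightarrow> 'a tvec \<Rightarrow> 'a tvec) \<Rightarrow> 'a vfield \<Rightarrow>
     ('a \<Rightarrow> 'a tvec \<Rightarrow> real) \<Rightarrow> 'a metric_tensor \<Rightarrow> ('a \<Rightarrow> real) \<Rightarrow> real \<Rightarrow> bool" where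
  "conformal_kenmotsu_space_form M \<phi> \<xi> \<eta> g f c \<longleftrightarrow>
     smooth_manifold M \<and> almost_contact_metric M \<phi> \<xi> \<eta> g \<and>
     smooth_fun M (pts M) f \<and> (\<forall>p\<in>pts M. 0 < f p) \<and>
     (let \<xi>t = (\<lambda>p. exp (- f p / 2) *\<^sub>R \<xi> p);
          \<eta>t = (\<lambda>p v. exp (f p / 2) * \<eta> p v);
          gt = (\<lambda>p u v. exp (f p) * g p u v)
      in kenmotsu M \<phi> \<xi>t \<eta>t gt \<and> const_phi_sectional_curvature M \<phi> \<xi>t gt c)"

definition lee_form :: "('a \<Rightarrow> real) \<Rightarrow> 'a \<Rightarrow> 'a tvec \<Rightarrow> real"
  where "lee_form f p v = v f"

definition is_gradient ::
    "('a, 'e::euclidean_space) mfd \<Rightarrow> 'a metric_tensor \<Rightarrow> ('a \<Rightarrow> real) \<Rightarrow> 'a vfield \<Rightarrow> bool" where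
  "is_gradient M g f G \<longleftrightarrow> vector_field M (pts M) G \<and>
     (\<forall>p\<in>pts M. \<forall>v\<in>tangent_space M p. g p (G p) v = v f)"

section \<open>Submanifolds\<close>

text \<open>
  \<open>S\<close> is an embedded submanifold of \<open>M\<close>: it carries the subspace topology, and around each of its
  points there is a chart of \<open>M\<close> in which it is a linear slice (the range of an injective linear
  map \<open>j\<close>), the remaining coordinates forming a chart of \<open>S\<close>.
\<close>

definition embedded_submanifold ::
    "('a, 'e::euclidean_space) mfd \<Rightarrow> ('a, 'f::euclidean_space) mfd \<Rightarrow> bool" where
  "embedded_submanifold M S \<longleftrightarrow>
     smooth_manifold S \<and> pts S \<subseteq> pts M \<and> mtop S = subtopology (mtop M) (pts S) \<and>
     (\<forall>p\<in>pts S. \<exists>U x (j :: 'f \<Rightarrow> 'e). (U, x) \<in> charts M \<and> p \<in> U \<and> linear j \<and> inj j \<and>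
        x ` (U \<inter> pts S) = x ` U \<inter> range j \<and> (U \<inter> pts S, inv j \<circ> x) \<in> charts S)"

text \<open>The differential at \<open>p\<close> of the inclusion of a submanifold into \<open>M\<close>; a function smooth on
  \<open>M\<close> near \<open>p\<close> is also smooth on the submanifold near \<open>p\<close>.\<close>

definition incl :: "('a, 'e::euclidean_space) mfd \<Rightarrow> 'a \<Rightarrow> 'a tvec \<Rightarrow> 'a tvec" where
  "incl M p v = (\<lambda>F. if smooth_at M p F then v F else 0)"

definition tangent_to ::
    "('a, 'e::euclidean_space) mfd \<Rightarrow> ('a, 'f::euclidean_space) mfd \<Rightarrow> 'a vfield \<Rightarrow> bool" where
  "tangent_to M S X \<longleftrightarrow> (\<forall>p\<in>pts S. X p \<in> incl M p ` tangent_space S p)"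

definition induced_metric ::
    "('a, 'e::euclidean_space) mfd \<Rightarrow> 'a metric_tensor \<Rightarrow> 'a metric_tensor" where
  "induced_metric M g = (\<lambda>p u v. g p (incl M p u) (incl M p v))"

text \<open>Smooth sections of \<open>TM\<close> restricted to \<open>S\<close>.\<close>

definition vector_field_along ::
    "('a, 'e::euclidean_space) mfd \<Rightarrow> ('a, 'f::euclidean_space) mfd \<Rightarrow> 'a vfield \<Rightarrow> bool" where
  "vector_field_along M S W \<longleftrightarrow> (\<forall>p\<in>pts S. W p \<in> tangent_space M p) \<and>
     (\<forall>V F. openin (mtop M) V \<and> smooth_fun M V F \<longrightarrow>
        smooth_fun S (V \<inter> pts S) (\<lambda>p. W p F))"

definition unit_normal_field ::
    "('a, 'e::euclidean_space) mfd \<Rightarrow> ('a, 'f::euclidean_space) mfd \<Rightarrow> 'a metric_tensor \<Rightarrow>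
     'a vfield \<Rightarrow> bool" where
  "unit_normal_field M S g N \<longleftrightarrow> vector_field_along M S N \<and>
     (\<forall>p\<in>pts S. g p (N p) (N p) = 1 \<and>
        (\<forall>v\<in>tangent_space S p. g p (N p) (incl M p v) = 0))"

text \<open>
  \<open>cov_deriv_along M S nabla W p v w\<close> says that \<open>w = \<nabla>\<^sub>v W\<close> at \<open>p\<close>, for \<open>v\<close> tangent to \<open>S\<close> at \<open>p\<close>
  and a field \<open>W\<close> along \<open>S\<close>.  It is computed from local extensions of \<open>v\<close> and \<open>W\<close> to \<open>M\<close>; the
  result does not depend on them.
\<close>

definition cov_deriv_along ::
    "('a, 'e::euclidean_space) mfd \<Rightarrow> ('a, 'f::euclidean_space) mfd \<Rightarrow> 'a conn \<Rightarrow> 'a vfield \<Rightarrow>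
     'a \<Rightarrow> 'a tvec \<Rightarrow> 'a tvec \<Rightarrow> bool" where
  "cov_deriv_along M S nabla W p v w \<longleftrightarrow>
     (\<exists>U Xe We. openin (mtop M) U \<and> p \<in> U \<and> vector_field M U Xe \<and> vector_field M U We \<and>
        Xe p = incl M p v \<and> (\<forall>q\<in>U \<inter> pts S. We q = W q) \<and> w = nabla Xe We p)"

text \<open>\<open>AX = - \<nabla>\<^sub>X N\<close>\<close>

definition is_shape_operator ::
    "('a, 'e::euclidean_space) mfd \<Rightarrow> ('a, 'f::euclidean_space) mfd \<Rightarrow> 'a conn \<Rightarrow> 'a vfield \<Rightarrow>
     ('a \<Rightarrow> 'a tvec \<Rightarrow> 'a tvec) \<Rightarrow> bool" where
  "is_shape_operator M S nabla N A \<longleftrightarrow> tensor11 S A \<and>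
     (\<forall>p\<in>pts S. \<forall>v\<in>tangent_space S p.
        cov_deriv_along M S nabla N p v (- incl M p (A p v)))"

text \<open>\<open>(\<nabla>\<^sub>X A) Y = \<theta>(X) A Y\<close>\<close>

definition recurrent ::
    "('a, 'f::euclidean_space) mfd \<Rightarrow> 'a conn \<Rightarrow> ('a \<Rightarrow> 'a tvec \<Rightarrow> 'a tvec) \<Rightarrow> bool" where
  "recurrent S nabla A \<longleftrightarrow>
     (\<exists>\<theta>. one_form S \<theta> \<and>
       (\<forall>U X Y. openin (mtop S) U \<and> vector_field S U X \<and> vector_field S U Y \<longrightarrow>
         (\<forall>p\<in>U. nabla X (\<lambda>q. A q (Y q)) p - A p (nabla X Y p) = \<theta> p (X p) *\<^sub>R A p (Y p))))"

definition totally_geodesic ::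
    "('a, 'f::euclidean_space) mfd \<Rightarrow> ('a \<Rightarrow> 'a tvec \<Rightarrow> 'a tvec) \<Rightarrow> bool" where
  "totally_geodesic S A \<longleftrightarrow> (\<forall>p\<in>pts S. \<forall>v\<in>tangent_space S p. A p v = 0)"

text \<open>A distribution: a subbundle of the tangent bundle of constant rank with smooth local
  frames.\<close>

definition distribution ::
    "('a, 'f::euclidean_space) mfd \<Rightarrow> ('a \<Rightarrow> 'a tvec set) \<Rightarrow> bool" where
  "distribution S D \<longleftrightarrow>
     (\<exists>k. \<forall>p\<in>pts S. \<exists>U (X :: nat \<Rightarrow> 'a vfield).
        openin (mtop S) U \<and> p \<in> U \<and> (\<forall>i<k. vector_field S U (X i)) \<and>
        (\<forall>q\<in>U. inj_on (\<lambda>i. X i q) {..<k} \<and> independent ((\<lambda>i. X i q) ` {..<k}) \<and>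
           D q = span ((\<lambda>i. X i q) ` {..<k})))"

text \<open>
  The choice \<open>D\<^sup>\<bottom> = span {U, \<xi>}\<close> with \<open>U = - \<phi> N\<close>, and \<open>D\<close> its orthogonal complement, always
  satisfies the conditions below; the definition allows any admissible pair, \<open>E\<close> being \<open>D\<^sup>\<bottom>\<close>.
\<close>

definition cr_hypersurface ::
    "('a, 'e::euclidean_space) mfd \<Rightarrow> ('a, 'f::euclidean_space) mfd \<Rightarrow>
     ('a \<Rightarrow> 'a tvec \<Rightarrow> 'a tvec) \<Rightarrow> 'a vfield \<Rightarrow> 'a metric_tensor \<Rightarrow> bool" where
  "cr_hypersurface M S \<phi> \<xi> g \<longleftrightarrow>
     embedded_submanifold M S \<and> DIM('e) = DIM('f) + 1 \<and> tangent_to M S \<xi> \<and>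
     (\<exists>D E. distribution S D \<and> distribution S E \<and>
       (\<forall>p\<in>pts S.
          (\<forall>v\<in>tangent_space S p. \<exists>u\<in>D p. \<exists>w\<in>E p. v = u + w) \<and>
          (\<forall>u\<in>D p. \<forall>w\<in>E p. induced_metric M g p u w = 0) \<and>
          (\<forall>u\<in>D p. \<phi> p (incl M p u) \<in> incl M p ` D p) \<and>
          (\<forall>w\<in>E p. \<forall>v\<in>tangent_space S p. g p (\<phi> p (incl M p w)) (incl M p v) = 0)))"

end

(*
  Since g~ = e^f g, Koszul's formula turns the Kenmotsu identity nabla~_X xi~ = X - eta~(X) xi~ into
    g(nabla_X xi, Z) = (e^(f/2) - beta/2) g(X, Z) - e^(f/2) eta(X) eta(Z) + eta(X) omega(Z) / 2.
  As the Lee vector field is tangent, nabla_X xi is then tangent for every tangent X, so A xi = 0.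
  Recurrence applied to A xi = 0 gives A(nabla'_X xi) = 0, nabla' being the induced connection, and for
  X orthogonal to xi this reads (e^(f/2) - beta/2) A X = 0; hence (e^(f/2) - beta/2) A = 0 at each point.
  In local coordinates, recurrence is a linear first-order system for the components of A, so on a
  connected hypersurface A vanishes everywhere as soon as it vanishes at one point.
*)
theory Submission
  imports Defs
begin

section \<open>Smoothness between open sets of Euclidean spaces: locality and closure rules\<close>

section \<open>Smooth maps\<close>


text \<open>The pointwise identity
  \<open>(exp (f p / 2) - \<xi> p f / 2) *\<^sub>R A p v = 0\<close> alone does not give the
  alternative, since one factor could vanish at some points and the other factor elsewhere.
  Propagation of zeros of \<open>A\<close> closes this gap: unless \<open>A\<close> is zero
  throughout, it is nonzero at every point, and then the scalar factor vanishes at every point.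

  Tangent vectors of \<open>S\<close> and of \<open>M\<close> are different operators, acting on
  functions smooth near the point in \<open>S\<close> and in \<open>M\<close> respectively.
  \<open>A\<close> acts on those of \<open>S\<close>, so \<xi> has to be lifted to a smooth field on
  \<open>S\<close>, and computations run on pairs of fields related by the inclusion.

  No Gauss formula is set up. The induced connection is reached only through products with tangent
  vectors, where the Koszul formulas of \<open>S\<close> and \<open>M\<close> agree term by term;
  nondegeneracy of the induced metric then recovers the vectors themselves. Likewise the extensions
  hidden in the definition of the shape operator are arbitrary, and are handled by tensoriality in
  the direction and by differentiating along \<open>S\<close> only.\<close>

lemma has_derivative_cong_open:
  assumes "open S" "x \<in> S" "\<And>y. y \<in> S \<Longrightarrow> f y = g y"
  shows "(f has_derivative D) (at x) \<longleftrightarrow> (g has_derivative D) (at x)"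
  using assms has_derivative_transform_within_open by metis

lemma frechet_derivative_cong_open:
  assumes "open S" "x \<in> S" "\<And>y. y \<in> S \<Longrightarrow> f y = g y"
  shows "frechet_derivative f (at x) = frechet_derivative g (at x)"
  unfolding frechet_derivative_def using has_derivative_cong_open[OF assms] by simp

lemma differentiable_cong_open:
  assumes "open S" "x \<in> S" "\<And>y. y \<in> S \<Longrightarrow> f y = g y"
  shows "f differentiable (at x) \<longleftrightarrow> g differentiable (at x)"
  unfolding differentiable_def using has_derivative_cong_open[OF assms] by simp

lemma frechet_derivative_eq:
  "(f has_derivative D) (at x) \<Longrightarrow> frechet_derivative f (at x) v = D v"
  using frechet_derivative_at by metis

text \<open>Openness lets every derivative at a point of \<open>S\<close> see values in
  \<open>S\<close> only. Coordinate expressions depend on this, because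
  \<open>F \<circ> inv_into U x\<close> has arbitrary values off the chart image.\<close>

lemma C_k_cong:
  assumes "open S" "\<And>x. x \<in> S \<Longrightarrow> f x = g x"
  shows "C_k k S f \<longleftrightarrow> C_k k S g"
  using assms(2)
proof (induction k arbitrary: f g)
  case 0
  then show ?case by simp
next
  case (Suc k)
  have "C_k k S (\<lambda>x. frechet_derivative f (at x) v) \<longleftrightarrow> C_k k S (\<lambda>x. frechet_derivative g (at x) v)" for v
    by (rule Suc.IH) (use frechet_derivative_cong_open[OF assms(1) _ Suc.prems] in auto)
  with differentiable_cong_open[OF assms(1) _ Suc.prems] show ?case by auto
qed

lemma C_k_subset: "C_k k S f \<Longrightarrow> T \<subseteq> S \<Longrightarrow> C_k k T f"
  by (induction k arbitrary: f) (auto intro: continuous_on_subset)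

lemma C_k_local:
  assumes "\<And>x. x \<in> S \<Longrightarrow> \<exists>T. open T \<and> x \<in> T \<and> C_k k T f"
  shows "C_k k S f"
  using assms
proof (induction k arbitrary: f)
  case 0
  then show ?case
    by (metis C_k.simps(1) continuous_at_imp_continuous_on continuous_on_eq_continuous_at)
next
  case (Suc k)
  then show ?case by (metis C_k.simps(2))
qed

text \<open>\<open>C_k (Suc k)\<close> does not mention lower orders. At order zero
  differentiability supplies the continuity; higher orders pass the claim on to the directional
  derivatives.\<close>

lemma C_k_SucD: "C_k (Suc k) S f \<Longrightarrow> C_k k S f"
proof (induction k arbitrary: f)
  case 0
  then show ?case
    by (simp add: continuous_at_imp_continuous_on differentiable_imp_continuous_within)
next
  case (Suc k)
  then show ?case by (metis C_k.simps(2))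
qed

lemma C_k_const: "C_k k S (\<lambda>x. c)"
  by (induction k arbitrary: c) auto

lemma C_k_bounded_linear:
  assumes "bounded_linear L" shows "C_k k S L"
  using assms
  by (cases k) (auto simp: frechet_derivative_at[OF bounded_linear_imp_has_derivative, symmetric]
      C_k_const bounded_linear_imp_differentiable linear_continuous_on)

lemma C_k_linear_image:
  assumes L: "bounded_linear L" and S: "open S" and "C_k k S f"
  shows "C_k k S (\<lambda>x. L (f x))"
  using assms(3)
proof (induction k arbitrary: f)
  case 0
  then show ?case using bounded_linear.continuous_on[OF L] by auto
next
  case (Suc k)
  have der: "((\<lambda>x. L (f x)) has_derivative (\<lambda>v. L (frechet_derivative f (at x) v))) (at x)"
    if "x \<in> S" for x
    using Suc.prems that bounded_linear.has_derivative[OF L] frechet_derivative_works by fastforce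
  have "C_k k S (\<lambda>x. frechet_derivative (\<lambda>x. L (f x)) (at x) v)" for v
    by (subst C_k_cong[OF S, of _ "\<lambda>x. L (frechet_derivative f (at x) v)"])
       (use Suc frechet_derivative_eq[OF der] in auto)
  with der show ?case by (auto simp: differentiable_def)
qed

lemma C_k_add:
  assumes S: "open S" and "C_k k S f" "C_k k S g"
  shows "C_k k S (\<lambda>x. f x + g x)"
  using assms(2,3)
proof (induction k arbitrary: f g)
  case 0
  then show ?case by (auto intro: continuous_intros)
next
  case (Suc k)
  have der: "((\<lambda>x. f x + g x) has_derivative
      (\<lambda>v. frechet_derivative f (at x) v + frechet_derivative g (at x) v)) (at x)" if "x \<in> S" for x
    using Suc.prems that by (auto intro!: has_derivative_add simp: frechet_derivative_works[symmetric])
  have "C_k k S (\<lambda>x. frechet_derivative (\<lambda>x. f x + g x) (at x) v)" for v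
    by (subst C_k_cong[OF S, of _ "\<lambda>x. frechet_derivative f (at x) v + frechet_derivative g (at x) v"])
       (use Suc frechet_derivative_eq[OF der] in auto)
  with der show ?case by (auto simp: differentiable_def)
qed

lemma C_k_sum:
  assumes "open S" "\<And>i. i \<in> I \<Longrightarrow> C_k k S (f i)"
  shows "C_k k S (\<lambda>x. \<Sum>i\<in>I. f i x)"
  using assms(2)
  by (induction I rule: infinite_finite_induct) (auto intro: C_k_const C_k_add[OF assms(1)])

lemma C_k_scaleR:
  fixes f :: "'e::euclidean_space \<Rightarrow> real" and g :: "'e \<Rightarrow> 'b::real_normed_vector"
  assumes S: "open S" and "C_k k S f" "C_k k S g"
  shows "C_k k S (\<lambda>x. f x *\<^sub>R g x)"
  using assms(2,3)
proof (induction k arbitrary: f g)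
  case 0
  then show ?case by (auto intro: continuous_intros)
next
  case (Suc k)
  have der: "((\<lambda>x. f x *\<^sub>R g x) has_derivative
      (\<lambda>v. f x *\<^sub>R frechet_derivative g (at x) v + frechet_derivative f (at x) v *\<^sub>R g x)) (at x)"
    if "x \<in> S" for x
    using Suc.prems that
    by (auto intro!: has_derivative_scaleR simp: frechet_derivative_works[symmetric])
  have "C_k k S (\<lambda>x. frechet_derivative (\<lambda>x. f x *\<^sub>R g x) (at x) v)" for v
  proof (subst C_k_cong[OF S])
    show "frechet_derivative (\<lambda>x. f x *\<^sub>R g x) (at x) v =
      f x *\<^sub>R frechet_derivative g (at x) v + frechet_derivative f (at x) v *\<^sub>R g x" if "x \<in> S" for x
      by (rule frechet_derivative_eq[OF der[OF that]])
    \<comment> \<open>Each term of the product rule keeps one factor undifferentiated; that factor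
      is known to order \<open>Suc k\<close> and is lowered to order \<open>k\<close> before the
      induction hypothesis applies.\<close>
    show "C_k k S (\<lambda>x. f x *\<^sub>R frechet_derivative g (at x) v + frechet_derivative f (at x) v *\<^sub>R g x)"
      by (intro C_k_add[OF S] Suc.IH C_k_SucD[OF Suc.prems(1)] C_k_SucD[OF Suc.prems(2)])
         (use Suc.prems in auto)
  qed
  with der show ?case by (auto simp: differentiable_def)
qed

text \<open>The chain rule differentiates \<open>g\<close> in a direction that varies with the
  point, whereas \<open>C_k\<close> controls derivatives in fixed directions. Expanding that
  direction in the basis gives a sum of products of scalar functions with derivatives of
  \<open>g\<close> in fixed directions, to which the induction applies.\<close>

lemma C_k_comp:
  fixes f :: "'e::euclidean_space \<Rightarrow> 'd::euclidean_space" and g :: "'d \<Rightarrow> 'b::real_normed_vector"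
  assumes S: "open S" and "C_k k S f" "C_k k T g" "f ` S \<subseteq> T"
  shows "C_k k S (\<lambda>x. g (f x))"
  using assms(2,3)
proof (induction k arbitrary: g)
  case 0
  then show ?case using assms(4) by (auto intro: continuous_on_compose2)
next
  case (Suc k)
  have der: "((\<lambda>x. g (f x)) has_derivative
      (\<lambda>v. frechet_derivative g (at (f x)) (frechet_derivative f (at x) v))) (at x)"
    if "x \<in> S" for x
    by (rule has_derivative_compose[where f=f])
       (use Suc.prems that assms(4) in \<open>auto simp: frechet_derivative_works[symmetric]\<close>)
  have "C_k k S (\<lambda>x. frechet_derivative (\<lambda>x. g (f x)) (at x) v)" for v
  proof (subst C_k_cong[OF S])
    show "frechet_derivative (\<lambda>x. g (f x)) (at x) v =
      (\<Sum>b\<in>Basis. (frechet_derivative f (at x) v \<bullet> b) *\<^sub>R frechet_derivative g (at (f x)) b)"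
      if "x \<in> S" for x
    proof -
      have "linear (frechet_derivative g (at (f x)))"
        using Suc.prems(2) that assms(4) by (auto intro: linear_frechet_derivative)
      then have "frechet_derivative g (at (f x)) (\<Sum>b\<in>Basis. (w \<bullet> b) *\<^sub>R b) =
        (\<Sum>b\<in>Basis. (w \<bullet> b) *\<^sub>R frechet_derivative g (at (f x)) b)" for w
        by (simp add: linear_sum linear_scale)
      then show ?thesis
        unfolding frechet_derivative_eq[OF der[OF that]] euclidean_representation .
    qed
    show "C_k k S (\<lambda>x. \<Sum>b\<in>Basis. (frechet_derivative f (at x) v \<bullet> b) *\<^sub>R
        frechet_derivative g (at (f x)) b)"
    proof (rule C_k_sum[OF S], rule C_k_scaleR[OF S])
      fix b :: 'd
      show "C_k k S (\<lambda>x. frechet_derivative f (at x) v \<bullet> b)"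
        using Suc.prems(1) by (auto intro: C_k_linear_image[OF bounded_linear_inner_left S])
      show "C_k k S (\<lambda>x. frechet_derivative g (at (f x)) b)"
        using Suc.prems(2) by (intro Suc.IH C_k_SucD[OF Suc.prems(1)]) auto
    qed
  qed
  with der show ?case by (auto simp: differentiable_def)
qed

lemma C_inf_cong:
  assumes "open S" "\<And>x. x \<in> S \<Longrightarrow> f x = g x"
  shows "C_inf S f \<longleftrightarrow> C_inf S g"
  unfolding C_inf_def using C_k_cong[OF assms] by simp

lemma C_inf_subset: "C_inf S f \<Longrightarrow> T \<subseteq> S \<Longrightarrow> C_inf T f"
  unfolding C_inf_def using C_k_subset by blast

lemma C_inf_local:
  assumes "\<And>x. x \<in> S \<Longrightarrow> \<exists>T. open T \<and> x \<in> T \<and> C_inf T f"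
  shows "C_inf S f"
  unfolding C_inf_def using assms C_k_local[of S _ f] by (meson C_inf_def)

lemma C_inf_const: "C_inf S (\<lambda>x. c)"
  by (simp add: C_inf_def C_k_const)

lemma C_inf_bounded_linear: "bounded_linear L \<Longrightarrow> C_inf S L"
  by (simp add: C_inf_def C_k_bounded_linear)

lemma C_inf_add: "open S \<Longrightarrow> C_inf S f \<Longrightarrow> C_inf S g \<Longrightarrow> C_inf S (\<lambda>x. f x + g x)"
  by (simp add: C_inf_def C_k_add)

lemma C_inf_mult:
  "open S \<Longrightarrow> C_inf S f \<Longrightarrow> C_inf S g \<Longrightarrow> C_inf S (\<lambda>x. f x * (g x :: real))"
  using C_k_scaleR[of S _ f g] by (simp add: C_inf_def)

lemma C_inf_comp:
  fixes f :: "'e::euclidean_space \<Rightarrow> 'd::euclidean_space"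
  assumes "open S" "C_inf S f" "C_inf T g" "f ` S \<subseteq> T"
  shows "C_inf S (\<lambda>x. g (f x))"
  using assms C_k_comp[of S _ f T g] by (auto simp: C_inf_def)

lemma C_inf_differentiable: "C_inf S f \<Longrightarrow> x \<in> S \<Longrightarrow> f differentiable (at x)"
  unfolding C_inf_def by (metis C_k.simps(2))

lemma C_inf_has_derivative:
  "C_inf S f \<Longrightarrow> x \<in> S \<Longrightarrow> (f has_derivative frechet_derivative f (at x)) (at x)"
  using C_inf_differentiable frechet_derivative_works by blast

lemma C_inf_frechet_derivative: "C_inf S f \<Longrightarrow> C_inf S (\<lambda>x. frechet_derivative f (at x) v)"
  unfolding C_inf_def by (metis C_k.simps(2))

lemma C_inf_continuous_on: "C_inf S f \<Longrightarrow> continuous_on S f"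
  unfolding C_inf_def by (metis C_k.simps(1))

lemma C_inf_exp: "C_inf UNIV (exp :: real \<Rightarrow> real)"
proof -
  have "C_k k UNIV (exp :: real \<Rightarrow> real)" for k
  proof (induction k)
    case 0
    then show ?case by (simp add: continuous_on_exp)
  next
    case (Suc k)
    have der: "(exp has_derivative (\<lambda>v. v * exp x)) (at x)" for x :: real
      by (auto intro!: derivative_eq_intros)
    have "C_k k UNIV (\<lambda>x. v * exp x)" for v :: real
      using C_k_scaleR[OF open_UNIV C_k_const[of k UNIV v] Suc] by simp
    then show ?case
      using der by (auto simp: frechet_derivative_at[OF der, symmetric] differentiable_def)
  qed
  then show ?thesis by (simp add: C_inf_def)
qed

section \<open>Charts and the identification of tangent spaces with coordinate vectors\<close>

section \<open>Charts and coordinate vectors\<close>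


lemma is_chart_inj: "is_chart T (U, x) \<Longrightarrow> inj_on x U"
  unfolding is_chart_def
  by (auto dest!: homeomorphic_imp_injective_map openin_subset simp: Int_absorb1)

lemma is_chart_openin: "is_chart T (U, x) \<Longrightarrow> openin T U"
  by (simp add: is_chart_def)

lemma is_chart_open_image:
  assumes "is_chart T (U, x)" "openin T V"
  shows "open (x ` (U \<inter> V))"
proof -
  have "openin (top_of_set (x ` U)) (x ` (U \<inter> V))"
    using assms homeomorphic_imp_open_map[of "subtopology T U" "top_of_set (x ` U)" x]
    by (auto simp: is_chart_def open_map_def openin_subtopology_Int2)
  then show ?thesis
    using assms by (auto simp: is_chart_def intro: openin_open_trans)
qed

lemma is_chart_openin_vimage:
  assumes "is_chart T (U, x)" "open Q"
  shows "openin T {q \<in> U. x q \<in> Q}"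
proof -
  have U: "openin T U" and c: "continuous_map (subtopology T U) (top_of_set (x ` U)) x"
    using assms homeomorphic_imp_continuous_map by (auto simp: is_chart_def)
  have "openin (subtopology T U)
      {q \<in> topspace (subtopology T U). x q \<in> x ` U \<inter> Q}"
    by (rule openin_continuous_map_preimage[OF c]) (use assms in auto)
  moreover have "{q \<in> topspace (subtopology T U). x q \<in> x ` U \<inter> Q} = {q \<in> U. x q \<in> Q}"
    using openin_subset[OF U] by auto
  ultimately show ?thesis
    using U openin_trans_full by metis
qed

lemma compatible_sym: "compatible c d \<longleftrightarrow> compatible d c"
  by (auto simp: compatible_def Int_commute split: prod.splits)

text \<open>On the overlap \<open>F \<circ> inv_into W z\<close> is
  \<open>F \<circ> inv_into U x\<close> after the smooth transition map
  \<open>x \<circ> inv_into W z\<close>.\<close>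

lemma C_inf_chart_change:
  assumes c: "is_chart T (U, x)" and d: "is_chart T (W, z)" and comp: "compatible (U, x) (W, z)"
    and V: "openin T V" and F: "C_inf (x ` (U \<inter> V)) (F \<circ> inv_into U x)"
  shows "C_inf (z ` (W \<inter> (U \<inter> V))) (F \<circ> inv_into W z)"
proof -
  have UV: "openin T (U \<inter> V)"
    using V is_chart_openin[OF c] by blast
  have o: "open (z ` (W \<inter> (U \<inter> V)))"
    by (rule is_chart_open_image[OF d UV])
  have "C_inf (z ` (U \<inter> W)) (x \<circ> inv_into W z)"
    using comp by (simp add: compatible_def)
  then have "C_inf (z ` (W \<inter> (U \<inter> V))) (x \<circ> inv_into W z)"
    by (rule C_inf_subset) auto
  moreover have "(x \<circ> inv_into W z) ` (z ` (W \<inter> (U \<inter> V))) \<subseteq> x ` (U \<inter> V)"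
    using is_chart_inj[OF d] by auto
  ultimately have "C_inf (z ` (W \<inter> (U \<inter> V))) (\<lambda>y. (F \<circ> inv_into U x) ((x \<circ> inv_into W z) y))"
    using C_inf_comp[OF o _ F] by metis
  then show ?thesis
    by (rule iffD1[OF C_inf_cong[OF o], rotated])
       (use is_chart_inj[OF c] is_chart_inj[OF d] in auto)
qed

text \<open>The cut-off to zero copies the one in \<open>velocity\<close>, so that both can be equal
  as operators on all functions.\<close>

definition coord_vec ::
    "('a, 'e::euclidean_space) mfd \<Rightarrow> 'a set \<Rightarrow> ('a \<Rightarrow> 'e) \<Rightarrow> 'e \<Rightarrow> 'a vfield" where
  "coord_vec M U x c p = (\<lambda>F. if smooth_at M p F
     then frechet_derivative (F \<circ> inv_into U x) (at (x p)) c else 0)"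

text \<open>Inverse to \<open>coord_vec\<close> on tangent vectors: the components are the
  derivatives of the coordinate functions. It is linear on arbitrary operators, not only on tangent
  vectors.\<close>

definition chart_comp :: "('a \<Rightarrow> 'e::euclidean_space) \<Rightarrow> 'a tvec \<Rightarrow> 'e" where
  "chart_comp x v = (\<Sum>b\<in>Basis. v (\<lambda>q. x q \<bullet> b) *\<^sub>R b)"

locale smooth_mfd =
  fixes M :: "('a, 'e::euclidean_space) mfd"
  assumes smooth_manifold: "smooth_manifold M"
begin

lemma atlas_subset_charts: "atlas M \<subseteq> charts M"
  using smooth_manifold by (auto simp: smooth_manifold_def charts_def)

lemma atlas_chart_at:
  assumes "p \<in> pts M"
  obtains U x where "(U, x) \<in> atlas M" "p \<in> U"
  using assms smooth_manifold by (fastforce simp: smooth_manifold_def)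

lemma chart_at:
  assumes "p \<in> pts M"
  obtains U x where "(U, x) \<in> charts M" "p \<in> U"
  using assms atlas_chart_at atlas_subset_charts by blast

lemma chart_is_chart: "(U, x) \<in> charts M \<Longrightarrow> is_chart (mtop M) (U, x)"
  by (simp add: charts_def)

lemma charts_compatible:
  assumes "c \<in> charts M" "d \<in> atlas M"
  shows "compatible c d" "compatible d c"
  using assms compatible_sym unfolding charts_def by blast+

lemma chart_inj: "(U, x) \<in> charts M \<Longrightarrow> inj_on x U"
  by (metis chart_is_chart is_chart_inj)

lemma chart_openin: "(U, x) \<in> charts M \<Longrightarrow> openin (mtop M) U"
  by (metis chart_is_chart is_chart_openin)

lemma chart_subset: "(U, x) \<in> charts M \<Longrightarrow> U \<subseteq> pts M"
  by (metis chart_openin openin_subset)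

lemma chart_open_image: "(U, x) \<in> charts M \<Longrightarrow> openin (mtop M) V \<Longrightarrow> open (x ` (U \<inter> V))"
  by (metis chart_is_chart is_chart_open_image)

text \<open>Smoothness is defined through the given atlas, but slice charts of a submanifold are
  only known to lie in the maximal one, so the test has to extend to every compatible chart.\<close>

lemma smooth_fun_chart:
  assumes V: "openin (mtop M) V" and F: "smooth_fun M V F" and c: "(U, x) \<in> charts M"
  shows "C_inf (x ` (U \<inter> V)) (F \<circ> inv_into U x)"
proof (rule C_inf_local)
  fix y assume "y \<in> x ` (U \<inter> V)"
  then obtain p where p: "p \<in> U" "p \<in> V" "y = x p" by auto
  then obtain W z where d: "(W, z) \<in> atlas M" "p \<in> W"
    using atlas_chart_at openin_subset[OF V] by blast
  have d': "(W, z) \<in> charts M"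
    using d atlas_subset_charts by auto
  have "C_inf (z ` (W \<inter> V)) (F \<circ> inv_into W z)"
    using F d by (auto simp: smooth_fun_def Int_commute)
  then have "C_inf (x ` (U \<inter> (W \<inter> V))) (F \<circ> inv_into U x)"
    by (rule C_inf_chart_change[OF chart_is_chart[OF d'] chart_is_chart[OF c] _ V, rotated])
       (rule charts_compatible(2)[OF c d(1)])
  moreover have "open (x ` (U \<inter> (W \<inter> V)))"
    by (rule chart_open_image[OF c]) (use V chart_openin[OF d'] in blast)
  moreover have "y \<in> x ` (U \<inter> (W \<inter> V))"
    using p d by blast
  ultimately show "\<exists>T. open T \<and> y \<in> T \<and> C_inf T (F \<circ> inv_into U x)"
    by metis
qed

text \<open>Conversely, one chart of the maximal atlas around each point suffices, because it is
  compatible with every chart of the given atlas.\<close>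

lemma smooth_funI:
  assumes "\<And>p. p \<in> V \<Longrightarrow> \<exists>U x W. (U, x) \<in> charts M \<and> p \<in> U \<and> openin (mtop M) W \<and> p \<in> W \<and>
    C_inf (x ` (U \<inter> W)) (F \<circ> inv_into U x)"
  shows "smooth_fun M V F"
  unfolding smooth_fun_def
proof safe
  fix W z assume d: "(W, z) \<in> atlas M"
  show "C_inf (z ` (V \<inter> W)) (F \<circ> inv_into W z)"
  proof (rule C_inf_local)
    fix y assume "y \<in> z ` (V \<inter> W)"
    then obtain p where p: "p \<in> V" "p \<in> W" "y = z p" by auto
    obtain U x Q where c: "(U, x) \<in> charts M" "p \<in> U" and Q: "openin (mtop M) Q" "p \<in> Q"
      and F: "C_inf (x ` (U \<inter> Q)) (F \<circ> inv_into U x)"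
      using assms[OF p(1)] by blast
    have d': "(W, z) \<in> charts M"
      using d atlas_subset_charts by auto
    have "C_inf (z ` (W \<inter> (U \<inter> Q))) (F \<circ> inv_into W z)"
      by (rule C_inf_chart_change[OF chart_is_chart[OF c(1)] chart_is_chart[OF d'] _ Q(1) F])
        (rule charts_compatible(1)[OF c(1) d])
    moreover have "open (z ` (W \<inter> (U \<inter> Q)))"
      by (rule chart_open_image[OF d']) (use Q chart_openin[OF c(1)] in blast)
    moreover have "y \<in> z ` (W \<inter> (U \<inter> Q))"
      using p c Q by blast
    ultimately show "\<exists>T. open T \<and> y \<in> T \<and> C_inf T (F \<circ> inv_into W z)"
      by metis
  qed
qed

lemma smooth_fun_chartI:
  assumes "(U, x) \<in> charts M" "openin (mtop M) V" "V \<subseteq> U" "C_inf (x ` V) (F \<circ> inv_into U x)"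
  shows "smooth_fun M V F"
proof (rule smooth_funI)
  fix p assume "p \<in> V"
  moreover have "U \<inter> V = V" using assms(3) by blast
  ultimately show "\<exists>U x W. (U, x) \<in> charts M \<and> p \<in> U \<and> openin (mtop M) W \<and> p \<in> W \<and>
      C_inf (x ` (U \<inter> W)) (F \<circ> inv_into U x)"
    using assms by (intro exI[of _ U] exI[of _ x] exI[of _ V]) auto
qed

lemma smooth_fun_subset: "smooth_fun M V F \<Longrightarrow> W \<subseteq> V \<Longrightarrow> smooth_fun M W F"
  unfolding smooth_fun_def by (auto 4 3 dest: bspec intro: C_inf_subset[of "_ ` (V \<inter> _)"])

lemma smooth_fun_open_image:
  "(U, x) \<in> atlas M \<Longrightarrow> openin (mtop M) V \<Longrightarrow> open (x ` (V \<inter> U))"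
  using chart_open_image[OF subsetD[OF atlas_subset_charts]] by (simp add: Int_commute)

lemma smooth_fun_cong:
  assumes V: "openin (mtop M) V" and eq: "\<And>p. p \<in> V \<Longrightarrow> F p = G p"
  shows "smooth_fun M V F \<longleftrightarrow> smooth_fun M V G"
proof -
  have "C_inf (x ` (V \<inter> U)) (F \<circ> inv_into U x) \<longleftrightarrow> C_inf (x ` (V \<inter> U)) (G \<circ> inv_into U x)"
    if c: "(U, x) \<in> atlas M" for U x
    by (rule C_inf_cong[OF smooth_fun_open_image[OF c V]])
       (use eq chart_inj[OF subsetD[OF atlas_subset_charts c]] in auto)
  then show ?thesis
    unfolding smooth_fun_def by auto
qed

lemma smooth_fun_local:
  assumes "\<And>p. p \<in> V \<Longrightarrow> \<exists>W. openin (mtop M) W \<and> p \<in> W \<and> smooth_fun M W F"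
  shows "smooth_fun M V F"
  unfolding smooth_fun_def
proof safe
  fix U x assume c: "(U, x) \<in> atlas M"
  show "C_inf (x ` (V \<inter> U)) (F \<circ> inv_into U x)"
  proof (rule C_inf_local)
    fix y assume "y \<in> x ` (V \<inter> U)"
    then obtain p where p: "p \<in> V" "p \<in> U" "y = x p" by auto
    obtain W where W: "openin (mtop M) W" "p \<in> W" "smooth_fun M W F"
      using assms[OF p(1)] by blast
    then have "C_inf (x ` (W \<inter> U)) (F \<circ> inv_into U x)"
      using c by (auto simp: smooth_fun_def)
    moreover have "y \<in> x ` (W \<inter> U)" using p W by blast
    ultimately show "\<exists>T. open T \<and> y \<in> T \<and> C_inf T (F \<circ> inv_into U x)"
      using smooth_fun_open_image[OF c W(1)] by metis
  qed
qed

lemma smooth_fun_const: "smooth_fun M V (\<lambda>p. r)"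
  by (auto simp: smooth_fun_def o_def C_inf_const)

lemma smooth_fun_add:
  "openin (mtop M) V \<Longrightarrow> smooth_fun M V F \<Longrightarrow> smooth_fun M V G \<Longrightarrow> smooth_fun M V (\<lambda>p. F p + G p)"
  by (auto simp: smooth_fun_def o_def intro!: C_inf_add smooth_fun_open_image)

lemma smooth_fun_mult:
  "openin (mtop M) V \<Longrightarrow> smooth_fun M V F \<Longrightarrow> smooth_fun M V G \<Longrightarrow> smooth_fun M V (\<lambda>p. F p * G p)"
  by (auto simp: smooth_fun_def o_def intro!: C_inf_mult smooth_fun_open_image)

lemma smooth_fun_sum:
  assumes "openin (mtop M) V" "\<And>i. i \<in> I \<Longrightarrow> smooth_fun M V (F i)"
  shows "smooth_fun M V (\<lambda>p. \<Sum>i\<in>I. F i p)"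
  using assms(2)
  by (induction I rule: infinite_finite_induct)
     (auto intro: smooth_fun_const smooth_fun_add[OF assms(1)])

lemma smooth_fun_comp:
  fixes h :: "real \<Rightarrow> real"
  assumes "openin (mtop M) V" "smooth_fun M V F" "C_inf UNIV h"
  shows "smooth_fun M V (\<lambda>p. h (F p))"
  unfolding smooth_fun_def
proof safe
  fix U x assume c: "(U, x) \<in> atlas M"
  then have "C_inf (x ` (V \<inter> U)) (F \<circ> inv_into U x)"
    using assms(2) by (auto simp: smooth_fun_def)
  then have "C_inf (x ` (V \<inter> U)) (\<lambda>y. h ((F \<circ> inv_into U x) y))"
    by (rule C_inf_comp[OF smooth_fun_open_image[OF c assms(1)] _ assms(3)]) auto
  then show "C_inf (x ` (V \<inter> U)) ((\<lambda>p. h (F p)) \<circ> inv_into U x)"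
    by (simp add: o_def)
qed

lemma smooth_fun_coord:
  assumes c: "(U, x) \<in> charts M"
  shows "smooth_fun M U (\<lambda>q. x q \<bullet> b)"
proof (rule smooth_fun_chartI[OF c chart_openin[OF c]])
  have "open (x ` U)"
    using chart_open_image[OF c chart_openin[OF c]] by simp
  then show "C_inf (x ` U) ((\<lambda>q. x q \<bullet> b) \<circ> inv_into U x)"
    by (rule iffD2[OF C_inf_cong[of _ _ "\<lambda>y. y \<bullet> b"]])
       (auto simp: f_inv_into_f intro!: C_inf_bounded_linear bounded_linear_inner_left)
qed simp

lemma smooth_atI: "openin (mtop M) V \<Longrightarrow> smooth_fun M V F \<Longrightarrow> p \<in> V \<Longrightarrow> smooth_at M p F"
  by (auto simp: smooth_at_def)

lemma smooth_at_cong: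
  assumes V: "openin (mtop M) V" "p \<in> V" and eq: "\<And>q. q \<in> V \<Longrightarrow> F q = G q"
  shows "smooth_at M p F \<longleftrightarrow> smooth_at M p G"
proof -
  have "smooth_at M p G" if "smooth_at M p F" and eq: "\<And>q. q \<in> V \<Longrightarrow> F q = G q" for F G
  proof -
    obtain W where W: "openin (mtop M) W" "p \<in> W" "smooth_fun M W F"
      using \<open>smooth_at M p F\<close> by (auto simp: smooth_at_def)
    have VW: "openin (mtop M) (V \<inter> W)" using V W by blast
    have "smooth_fun M (V \<inter> W) F" using W smooth_fun_subset by blast
    then have "smooth_fun M (V \<inter> W) G" using smooth_fun_cong[OF VW, of F G] eq by auto
    then show ?thesis using VW V W smooth_atI by blast
  qed
  from this[of F G] this[of G F] eq show ?thesis by auto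
qed

lemma smooth_at_has_derivative:
  assumes "(U, x) \<in> charts M" "p \<in> U" "smooth_at M p F"
  shows "((F \<circ> inv_into U x) has_derivative frechet_derivative (F \<circ> inv_into U x) (at (x p))) (at (x p))"
proof -
  obtain V where "openin (mtop M) V" "p \<in> V" "smooth_fun M V F"
    using assms by (auto simp: smooth_at_def)
  then show ?thesis
    using C_inf_has_derivative[OF smooth_fun_chart[OF _ _ assms(1)]] assms(2) by blast
qed

lemma coord_vec_linear:
  assumes c: "(U, x) \<in> charts M" and p: "p \<in> U"
  shows "linear (\<lambda>c. coord_vec M U x c p)"
proof -
  have *: "linear (frechet_derivative (F \<circ> inv_into U x) (at (x p)))" if "smooth_at M p F" for F
    using smooth_at_has_derivative[OF c p that] has_derivative_linear by blast
  show ?thesis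
    by (rule linearI)
       (auto simp: coord_vec_def fun_eq_iff scaleR_fun_def linear_add[OF *] linear_scale[OF *])
qed

lemma coord_vec_coord:
  assumes c: "(U, x) \<in> charts M" and p: "p \<in> U"
  shows "coord_vec M U x c p (\<lambda>q. x q \<bullet> b) = c \<bullet> b"
proof -
  have o: "open (x ` U)"
    using chart_open_image[OF c chart_openin[OF c]] by simp
  have "((\<lambda>y. y \<bullet> b) has_derivative (\<lambda>y. y \<bullet> b)) (at (x p))"
    by (rule bounded_linear_imp_has_derivative[OF bounded_linear_inner_left])
  then have "(((\<lambda>q. x q \<bullet> b) \<circ> inv_into U x) has_derivative (\<lambda>y. y \<bullet> b)) (at (x p))"
    by (rule iffD2[OF has_derivative_cong_open[OF o], rotated -1]) (use p in \<open>auto simp: f_inv_into_f\<close>)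
  then show ?thesis
    using smooth_atI[OF chart_openin[OF c] smooth_fun_coord[OF c] p]
    by (simp add: coord_vec_def frechet_derivative_eq)
qed

lemma chart_comp_coord_vec:
  assumes "(U, x) \<in> charts M" "p \<in> U"
  shows "chart_comp x (coord_vec M U x c p) = c"
  unfolding chart_comp_def coord_vec_coord[OF assms] by (rule euclidean_representation)

text \<open>Continuity keeps the curve inside \<open>U\<close> near time 0, where
  \<open>F (\<gamma> t)\<close> factors as \<open>F \<circ> inv_into U x\<close> after
  \<open>x \<circ> \<gamma>\<close>. By the chain rule the velocity depends on the curve only
  through \<open>d\<close>.\<close>

lemma velocity_eq_coord_vec:
  assumes c: "(U, x) \<in> charts M" and p: "p \<in> U"
    and \<gamma>: "smooth_curve M {-e<..<e} \<gamma>" "0 < e" "\<gamma> 0 = p"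
    and d: "((x \<circ> \<gamma>) has_vector_derivative d) (at 0)"
  shows "velocity M \<gamma> = coord_vec M U x d p"
proof
  fix F
  show "velocity M \<gamma> F = coord_vec M U x d p F"
  proof (cases "smooth_at M p F")
    case True
    let ?D = "frechet_derivative (F \<circ> inv_into U x) (at (x p))"
    have der: "((F \<circ> inv_into U x) has_derivative ?D) (at (x p))"
      by (rule smooth_at_has_derivative[OF c p True])
    have "((\<lambda>t. (F \<circ> inv_into U x) ((x \<circ> \<gamma>) t)) has_derivative (\<lambda>t. ?D (t *\<^sub>R d))) (at 0)"
      by (rule has_derivative_compose[OF d[unfolded has_vector_derivative_def]]) (use der \<gamma>(3) in \<open>simp add: o_def\<close>)
    moreover have "openin (top_of_set {-e<..<e}) {t \<in> topspace (top_of_set {-e<..<e}). \<gamma> t \<in> U}"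
      by (rule openin_continuous_map_preimage[OF _ chart_openin[OF c]])
         (use \<gamma> in \<open>simp add: smooth_curve_def\<close>)
    then have o: "open {t \<in> {-e<..<e}. \<gamma> t \<in> U}"
      using openin_open_trans[OF _ open_greaterThanLessThan] by fastforce
    have "((\<lambda>t. (F \<circ> inv_into U x) ((x \<circ> \<gamma>) t)) has_derivative D) (at 0) \<longleftrightarrow>
        ((\<lambda>t. F (\<gamma> t)) has_derivative D) (at 0)" for D
      by (rule has_derivative_cong_open[OF o]) (use \<gamma> p chart_inj[OF c] in auto)
    ultimately have "((\<lambda>t. F (\<gamma> t)) has_derivative (\<lambda>t. ?D (t *\<^sub>R d))) (at 0)"
      by metis
    moreover have "linear ?D" using der has_derivative_linear by blast
    then have "(\<lambda>t. ?D (t *\<^sub>R d)) = (*) (?D d)"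
      by (auto simp: fun_eq_iff linear_scale)
    ultimately have "((\<lambda>t. F (\<gamma> t)) has_real_derivative ?D d) (at 0)"
      by (simp only: has_field_derivative_def)
    then show ?thesis
      using True \<gamma>(3) by (simp add: velocity_def coord_vec_def DERIV_imp_deriv)
  next
    case False
    then show ?thesis using \<gamma>(3) by (simp add: velocity_def coord_vec_def)
  qed
qed

text \<open>Curves are tested in charts of the given atlas only, while \<open>(U, x)\<close> may be
  any chart of the maximal atlas; an atlas chart around \<open>p\<close> and the transition map
  bridge the difference.\<close>

lemma smooth_curve_differentiable:
  assumes c: "(U, x) \<in> charts M" and p: "p \<in> U"
    and \<gamma>: "smooth_curve M {-e<..<e} \<gamma>" "0 < e" "\<gamma> 0 = p"
  shows "(x \<circ> \<gamma>) differentiable (at 0)"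
proof -
  obtain W z where d: "(W, z) \<in> atlas M" "p \<in> W"
    using p chart_subset[OF c] atlas_chart_at by blast
  then have d': "(W, z) \<in> charts M" using atlas_subset_charts by blast
  have o: "open {t \<in> {-e<..<e}. \<gamma> t \<in> V}" if "openin (mtop M) V" for V
  proof -
    have "openin (top_of_set {-e<..<e}) {t \<in> topspace (top_of_set {-e<..<e}). \<gamma> t \<in> V}"
      by (rule openin_continuous_map_preimage[OF _ that]) (use \<gamma> in \<open>simp add: smooth_curve_def\<close>)
    then show ?thesis
      using openin_open_trans[OF _ open_greaterThanLessThan] by fastforce
  qed
  let ?T = "{t \<in> {-e<..<e}. \<gamma> t \<in> U \<inter> W}"
  have oT: "open ?T" using o chart_openin[OF c] chart_openin[OF d'] by blast
  have "C_inf {t \<in> {-e<..<e}. \<gamma> t \<in> W} (z \<circ> \<gamma>)"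
    using \<gamma> d by (auto simp: smooth_curve_def)
  then have "C_inf ?T (z \<circ> \<gamma>)" by (rule C_inf_subset) auto
  moreover have "C_inf (z ` (U \<inter> W)) (x \<circ> inv_into W z)"
    using charts_compatible(1)[OF c d(1)] by (simp add: compatible_def)
  ultimately have "C_inf ?T (\<lambda>t. (x \<circ> inv_into W z) ((z \<circ> \<gamma>) t))"
    by (rule C_inf_comp[OF oT]) auto
  then have "C_inf ?T (x \<circ> \<gamma>)"
    by (rule iffD1[OF C_inf_cong[OF oT], rotated]) (use chart_inj[OF d'] in auto)
  then show ?thesis
    by (rule C_inf_differentiable) (use \<gamma> p d in auto)
qed

text \<open>The witness is the curve whose coordinates run along the straight line
  \<open>x p + t *\<^sub>R d\<close>; in an atlas chart it is this line followed by a transition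
  map.\<close>

lemma coord_vec_in_tangent_space:
  assumes c: "(U, x) \<in> charts M" and p: "p \<in> U"
  shows "coord_vec M U x d p \<in> tangent_space M p"
proof -
  have oU: "open (x ` U)"
    using chart_open_image[OF c chart_openin[OF c]] by simp
  have cont: "continuous_on UNIV (\<lambda>t. x p + t *\<^sub>R d)"
    by (intro continuous_intros)
  have "open ((\<lambda>t. x p + t *\<^sub>R d) -` (x ` U))"
    using oU cont by (rule open_vimage)
  then obtain e where e: "e > 0" "ball 0 e \<subseteq> (\<lambda>t. x p + t *\<^sub>R d) -` (x ` U)"
    using p by (force simp: open_contains_ball)
  have I: "x p + t *\<^sub>R d \<in> x ` U" if "t \<in> {-e<..<e}" for t
    using e(2) that by (auto simp: ball_def dist_norm subset_iff)
  define \<gamma> where "\<gamma> t = inv_into U x (x p + t *\<^sub>R d)" for t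
  have x\<gamma>: "x (\<gamma> t) = x p + t *\<^sub>R d" "\<gamma> t \<in> U" if "t \<in> {-e<..<e}" for t
    unfolding \<gamma>_def using I[OF that] by (auto simp: f_inv_into_f inv_into_into)
  have \<gamma>0: "\<gamma> 0 = p" using p chart_inj[OF c] by (simp add: \<gamma>_def)
  \<comment> \<open>Preimages under \<open>\<gamma>\<close> become preimages of chart images under
    an affine map. This yields both the continuity of \<open>\<gamma>\<close> and the openness of
    its domains in the atlas charts.\<close>
  have pre: "{t \<in> {-e<..<e}. \<gamma> t \<in> V} = {-e<..<e} \<inter> (\<lambda>t. x p + t *\<^sub>R d) -` (x ` (U \<inter> V))" for V
  proof -
    have "\<gamma> t \<in> V \<longleftrightarrow> x p + t *\<^sub>R d \<in> x ` (U \<inter> V)" if "t \<in> {-e<..<e}" for t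
      using x\<gamma>[OF that] chart_inj[OF c] by (metis IntI IntE imageE image_eqI inj_onD)
    then show ?thesis by auto
  qed
  have oV: "open {t \<in> {-e<..<e}. \<gamma> t \<in> V}" if "openin (mtop M) V" for V
    unfolding pre by (intro open_Int open_vimage cont chart_open_image[OF c that]) auto
  have curve: "smooth_curve M {-e<..<e} \<gamma>"
    unfolding smooth_curve_def
  proof safe
    show "continuous_map (top_of_set {-e<..<e}) (mtop M) \<gamma>"
      unfolding continuous_map_def
      using x\<gamma>(2) chart_subset[OF c] oV by (auto simp: openin_open_eq)
  next
    fix W z assume d: "(W, z) \<in> atlas M"
    then have d': "(W, z) \<in> charts M" using atlas_subset_charts by blast
    let ?T = "{t \<in> {-e<..<e}. \<gamma> t \<in> W}"
    have oT: "open ?T" by (rule oV[OF chart_openin[OF d']])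
    have "C_inf ?T (\<lambda>t. x p + t *\<^sub>R d)"
      by (intro C_inf_add oT C_inf_const C_inf_bounded_linear bounded_linear_scaleR_left)
    moreover have "C_inf (x ` (U \<inter> W)) (z \<circ> inv_into U x)"
      using charts_compatible(1)[OF c d] by (simp add: compatible_def)
    ultimately have "C_inf ?T (\<lambda>t. (z \<circ> inv_into U x) (x p + t *\<^sub>R d))"
      by (rule C_inf_comp[OF oT]) (use pre in auto)
    then show "C_inf ?T (z \<circ> \<gamma>)"
      by (simp add: \<gamma>_def o_def)
  qed
  have "((\<lambda>t. x p + t *\<^sub>R d) has_vector_derivative d) (at 0)"
    by (auto intro!: derivative_eq_intros)
  then have "((x \<circ> \<gamma>) has_vector_derivative d) (at 0)"
    unfolding has_vector_derivative_def
    by (rule iffD1[OF has_derivative_cong_open[of "{-e<..<e}"], rotated -1])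
       (use e x\<gamma> in auto)
  then have "velocity M \<gamma> = coord_vec M U x d p"
    by (rule velocity_eq_coord_vec[OF c p curve e(1) \<gamma>0])
  then show ?thesis
    unfolding tangent_space_def mem_Collect_eq
    using curve e(1) \<gamma>0 by (intro exI[of _ \<gamma>] exI[of _ e]) simp
qed

text \<open>Velocities of curves have no evident sum. As the range of a linear map they form a
  vector space, with the coordinate vectors as a frame.\<close>

lemma tangent_space_eq_range:
  assumes c: "(U, x) \<in> charts M" and p: "p \<in> U"
  shows "tangent_space M p = range (\<lambda>d. coord_vec M U x d p)"
proof
  show "range (\<lambda>d. coord_vec M U x d p) \<subseteq> tangent_space M p"
    using coord_vec_in_tangent_space[OF c p] by blast
  show "tangent_space M p \<subseteq> range (\<lambda>d. coord_vec M U x d p)"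
  proof
    fix v assume "v \<in> tangent_space M p"
    then obtain \<gamma> e where g: "v = velocity M \<gamma>" "smooth_curve M {-e<..<e} \<gamma>" "0 < e" "\<gamma> 0 = p"
      by (auto simp: tangent_space_def)
    then have "(x \<circ> \<gamma>) differentiable (at 0)"
      using smooth_curve_differentiable[OF c p] by blast
    then obtain d where "((x \<circ> \<gamma>) has_vector_derivative d) (at 0)"
      using vector_derivative_works by blast
    then show "v \<in> range (\<lambda>d. coord_vec M U x d p)"
      using velocity_eq_coord_vec[OF c p g(2-4)] g(1) by blast
  qed
qed

lemma coord_vec_chart_comp:
  assumes c: "(U, x) \<in> charts M" "p \<in> U" and v: "v \<in> tangent_space M p"
  shows "coord_vec M U x (chart_comp x v) p = v"
proof -
  obtain d where "v = coord_vec M U x d p"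
    using v unfolding tangent_space_eq_range[OF c] by blast
  then show ?thesis
    by (simp only: chart_comp_coord_vec[OF c])
qed

end

section \<open>Derivation rules, coordinate frames and local vector fields\<close>

section \<open>Tangent vectors, vector fields and connections\<close>


lemma chart_comp_inner: "b \<in> Basis \<Longrightarrow> chart_comp x v \<bullet> b = v (\<lambda>q. x q \<bullet> b)"
  by (simp add: chart_comp_def inner_sum_left inner_Basis if_distrib if_distribR cong: if_cong)

lemma vector_field_tangent: "vector_field M U X \<Longrightarrow> p \<in> U \<Longrightarrow> X p \<in> tangent_space M p"
  by (simp add: vector_field_def)

lemma vector_field_smooth:
  "vector_field M U X \<Longrightarrow> openin (mtop M) V \<Longrightarrow> V \<subseteq> U \<Longrightarrow> smooth_fun M V F \<Longrightarrow>
    smooth_fun M V (\<lambda>p. X p F)"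
  by (simp add: vector_field_def)

lemma vector_field_subset: "vector_field M U X \<Longrightarrow> V \<subseteq> U \<Longrightarrow> vector_field M V X"
  by (auto simp: vector_field_def subset_iff)

context smooth_mfd
begin

lemma tangent_coord_vec:
  assumes "(U, x) \<in> charts M" "p \<in> U" "v \<in> tangent_space M p"
  obtains d where "v = coord_vec M U x d p"
  using assms tangent_space_eq_range by blast

lemma subspace_tangent_space:
  assumes "p \<in> pts M"
  shows "subspace (tangent_space M p)"
proof -
  obtain U x where c: "(U, x) \<in> charts M" "p \<in> U"
    using chart_at[OF assms] by blast
  show ?thesis
    unfolding tangent_space_eq_range[OF c]
    by (rule linear_subspace_image[OF coord_vec_linear[OF c] subspace_UNIV])
qed

lemma tangent_add: "p \<in> pts M \<Longrightarrow> u \<in> tangent_space M p \<Longrightarrow> v \<in> tangent_space M p \<Longrightarrow> u + v \<in> tangent_space M p"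
  and tangent_diff: "p \<in> pts M \<Longrightarrow> u \<in> tangent_space M p \<Longrightarrow> v \<in> tangent_space M p \<Longrightarrow> u - v \<in> tangent_space M p"
  and tangent_scaleR: "p \<in> pts M \<Longrightarrow> u \<in> tangent_space M p \<Longrightarrow> r *\<^sub>R u \<in> tangent_space M p"
  and tangent_zero: "p \<in> pts M \<Longrightarrow> 0 \<in> tangent_space M p"
  using subspace_tangent_space subspace_add subspace_diff subspace_scale subspace_0
  by metis+

text \<open>No smoothness of \<open>F\<close> and \<open>G\<close> is assumed: the cut-off in a
  tangent vector is decided by smoothness near \<open>p\<close>, which is itself a local
  property.\<close>

lemma tangent_cong:
  assumes v: "v \<in> tangent_space M p" and V: "openin (mtop M) V" "p \<in> V"
    and eq: "\<And>q. q \<in> V \<Longrightarrow> F q = G q"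
  shows "v F = v G"
proof -
  have p: "p \<in> pts M" using V openin_subset by blast
  obtain U x where c: "(U, x) \<in> charts M" "p \<in> U"
    using chart_at[OF p] by blast
  obtain d where d: "v = coord_vec M U x d p"
    using tangent_coord_vec[OF c v] .
  have "frechet_derivative (F \<circ> inv_into U x) (at (x p)) = frechet_derivative (G \<circ> inv_into U x) (at (x p))"
    by (rule frechet_derivative_cong_open[OF chart_open_image[OF c(1) V(1)]])
       (use V c chart_inj[OF c(1)] eq in auto)
  moreover have "smooth_at M p F \<longleftrightarrow> smooth_at M p G"
    by (rule smooth_at_cong[OF V eq])
  ultimately show ?thesis
    by (simp add: d coord_vec_def)
qed

lemma smooth_at_obtain2:
  assumes "smooth_at M p F" "smooth_at M p G"
  obtains V where "openin (mtop M) V" "p \<in> V" "smooth_fun M V F" "smooth_fun M V G"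
proof -
  obtain V W where "openin (mtop M) V" "p \<in> V" "smooth_fun M V F"
    "openin (mtop M) W" "p \<in> W" "smooth_fun M W G"
    using assms by (auto simp: smooth_at_def)
  then show thesis
    using that[of "V \<inter> W"] smooth_fun_subset[of V F "V \<inter> W"] smooth_fun_subset[of W G "V \<inter> W"] by auto
qed

lemma tangent_mult:
  assumes p: "p \<in> pts M" and v: "v \<in> tangent_space M p" and F: "smooth_at M p F" and G: "smooth_at M p G"
  shows "v (\<lambda>q. F q * G q) = v F * G p + F p * v G"
proof -
  obtain U x where c: "(U, x) \<in> charts M" "p \<in> U"
    using chart_at[OF p] by blast
  obtain d where d: "v = coord_vec M U x d p"
    using tangent_coord_vec[OF c v] .
  have FG: "smooth_at M p (\<lambda>q. F q * G q)"
    using smooth_at_obtain2[OF F G] smooth_fun_mult smooth_atI by metis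
  have ip: "inv_into U x (x p) = p" using chart_inj[OF c(1)] c(2) by simp
  have "((\<lambda>y. (F \<circ> inv_into U x) y * (G \<circ> inv_into U x) y) has_derivative
      (\<lambda>h. (F \<circ> inv_into U x) (x p) * frechet_derivative (G \<circ> inv_into U x) (at (x p)) h +
        frechet_derivative (F \<circ> inv_into U x) (at (x p)) h * (G \<circ> inv_into U x) (x p))) (at (x p))"
    by (intro has_derivative_mult smooth_at_has_derivative[OF c] F G)
  then have "frechet_derivative ((\<lambda>q. F q * G q) \<circ> inv_into U x) (at (x p)) d =
      F p * frechet_derivative (G \<circ> inv_into U x) (at (x p)) d +
        frechet_derivative (F \<circ> inv_into U x) (at (x p)) d * G p"
    by (intro frechet_derivative_eq) (simp add: o_def ip)
  then show ?thesis
    using F G FG by (simp add: d coord_vec_def)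
qed

lemma tangent_comp:
  assumes p: "p \<in> pts M" and v: "v \<in> tangent_space M p" and F: "smooth_at M p F"
    and h: "C_inf UNIV h" "(h has_real_derivative h') (at (F p))"
  shows "v (\<lambda>q. h (F q)) = h' * v F"
proof -
  obtain U x where c: "(U, x) \<in> charts M" "p \<in> U"
    using chart_at[OF p] by blast
  obtain d where d: "v = coord_vec M U x d p"
    using tangent_coord_vec[OF c v] .
  have hF: "smooth_at M p (\<lambda>q. h (F q))"
    using smooth_at_obtain2[OF F F] smooth_fun_comp[OF _ _ h(1)] smooth_atI by metis
  have ip: "inv_into U x (x p) = p" using chart_inj[OF c(1)] c(2) by simp
  have "((\<lambda>y. h ((F \<circ> inv_into U x) y)) has_derivative
      (\<lambda>k. h' * frechet_derivative (F \<circ> inv_into U x) (at (x p)) k)) (at (x p))"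
    by (rule has_derivative_compose[OF smooth_at_has_derivative[OF c F]])
       (use h(2) in \<open>simp add: ip has_field_derivative_def\<close>)
  then have "frechet_derivative ((\<lambda>q. h (F q)) \<circ> inv_into U x) (at (x p)) d =
      h' * frechet_derivative (F \<circ> inv_into U x) (at (x p)) d"
    by (intro frechet_derivative_eq) (simp add: o_def)
  then show ?thesis
    using F hF by (simp add: d coord_vec_def)
qed

lemma tangent_const:
  assumes p: "p \<in> pts M" and v: "v \<in> tangent_space M p"
  shows "v (\<lambda>q. r) = 0"
proof -
  have "smooth_at M p (\<lambda>q. r)"
    using smooth_atI[OF openin_topspace smooth_fun_const p] .
  from tangent_comp[OF p v this C_inf_const[of _ r], of 0] show ?thesis by simp
qed

lemma vector_field_add:
  assumes U: "openin (mtop M) U" and "vector_field M U X" "vector_field M U Y"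
  shows "vector_field M U (X + Y)"
  using assms tangent_add openin_subset[OF U]
  by (auto simp: vector_field_def intro!: smooth_fun_add)

lemma vector_field_scaleR:
  assumes U: "openin (mtop M) U" and "smooth_fun M U h" "vector_field M U X"
  shows "vector_field M U (\<lambda>q. h q *\<^sub>R X q)"
  using assms tangent_scaleR openin_subset[OF U]
  by (auto simp: vector_field_def scaleR_fun_def intro!: smooth_fun_mult intro: smooth_fun_subset)

lemma vector_field_zero:
  assumes U: "openin (mtop M) U"
  shows "vector_field M U (\<lambda>q. 0)"
  using tangent_zero openin_subset[OF U]
  by (auto simp: vector_field_def intro!: smooth_fun_const)

lemma vector_field_sum:
  assumes U: "openin (mtop M) U" and "\<And>i. i \<in> I \<Longrightarrow> vector_field M U (X i)"
  shows "vector_field M U (\<lambda>q. \<Sum>i\<in>I. X i q)"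
  using assms(2)
proof (induction I rule: infinite_finite_induct)
  case (insert i I)
  then have "vector_field M U (X i + (\<lambda>q. \<Sum>i\<in>I. X i q))"
    by (intro vector_field_add[OF U]) auto
  then show ?case using insert by (simp add: plus_fun_def)
qed (simp_all add: vector_field_zero[OF U])

lemma vector_field_cong:
  assumes "openin (mtop M) U" "\<And>q. q \<in> U \<Longrightarrow> X q = Y q"
  shows "vector_field M U X \<longleftrightarrow> vector_field M U Y"
proof -
  have "smooth_fun M V (\<lambda>p. X p F) \<longleftrightarrow> smooth_fun M V (\<lambda>p. Y p F)"
    if "openin (mtop M) V" "V \<subseteq> U" for V F
    by (rule smooth_fun_cong) (use that assms in auto)
  then show ?thesis
    using assms by (auto simp: vector_field_def)
qed

lemma vector_field_local:
  assumes "\<And>p. p \<in> U \<Longrightarrow> \<exists>W. openin (mtop M) W \<and> p \<in> W \<and> vector_field M W X"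
  shows "vector_field M U X"
  unfolding vector_field_def
proof safe
  fix p assume "p \<in> U"
  then obtain W where W: "p \<in> W" "vector_field M W X"
    using assms[of p] by blast
  show "X p \<in> tangent_space M p"
    by (rule vector_field_tangent[OF W(2,1)])
next
  fix V F assume V: "openin (mtop M) V" "V \<subseteq> U" "smooth_fun M V F"
  show "smooth_fun M V (\<lambda>p. X p F)"
  proof (rule smooth_fun_local)
    fix p assume p: "p \<in> V"
    then obtain W where W: "openin (mtop M) W" "p \<in> W" "vector_field M W X"
      using assms[OF subsetD[OF V(2)]] by blast
    then have "smooth_fun M (V \<inter> W) (\<lambda>p. X p F)"
      using V smooth_fun_subset[OF V(3)] by (intro vector_field_smooth[OF W(3)]) auto
    then show "\<exists>W. openin (mtop M) W \<and> p \<in> W \<and> smooth_fun M W (\<lambda>p. X p F)"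
      using V W p openin_Int[OF V(1) W(1)] by (intro exI[of _ "V \<inter> W"]) simp
  qed
qed

lemma vector_field_coord_vec:
  assumes c: "(U, x) \<in> charts M"
  shows "vector_field M U (coord_vec M U x d)"
  unfolding vector_field_def
proof safe
  fix p assume "p \<in> U"
  then show "coord_vec M U x d p \<in> tangent_space M p"
    by (rule coord_vec_in_tangent_space[OF c])
next
  fix V F assume V: "openin (mtop M) V" "V \<subseteq> U" "smooth_fun M V F"
  have UV: "U \<inter> V = V" using V by blast
  have "C_inf (x ` V) (F \<circ> inv_into U x)"
    using smooth_fun_chart[OF V(1,3) c] UV by simp
  then have C: "C_inf (x ` V) (\<lambda>y. frechet_derivative (F \<circ> inv_into U x) (at y) d)"
    by (rule C_inf_frechet_derivative)
  have "open (x ` V)"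
    using chart_open_image[OF c V(1)] UV by simp
  then have "C_inf (x ` V) ((\<lambda>p. coord_vec M U x d p F) \<circ> inv_into U x)"
    by (rule C_inf_cong[THEN iffD2, OF _ _ C])
       (use V chart_inj[OF c] smooth_atI[OF V(1,3)] in \<open>auto simp: coord_vec_def subset_iff\<close>)
  then show "smooth_fun M V (\<lambda>p. coord_vec M U x d p F)"
    by (rule smooth_fun_chartI[OF c V(1,2)])
qed

lemma smooth_fun_chart_comp:
  assumes c: "(U, x) \<in> charts M" and V: "openin (mtop M) V" "V \<subseteq> U" and X: "vector_field M V X"
    and b: "b \<in> Basis"
  shows "smooth_fun M V (\<lambda>q. chart_comp x (X q) \<bullet> b)"
  unfolding chart_comp_inner[OF b]
  by (rule vector_field_smooth[OF X V(1) subset_refl smooth_fun_subset[OF smooth_fun_coord[OF c] V(2)]])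

lemma tangent_representation:
  assumes c: "(U, x) \<in> charts M" and p: "p \<in> U" and v: "v \<in> tangent_space M p"
  shows "v = (\<Sum>b\<in>Basis. (chart_comp x v \<bullet> b) *\<^sub>R coord_vec M U x b p)"
proof -
  have "v = coord_vec M U x (\<Sum>b\<in>Basis. (chart_comp x v \<bullet> b) *\<^sub>R b) p"
    by (simp add: euclidean_representation coord_vec_chart_comp[OF c p v])
  also have "\<dots> = (\<Sum>b\<in>Basis. (chart_comp x v \<bullet> b) *\<^sub>R coord_vec M U x b p)"
    by (simp add: linear_sum[OF coord_vec_linear[OF c p]] linear_scale[OF coord_vec_linear[OF c p]])
  finally show ?thesis .
qed

end

section \<open>Connections: locality and tensoriality\<close>

locale mfd_connection = smooth_mfd M for M :: "('a, 'e::euclidean_space) mfd" +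
  fixes nabla :: "'a conn"
  assumes connection: "connection M nabla"
begin

lemma conn_vector_field:
  "openin (mtop M) U \<Longrightarrow> vector_field M U X \<Longrightarrow> vector_field M U Y \<Longrightarrow> vector_field M U (nabla X Y)"
  using connection smooth_fun_const unfolding connection_def by blast

lemma
  assumes "openin (mtop M) U" "vector_field M U X" "vector_field M U Y" "p \<in> U"
  shows conn_add_left: "vector_field M U Z \<Longrightarrow> nabla (X + Z) Y p = nabla X Y p + nabla Z Y p"
    and conn_scaleR_left: "smooth_fun M U h \<Longrightarrow> nabla (\<lambda>q. h q *\<^sub>R X q) Y p = h p *\<^sub>R nabla X Y p"
    and conn_add_right: "vector_field M U Z \<Longrightarrow> nabla X (Y + Z) p = nabla X Y p + nabla X Z p"
    and conn_scaleR_right: "smooth_fun M U h \<Longrightarrow>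
      nabla X (\<lambda>q. h q *\<^sub>R Y q) p = X p h *\<^sub>R Y p + h p *\<^sub>R nabla X Y p"
  using connection assms smooth_fun_const unfolding connection_def by blast+

lemma
  assumes U: "openin (mtop M) U" and X: "vector_field M U X" and Y: "vector_field M U Y" and p: "p \<in> U"
    and eq: "\<And>q. q \<in> U \<Longrightarrow> Y q = Y' q"
  shows conn_cong_right: "nabla X Y p = nabla X Y' p"
    and conn_cong_left: "nabla Y X p = nabla Y' X p"
proof -
  \<comment> \<open>The indicator is smooth on \<open>U\<close>, where it is constant 1, and its
    derivative at \<open>p\<close> is zero. Multiplying by it makes \<open>Y\<close> and
    \<open>Y'\<close> literally the same function, so the connection receives the same
    argument.\<close>
  define h where "h q = (if q \<in> U then 1 else 0 :: real)" for q
  have h: "smooth_fun M U h"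
    by (rule iffD2[OF smooth_fun_cong[OF U] smooth_fun_const]) (simp add: h_def)
  have pM: "p \<in> pts M" using U p openin_subset by blast
  have Xp: "X p \<in> tangent_space M p"
    by (rule vector_field_tangent[OF X p])
  have "X p h = X p (\<lambda>q. 1)"
    by (rule tangent_cong[OF Xp U p]) (simp add: h_def)
  then have Xh: "X p h = 0"
    using tangent_const[OF pM Xp] by simp
  have "vector_field M U Y'"
    using vector_field_cong[OF U eq] Y by simp
  then have *: "nabla X (\<lambda>q. h q *\<^sub>R Y' q) p = nabla X Y' p"
    "nabla (\<lambda>q. h q *\<^sub>R Y' q) X p = nabla Y' X p"
    using conn_scaleR_right[OF U X _ p h] conn_scaleR_left[OF U _ X p h] p Xh by (simp_all add: h_def)
  have "nabla X (\<lambda>q. h q *\<^sub>R Y q) p = nabla X Y p"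
    "nabla (\<lambda>q. h q *\<^sub>R Y q) X p = nabla Y X p"
    using conn_scaleR_right[OF U X Y p h] conn_scaleR_left[OF U Y X p h] p Xh by (simp_all add: h_def)
  moreover have "(\<lambda>q. h q *\<^sub>R Y q) = (\<lambda>q. h q *\<^sub>R Y' q)"
    using eq by (auto simp: h_def fun_eq_iff)
  ultimately show "nabla X Y p = nabla X Y' p" "nabla Y X p = nabla Y' X p"
    using * by simp_all
qed

lemma
  assumes U: "openin (mtop M) U" and X: "vector_field M U X" and p: "p \<in> U"
  shows conn_zero_right: "nabla X (\<lambda>q. 0) p = 0"
    and conn_zero_left: "nabla (\<lambda>q. 0) X p = 0"
proof -
  note Z = vector_field_zero[OF U] and h = smooth_fun_const[of U 0]
  show "nabla X (\<lambda>q. 0) p = 0" "nabla (\<lambda>q. 0) X p = 0"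
    using conn_scaleR_right[OF U X Z p h] conn_scaleR_left[OF U Z X p h] by simp_all
qed

lemma conn_sum_left:
  assumes U: "openin (mtop M) U" and X: "\<And>i. i \<in> I \<Longrightarrow> vector_field M U (X i)"
    and Y: "vector_field M U Y" and p: "p \<in> U"
  shows "nabla (\<lambda>q. \<Sum>i\<in>I. X i q) Y p = (\<Sum>i\<in>I. nabla (X i) Y p)"
  using X
proof (induction I rule: infinite_finite_induct)
  case (insert i I)
  then have "nabla (X i + (\<lambda>q. \<Sum>i\<in>I. X i q)) Y p = nabla (X i) Y p + nabla (\<lambda>q. \<Sum>i\<in>I. X i q) Y p"
    by (intro conn_add_left[OF U _ Y p] vector_field_sum[OF U]) auto
  then show ?case using insert by (simp add: plus_fun_def)
qed (simp_all add: conn_zero_left[OF U Y p])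

lemma conn_sum_right:
  assumes U: "openin (mtop M) U" and X: "vector_field M U X"
    and Y: "\<And>i. i \<in> I \<Longrightarrow> vector_field M U (Y i)" and p: "p \<in> U"
  shows "nabla X (\<lambda>q. \<Sum>i\<in>I. Y i q) p = (\<Sum>i\<in>I. nabla X (Y i) p)"
  using Y
proof (induction I rule: infinite_finite_induct)
  case (insert i I)
  then have "nabla X (Y i + (\<lambda>q. \<Sum>i\<in>I. Y i q)) p = nabla X (Y i) p + nabla X (\<lambda>q. \<Sum>i\<in>I. Y i q) p"
    by (intro conn_add_right[OF U X _ p] vector_field_sum[OF U]) auto
  then show ?case using insert by (simp add: plus_fun_def)
qed (simp_all add: conn_zero_right[OF U X p])

text \<open>Expanding the direction in the coordinate frame leaves only its components at
  \<open>p\<close> as coefficients. This allows one extension of a tangent vector to be exchanged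
  for another.\<close>

lemma conn_tensorial:
  assumes U: "openin (mtop M) U" and p: "p \<in> U" and X: "vector_field M U X" "vector_field M U X'"
    and Y: "vector_field M U Y" and eq: "X p = X' p"
  shows "nabla X Y p = nabla X' Y p"
proof -
  have pM: "p \<in> pts M" using U p openin_subset by blast
  obtain W x where c: "(W, x) \<in> charts M" "p \<in> W"
    using chart_at[OF pM] by blast
  define V where "V = U \<inter> W"
  have V: "openin (mtop M) V" "V \<subseteq> U" "V \<subseteq> W" "p \<in> V"
    using U p c(2) chart_openin[OF c(1)] by (auto simp: V_def)
  note Y' = vector_field_subset[OF Y V(2)]
  have E: "vector_field M V (coord_vec M W x b)" for b
    using vector_field_subset[OF vector_field_coord_vec[OF c(1)] V(3)] .
  have "nabla Z Y p = (\<Sum>b\<in>Basis. (chart_comp x (Z p) \<bullet> b) *\<^sub>R nabla (coord_vec M W x b) Y p)"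
    if Z: "vector_field M U Z" for Z
  proof -
    note Z' = vector_field_subset[OF Z V(2)]
    have h: "smooth_fun M V (\<lambda>q. chart_comp x (Z q) \<bullet> b)" if "b \<in> Basis" for b
      by (rule smooth_fun_chart_comp[OF c(1) V(1,3) Z' that])
    have "nabla Z Y p = nabla (\<lambda>q. \<Sum>b\<in>Basis. (chart_comp x (Z q) \<bullet> b) *\<^sub>R coord_vec M W x b q) Y p"
      by (rule conn_cong_left[OF V(1) Y' Z' V(4)])
         (rule tangent_representation[OF c(1) subsetD[OF V(3)] vector_field_tangent[OF Z']])
    also have "\<dots> = (\<Sum>b\<in>Basis. nabla (\<lambda>q. (chart_comp x (Z q) \<bullet> b) *\<^sub>R coord_vec M W x b q) Y p)"
      by (rule conn_sum_left[OF V(1) _ Y' V(4)]) (rule vector_field_scaleR[OF V(1) h E])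
    also have "\<dots> = (\<Sum>b\<in>Basis. (chart_comp x (Z p) \<bullet> b) *\<^sub>R nabla (coord_vec M W x b) Y p)"
      by (rule sum.cong[OF refl conn_scaleR_left[OF V(1) E Y' V(4) h]])
    finally show ?thesis .
  qed
  with X eq show ?thesis by simp
qed

end

section \<open>Comparison of Levi-Civita connections and the covariant derivative of \<xi>\<close>

section \<open>Koszul formula and conformal Kenmotsu structures\<close>


lemma linear_over_add: "linear_over T h \<Longrightarrow> u \<in> T \<Longrightarrow> v \<in> T \<Longrightarrow> h (u + v) = h u + h v"
  and linear_over_scaleR: "linear_over T h \<Longrightarrow> v \<in> T \<Longrightarrow> h (a *\<^sub>R v) = a *\<^sub>R h v"
  by (simp_all add: linear_over_def)

lemma linear_over_zero: "linear_over T h \<Longrightarrow> v \<in> T \<Longrightarrow> h 0 = 0"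
  using linear_over_scaleR[of T h v 0] by simp

lemma linear_over_diff:
  assumes "linear_over T h" "subspace T" "u \<in> T" "v \<in> T"
  shows "h (u - v) = h u - h v"
  using linear_over_add[OF assms(1), of "u - v" v] assms by (simp add: subspace_diff)

lemma linear_over_sum:
  assumes "linear_over T h" "subspace T" "\<And>i. i \<in> I \<Longrightarrow> v i \<in> T"
  shows "h (\<Sum>i\<in>I. v i) = (\<Sum>i\<in>I. h (v i))"
  using assms(3)
proof (induction I rule: infinite_finite_induct)
  case (insert i I)
  then show ?case
    using linear_over_add[OF assms(1), of "v i" "\<Sum>i\<in>I. v i"] subspace_sum[OF assms(2), of I v] by auto
qed (use linear_over_zero[OF assms(1) subspace_0[OF assms(2)]] in simp_all)

text \<open>Collects what the Koszul formula rests on. It is instantiated for the metric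
  \<open>g\<close>, for its conformal multiple, and for the metric induced on the
  hypersurface.\<close>

locale levi_civita_mfd = smooth_mfd M for M :: "('a, 'e::euclidean_space) mfd" +
  fixes g :: "'a metric_tensor" and nabla :: "'a conn"
  assumes metric_linear: "p \<in> pts M \<Longrightarrow> u \<in> tangent_space M p \<Longrightarrow> linear_over (tangent_space M p) (g p u)"
    and metric_sym: "p \<in> pts M \<Longrightarrow> u \<in> tangent_space M p \<Longrightarrow> v \<in> tangent_space M p \<Longrightarrow> g p u v = g p v u"
    and levi_civita: "levi_civita M g nabla"

sublocale levi_civita_mfd \<subseteq> mfd_connection M nabla
  by unfold_locales (use levi_civita in \<open>simp add: levi_civita_def\<close>)

context levi_civita_mfd
begin

context
  fixes p :: 'a and u v w :: "'a tvec"
  assumes p: "p \<in> pts M" and u: "u \<in> tangent_space M p" and v: "v \<in> tangent_space M p"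
begin

lemma metric_scaleR_right: "g p u (r *\<^sub>R v) = r * g p u v"
  using linear_over_scaleR[OF metric_linear[OF p u] v] by simp

lemma metric_scaleR_left: "g p (r *\<^sub>R v) u = r * g p v u"
  using metric_scaleR_right metric_sym[OF p u] tangent_scaleR[OF p v] v by metis

context
  assumes w: "w \<in> tangent_space M p"
begin

lemma metric_add_right: "g p u (v + w) = g p u v + g p u w"
  by (rule linear_over_add[OF metric_linear[OF p u] v w])

lemma metric_diff_right: "g p u (v - w) = g p u v - g p u w"
  by (rule linear_over_diff[OF metric_linear[OF p u] subspace_tangent_space[OF p] v w])

lemma metric_add_left: "g p (v + w) u = g p v u + g p w u"
  using metric_add_right metric_sym[OF p u] tangent_add[OF p v w] v w by metis

lemma metric_diff_left: "g p (v - w) u = g p v u - g p w u"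
  using metric_diff_right metric_sym[OF p u] tangent_diff[OF p v w] v w by metis

end

end

lemma
  assumes "openin (mtop M) U" "vector_field M U X" "vector_field M U Y" "p \<in> U"
  shows torsion_free: "nabla X Y p - nabla Y X p = lie_bracket M X Y p"
    and metric_compatible: "vector_field M U Z \<Longrightarrow>
      X p (\<lambda>q. g q (Y q) (Z q)) = g p (nabla X Y p) (Z p) + g p (Y p) (nabla X Z p)"
  using levi_civita assms unfolding levi_civita_def by blast+

lemma lie_bracket_tangent:
  assumes "openin (mtop M) U" "vector_field M U X" "vector_field M U Y" "p \<in> U"
  shows "lie_bracket M X Y p \<in> tangent_space M p"
  unfolding torsion_free[OF assms, symmetric]
  using assms openin_subset[OF assms(1)]
  by (intro tangent_diff vector_field_tangent[OF conn_vector_field]) auto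

text \<open>The right-hand side contains only the metric and brackets. This makes it the means of
  comparing connections: for conformally related metrics, and for a manifold and its
  submanifold.\<close>

lemma koszul:
  assumes U: "openin (mtop M) U" and X: "vector_field M U X" and Y: "vector_field M U Y"
    and Z: "vector_field M U Z" and p: "p \<in> U"
  shows "2 * g p (nabla X Y p) (Z p) =
    X p (\<lambda>q. g q (Y q) (Z q)) + Y p (\<lambda>q. g q (X q) (Z q)) - Z p (\<lambda>q. g q (X q) (Y q))
    + g p (lie_bracket M X Y p) (Z p) - g p (lie_bracket M X Z p) (Y p)
    - g p (lie_bracket M Y Z p) (X p)"
proof -
  have pM: "p \<in> pts M" using U p openin_subset by blast
  have T: "nabla V W p \<in> tangent_space M p" if "vector_field M U V" "vector_field M U W" for V W
    using vector_field_tangent[OF conn_vector_field[OF U that] p] .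
  note t = vector_field_tangent[OF _ p]
  note sym = metric_sym[OF pM t T] and diff = metric_diff_left[OF pM t T T]
  show ?thesis
    unfolding metric_compatible[OF U X Y p Z] metric_compatible[OF U Y X p Z]
      metric_compatible[OF U Z X p Y] torsion_free[OF U X Y p, symmetric]
      torsion_free[OF U X Z p, symmetric] torsion_free[OF U Y Z p, symmetric]
    using sym[OF Y X Z] sym[OF X Y Z] sym[OF X Z Y] diff[OF Z X Y Y X] diff[OF Y X Z Z X]
      diff[OF X Y Z Z Y]
    by linarith
qed

end

lemma riemannian_levi_civita_mfd:
  assumes "smooth_manifold M" "riemannian_metric M g" "levi_civita M g nabla"
  shows "levi_civita_mfd M g nabla"
  using assms unfolding riemannian_metric_def by unfold_locales auto

lemma riemannian_metric_smooth:
  "riemannian_metric M g \<Longrightarrow> openin (mtop M) U \<Longrightarrow> vector_field M U X \<Longrightarrow> vector_field M U Y \<Longrightarrow>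
    smooth_fun M U (\<lambda>p. g p (X p) (Y p))"
  unfolding riemannian_metric_def by (drule conjunct2) simp

text \<open>Taking \<open>Y = \<xi>\<close> in the formula for the derivative of
  \<open>\<phi>\<close> and using \<open>\<phi> \<xi> = 0\<close> gives
  \<open>\<phi> (nabla X \<xi>) = \<phi> X\<close>. So \<open>nabla X \<xi> - X\<close> lies in the
  kernel of \<open>\<phi>\<close>, which \<xi> spans, and the coefficient follows because \<xi> has
  constant length.\<close>

lemma kenmotsu_nabla_xi:
  assumes M: "smooth_manifold M" and acm: "almost_contact_metric M \<phi> \<xi> \<eta> g" and lc: "levi_civita M g nabla"
    and nabla_phi: "\<And>U X Y p. openin (mtop M) U \<Longrightarrow> vector_field M U X \<Longrightarrow> vector_field M U Y \<Longrightarrow> p \<in> U \<Longrightarrow>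
      nabla X (\<lambda>q. \<phi> q (Y q)) p - \<phi> p (nabla X Y p) =
        - (g p (X p) (\<phi> p (Y p)) *\<^sub>R \<xi> p) - \<eta> p (Y p) *\<^sub>R \<phi> p (X p)"
    and U: "openin (mtop M) U" and X: "vector_field M U X" and p: "p \<in> U"
  shows "nabla X \<xi> p = X p - \<eta> p (X p) *\<^sub>R \<xi> p"
proof -
  have rm: "riemannian_metric M g"
    using acm by (simp add: almost_contact_metric_def)
  interpret levi_civita_mfd M g nabla
    by (rule riemannian_levi_civita_mfd[OF M rm lc])
  have pM: "p \<in> pts M" and UM: "U \<subseteq> pts M" using U p openin_subset by blast+
  have \<xi>: "vector_field M U \<xi>"
    using acm UM vector_field_subset by (auto simp: almost_contact_metric_def)
  note t = vector_field_tangent[OF _ p]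
  note Xp = t[OF X] and \<xi>p = t[OF \<xi>] and nX = t[OF conn_vector_field[OF U X \<xi>]]
  have \<phi>: "linear_over (tangent_space M p) (\<phi> p)" and \<phi>\<xi>: "\<And>q. q \<in> pts M \<Longrightarrow> \<phi> q (\<xi> q) = 0"
    and \<eta>\<xi>: "\<And>q. q \<in> pts M \<Longrightarrow> \<eta> q (\<xi> q) = 1"
    and \<phi>\<phi>: "\<And>u. u \<in> tangent_space M p \<Longrightarrow> \<phi> p (\<phi> p u) = - u + \<eta> p u *\<^sub>R \<xi> p"
    and \<eta>: "\<And>q u. q \<in> pts M \<Longrightarrow> u \<in> tangent_space M q \<Longrightarrow> \<eta> q u = g q u (\<xi> q)"
    using acm pM by (auto simp: almost_contact_metric_def tensor11_def)
  \<comment> \<open>\<open>\<phi> q (\<xi> q)\<close> is known to vanish only for points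
    \<open>q\<close> of \<open>M\<close>, so locality of the connection is invoked.\<close>
  have "nabla X (\<lambda>q. \<phi> q (\<xi> q)) p = nabla X (\<lambda>q. 0) p"
    by (rule conn_cong_right[OF U X vector_field_zero[OF U] p, symmetric]) (use \<phi>\<xi> UM in auto)
  then have "nabla X (\<lambda>q. \<phi> q (\<xi> q)) p = 0"
    using conn_zero_right[OF U X p] by simp
  then have "\<phi> p (nabla X \<xi> p) = \<phi> p (X p)"
    using nabla_phi[OF U X \<xi> p] linear_over_zero[OF metric_linear[OF pM Xp] Xp]
    by (simp add: \<phi>\<xi>[OF pM] \<eta>\<xi>[OF pM])
  moreover define w where "w = nabla X \<xi> p - X p"
  ultimately have "\<phi> p w = 0"
    using linear_over_diff[OF \<phi> subspace_tangent_space[OF pM] nX Xp] by simp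
  \<comment> \<open>As \<open>\<phi> p w = 0\<close>, the identity for
    \<open>\<phi> p (\<phi> p w)\<close> reads
    \<open>0 = - w + \<eta> p w *\<^sub>R \<xi> p\<close>.\<close>
  then have w: "w = \<eta> p w *\<^sub>R \<xi> p"
    using \<phi>\<phi>[of w] linear_over_zero[OF \<phi> Xp] tangent_diff[OF pM nX Xp]
    by (simp add: w_def eq_neg_iff_add_eq_0 algebra_simps)
  have "X p (\<lambda>q. g q (\<xi> q) (\<xi> q)) = X p (\<lambda>q. 1)"
    by (rule tangent_cong[OF Xp U p]) (use \<eta>[OF _ vector_field_tangent[OF \<xi>]] \<eta>\<xi> UM in force)
  also have "\<dots> = 0"
    by (rule tangent_const[OF pM Xp])
  finally have "g p (nabla X \<xi> p) (\<xi> p) = 0"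
    using metric_compatible[OF U X \<xi> p \<xi>] metric_sym[OF pM nX \<xi>p] by simp
  then have "\<eta> p w = - \<eta> p (X p)"
    using metric_diff_left[OF pM \<xi>p nX Xp] \<eta>[OF pM] Xp tangent_diff[OF pM nX Xp] by (simp add: w_def)
  then show ?thesis
    using w by (simp add: w_def algebra_simps)
qed

text \<open>The Koszul formulas of the two metrics differ, up to the common factor
  \<open>exp (f p)\<close>, only by the terms in which that factor is differentiated. The terms with
  \<open>X p f\<close> cancel: one stems from the rescaling of \<xi>, the other from the change of
  the metric.\<close>

lemma conformal_kenmotsu_nabla_xi:
  fixes f :: "'a \<Rightarrow> real"
  assumes M: "smooth_manifold M" and acm: "almost_contact_metric M \<phi> \<xi> \<eta> g"
    and f: "smooth_fun M (pts M) f"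
    and ken: "kenmotsu M \<phi> (\<lambda>p. exp (- f p / 2) *\<^sub>R \<xi> p) (\<lambda>p v. exp (f p / 2) * \<eta> p v)
      (\<lambda>p u v. exp (f p) * g p u v)"
    and lc: "levi_civita M g nabla"
    and U: "openin (mtop M) U" and X: "vector_field M U X" and Z: "vector_field M U Z" and p: "p \<in> U"
  shows "g p (nabla X \<xi> p) (Z p) = exp (f p / 2) * (g p (X p) (Z p) - \<eta> p (X p) * \<eta> p (Z p))
    - \<xi> p f / 2 * g p (X p) (Z p) + \<eta> p (X p) * Z p f / 2"
proof -
  let ?\<xi> = "\<lambda>p. exp (- f p / 2) *\<^sub>R \<xi> p" and ?\<eta> = "\<lambda>p v. exp (f p / 2) * \<eta> p v"
    and ?g = "\<lambda>p u v. exp (f p) * g p u v"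
  have rm: "riemannian_metric M g"
    using acm by (simp add: almost_contact_metric_def)
  have acm': "almost_contact_metric M \<phi> ?\<xi> ?\<eta> ?g"
    using ken by (simp add: kenmotsu_def)
  then have rm': "riemannian_metric M ?g"
    by (simp add: almost_contact_metric_def)
  obtain D where lcD: "levi_civita M ?g D"
    and nabla_phi: "\<forall>U X Y. openin (mtop M) U \<and> vector_field M U X \<and> vector_field M U Y \<longrightarrow>
      (\<forall>p\<in>U. D X (\<lambda>q. \<phi> q (Y q)) p - \<phi> p (D X Y p) =
        - (?g p (X p) (\<phi> p (Y p)) *\<^sub>R ?\<xi> p) - ?\<eta> p (Y p) *\<^sub>R \<phi> p (X p))"
    using ken unfolding kenmotsu_def by (elim conjE exE)
  interpret levi_civita_mfd M g nabla
    by (rule riemannian_levi_civita_mfd[OF M rm lc])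
  interpret D: levi_civita_mfd M ?g D
    by (rule riemannian_levi_civita_mfd[OF M rm' lcD])
  have pM: "p \<in> pts M" and UM: "U \<subseteq> pts M" using U p openin_subset by blast+
  have \<xi>: "vector_field M U \<xi>" and \<xi>': "vector_field M U ?\<xi>"
    using acm acm' UM vector_field_subset by (auto simp: almost_contact_metric_def)
  note t = vector_field_tangent[OF _ p]
  note Xp = t[OF X] and \<xi>p = t[OF \<xi>] and Zp = t[OF Z]
  have \<eta>: "\<And>u. u \<in> tangent_space M p \<Longrightarrow> \<eta> p u = g p u (\<xi> p)"
    using acm pM by (auto simp: almost_contact_metric_def)
  have fU: "smooth_fun M U f"
    by (rule smooth_fun_subset[OF f UM])
  note fp = smooth_atI[OF U fU p]
  have ef: "C_inf UNIV (\<lambda>r::real. exp (r / 2))"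
    using C_inf_comp[OF open_UNIV C_inf_bounded_linear[OF bounded_linear_divide] C_inf_exp, of 2] by simp
  have h: "smooth_fun M U (\<lambda>q. exp (f q / 2))"
    by (rule smooth_fun_comp[OF U fU ef])
  have Xh: "X p (\<lambda>q. exp (f q / 2)) = exp (f p / 2) / 2 * X p f"
    by (rule tangent_comp[OF pM Xp fp ef]) (auto intro!: derivative_eq_intros)
  \<comment> \<open>The Kenmotsu identity concerns the rescaled field; writing \<xi> as a multiple
    of it lets the Leibniz rule deliver \<open>D X \<xi>\<close>.\<close>
  have \<xi>_eq: "(\<lambda>q. exp (f q / 2) *\<^sub>R ?\<xi> q) = \<xi>"
    by (simp add: fun_eq_iff exp_minus)
  have "D X \<xi> p = X p (\<lambda>q. exp (f q / 2)) *\<^sub>R ?\<xi> p + exp (f p / 2) *\<^sub>R D X ?\<xi> p"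
    using D.conn_scaleR_right[OF U X \<xi>' p h] unfolding \<xi>_eq .
  also have "D X ?\<xi> p = X p - ?\<eta> p (X p) *\<^sub>R ?\<xi> p"
    by (rule kenmotsu_nabla_xi[OF M acm' lcD _ U X p]) (use nabla_phi in simp)
  also have "X p (\<lambda>q. exp (f q / 2)) *\<^sub>R ?\<xi> p = (X p f / 2) *\<^sub>R \<xi> p"
    by (simp add: Xh exp_minus)
  also have "?\<eta> p (X p) *\<^sub>R ?\<xi> p = \<eta> p (X p) *\<^sub>R \<xi> p"
    by (simp add: exp_minus)
  finally have DX: "D X \<xi> p = (X p f / 2) *\<^sub>R \<xi> p + exp (f p / 2) *\<^sub>R (X p - \<eta> p (X p) *\<^sub>R \<xi> p)" .
  have "g p (D X \<xi> p) (Z p) =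
    X p f / 2 * g p (\<xi> p) (Z p) + exp (f p / 2) * (g p (X p) (Z p) - \<eta> p (X p) * g p (\<xi> p) (Z p))"
    unfolding DX
    by (simp add: metric_add_left metric_diff_left metric_scaleR_left tangent_scaleR tangent_diff
        pM Xp \<xi>p Zp)
  moreover have deriv: "V p (\<lambda>q. exp (f q) * g q (Y q) (W q)) =
      exp (f p) * (V p f * g p (Y p) (W p) + V p (\<lambda>q. g q (Y q) (W q)))"
    if "vector_field M U V" "vector_field M U Y" "vector_field M U W" for V Y W
  proof -
    note Vp = t[OF that(1)]
    have e: "smooth_at M p (\<lambda>q. exp (f q))"
      by (rule smooth_atI[OF U smooth_fun_comp[OF U fU C_inf_exp] p])
    have "V p (\<lambda>q. exp (f q)) = exp (f p) * V p f"
      by (rule tangent_comp[OF pM Vp fp C_inf_exp]) (auto intro!: derivative_eq_intros)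
    then show ?thesis
      using tangent_mult[OF pM Vp e smooth_atI[OF U riemannian_metric_smooth[OF rm U that(2,3)] p]]
      by (simp add: algebra_simps)
  qed
  \<comment> \<open>Bracket terms merely acquire the factor \<open>exp (f p)\<close>; the three
    metric derivatives contribute in addition one derivative of \<open>f\<close> each.\<close>
  have "2 * (exp (f p) * g p (D X \<xi> p) (Z p)) = exp (f p) * (2 * g p (nabla X \<xi> p) (Z p)
      + X p f * g p (\<xi> p) (Z p) + \<xi> p f * g p (X p) (Z p) - Z p f * g p (X p) (\<xi> p))"
    unfolding D.koszul[OF U X \<xi> Z p] koszul[OF U X \<xi> Z p]
      deriv[OF X \<xi> Z] deriv[OF \<xi> X Z] deriv[OF Z X \<xi>] by (simp add: algebra_simps)
  then have "exp (f p) * (2 * g p (D X \<xi> p) (Z p)) = exp (f p) * (2 * g p (nabla X \<xi> p) (Z p)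
      + X p f * g p (\<xi> p) (Z p) + \<xi> p f * g p (X p) (Z p) - Z p f * g p (X p) (\<xi> p))"
    by (simp add: ac_simps)
  then have "2 * g p (D X \<xi> p) (Z p) = 2 * g p (nabla X \<xi> p) (Z p)
      + X p f * g p (\<xi> p) (Z p) + \<xi> p f * g p (X p) (Z p) - Z p f * g p (X p) (\<xi> p)"
    by simp
  ultimately show ?thesis
    using \<eta>[OF Xp] \<eta>[OF Zp] metric_sym[OF pM \<xi>p Zp] by (simp add: field_simps)
qed

section \<open>Propagation of zeros for recurrent tensors of type (1,1)\<close>

section \<open>Recurrent tensors\<close>


text \<open>A uniqueness argument of Gronwall type in several variables. On a ball of radius
  \<open>r\<close> the mean value inequality bounds each function by \<open>r\<close> times a
  constant times the maximum of the sum of all absolute values; for small \<open>r\<close> this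
  makes the maximum at most half of itself.\<close>

lemma zero_near_if_derivative_dominated:
  fixes a :: "'i \<Rightarrow> 'e::euclidean_space \<Rightarrow> real"
  assumes I: "finite I" and S: "open S" "y0 \<in> S"
    and der: "\<And>i y. i \<in> I \<Longrightarrow> y \<in> S \<Longrightarrow> (a i has_derivative a' i y) (at y)"
    and bound: "\<And>i y w. i \<in> I \<Longrightarrow> y \<in> S \<Longrightarrow> \<bar>a' i y w\<bar> \<le> C * (\<Sum>k\<in>I. \<bar>a k y\<bar>) * norm w"
    and zero: "\<And>i. i \<in> I \<Longrightarrow> a i y0 = 0"
  obtains r where "r > 0" "\<And>i y. i \<in> I \<Longrightarrow> y \<in> cball y0 r \<Longrightarrow> a i y = 0"
proof -
  \<comment> \<open>\<open>\<bar>C\<bar> + 1\<close> is positive and above \<open>C\<close> whatever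
    the sign of \<open>C\<close>; the 1 added to \<open>card I\<close> keeps \<open>K\<close>
    positive for empty \<open>I\<close>, so that the radius \<open>1 / (2 * K)\<close> is
    meaningful.\<close>
  define K where "K = (\<bar>C\<bar> + 1) * (card I + 1)"
  have K: "K > 0" by (simp add: K_def add_nonneg_pos)
  obtain r0 where r0: "r0 > 0" "cball y0 r0 \<subseteq> S"
    using S open_contains_cball by blast
  define r where "r = min r0 (1 / (2 * K))"
  have "cball y0 r \<subseteq> cball y0 r0" by (simp add: r_def subset_cball)
  moreover have "r * K \<le> 1 / (2 * K) * K"
    using K by (intro mult_right_mono) (auto simp: r_def)
  ultimately have r: "r > 0" "cball y0 r \<subseteq> S" "r * K \<le> 1 / 2"
    using r0 K by (auto simp: r_def)
  define s where "s y = (\<Sum>k\<in>I. \<bar>a k y\<bar>)" for y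
  have "continuous_on (cball y0 r) (a i)" if "i \<in> I" for i
    using der[OF that] r(2)
    by (meson continuous_at_imp_continuous_on has_derivative_continuous subsetD)
  then have "continuous_on (cball y0 r) s"
    unfolding s_def by (intro continuous_intros) auto
  moreover have "cball y0 r \<noteq> {}" using r(1) by simp
  ultimately obtain y1 where y1: "y1 \<in> cball y0 r" "\<And>y. y \<in> cball y0 r \<Longrightarrow> s y \<le> s y1"
    using continuous_attains_sup[OF compact_cball] by metis
  have s0: "0 \<le> s y" for y by (simp add: s_def sum_nonneg)
  have small: "\<bar>a i y\<bar> \<le> (\<bar>C\<bar> + 1) * s y1 * r" if i: "i \<in> I" and y: "y \<in> cball y0 r" for i y
  proof -
    have "norm (a i y - a i y0) \<le> ((\<bar>C\<bar> + 1) * s y1) * norm (y - y0)"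
    proof (rule differentiable_bound[OF convex_cball])
      show "(a i has_derivative a' i z) (at z within cball y0 r)" if "z \<in> cball y0 r" for z
        using der[OF i] r(2) that has_derivative_at_withinI by blast
      show "onorm (a' i z) \<le> (\<bar>C\<bar> + 1) * s y1" if z: "z \<in> cball y0 r" for z
      proof (rule onorm_le)
        fix w
        have "\<bar>a' i z w\<bar> \<le> C * s z * norm w"
          using bound[OF i, of z w] z r(2) by (auto simp: s_def)
        also have "\<dots> \<le> (\<bar>C\<bar> + 1) * s y1 * norm w"
          using y1(2)[OF z] s0[of z] by (intro mult_right_mono mult_mono) auto
        finally show "norm (a' i z w) \<le> (\<bar>C\<bar> + 1) * s y1 * norm w" by simp
      qed
    qed (use y r(1) in auto)
    also have "\<dots> \<le> ((\<bar>C\<bar> + 1) * s y1) * r"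
      using y s0[of y1] by (intro mult_left_mono) (auto simp: dist_norm norm_minus_commute)
    finally show ?thesis using zero[OF i] by simp
  qed
  \<comment> \<open>Summing the estimates at the maximum point itself bounds \<open>s y1\<close> by
    \<open>r * K * s y1\<close>, which is at most half of \<open>s y1\<close>.\<close>
  have "s y1 \<le> (\<Sum>k\<in>I. (\<bar>C\<bar> + 1) * s y1 * r)"
    unfolding s_def[of y1] by (rule sum_mono) (use small[OF _ y1(1)] in \<open>simp add: s_def\<close>)
  also have "\<dots> = card I * ((\<bar>C\<bar> + 1) * r) * s y1"
    by simp
  also have "\<dots> \<le> (card I + 1) * ((\<bar>C\<bar> + 1) * r) * s y1"
    using r(1) s0[of y1] by (intro mult_right_mono) auto
  also have "\<dots> = r * K * s y1"
    by (simp add: K_def algebra_simps)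
  also have "\<dots> \<le> 1 / 2 * s y1"
    using r(3) s0[of y1] by (rule mult_right_mono)
  finally have "s y1 = 0" using s0[of y1] by simp
  then have "a i y = 0" if "i \<in> I" "y \<in> cball y0 r" for i y
    using small[OF that] by simp
  with r(1) that show thesis by blast
qed

lemma chart_comp_add: "chart_comp x (u + v) = chart_comp x u + chart_comp x v"
  by (simp add: chart_comp_def scaleR_add_left sum.distrib)

lemma chart_comp_scaleR: "chart_comp x (r *\<^sub>R v) = r *\<^sub>R chart_comp x v"
  by (simp add: chart_comp_def scaleR_fun_def scaleR_sum_right)

lemma chart_comp_linear: "linear (chart_comp x)"
  by (rule linearI) (simp_all add: chart_comp_add chart_comp_scaleR)

lemma tensor11_linear: "tensor11 M A \<Longrightarrow> p \<in> pts M \<Longrightarrow> linear_over (tangent_space M p) (A p)"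
  and tensor11_tangent: "tensor11 M A \<Longrightarrow> p \<in> pts M \<Longrightarrow> v \<in> tangent_space M p \<Longrightarrow> A p v \<in> tangent_space M p"
  and tensor11_vector_field: "tensor11 M A \<Longrightarrow> openin (mtop M) U \<Longrightarrow> vector_field M U X \<Longrightarrow>
    vector_field M U (\<lambda>p. A p (X p))"
  by (auto simp: tensor11_def)

context smooth_mfd
begin

text \<open>The matrix of \<open>A\<close> in the coordinate frame: \<open>b\<close> indexes the
  argument and \<open>k\<close> the component of the value.\<close>

definition tensor_coeff ::
    "('a \<Rightarrow> 'a tvec \<Rightarrow> 'a tvec) \<Rightarrow> 'a set \<Rightarrow> ('a \<Rightarrow> 'e) \<Rightarrow> 'e \<times> 'e \<Rightarrow> 'a \<Rightarrow> real" where
  "tensor_coeff A U x = (\<lambda>(b, k) q. chart_comp x (A q (coord_vec M U x b q)) \<bullet> k)"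

lemma smooth_fun_tensor_coeff:
  assumes A: "tensor11 M A" and c: "(U, x) \<in> charts M" and k: "snd i \<in> Basis"
  shows "smooth_fun M U (tensor_coeff A U x i)"
proof -
  note U = chart_openin[OF c]
  show ?thesis
    using smooth_fun_chart_comp[OF c U subset_refl
        tensor11_vector_field[OF A U vector_field_coord_vec[OF c]] k]
    by (simp add: tensor_coeff_def split_beta)
qed

text \<open>Reduces vanishing of \<open>A\<close> at a point to finitely many real equations, which
  continuity and differential inequalities can handle.\<close>

lemma tensor_zero_iff_coeff:
  assumes A: "tensor11 M A" and c: "(U, x) \<in> charts M" and p: "p \<in> U"
  shows "(\<forall>v\<in>tangent_space M p. A p v = 0) \<longleftrightarrow> (\<forall>i\<in>Basis \<times> Basis. tensor_coeff A U x i p = 0)"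
proof
  assume "\<forall>v\<in>tangent_space M p. A p v = 0"
  then have "A p (coord_vec M U x b p) = 0" for b
    using coord_vec_in_tangent_space[OF c p] by blast
  then show "\<forall>i\<in>Basis \<times> Basis. tensor_coeff A U x i p = 0"
    by (simp add: tensor_coeff_def linear_0[OF chart_comp_linear] split_beta)
next
  assume *: "\<forall>i\<in>Basis \<times> Basis. tensor_coeff A U x i p = 0"
  have pM: "p \<in> pts M" using p chart_subset[OF c] by blast
  note lin = tensor11_linear[OF A pM] and sub = subspace_tangent_space[OF pM]
    and E = coord_vec_in_tangent_space[OF c p]
  have zero: "A p (coord_vec M U x b p) = 0" if b: "b \<in> Basis" for b
  proof -
    have "chart_comp x (A p (coord_vec M U x b p)) = 0"
      by (rule euclidean_eqI) (use * b in \<open>auto simp: tensor_coeff_def\<close>)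
    then show ?thesis
      using coord_vec_chart_comp[OF c p tensor11_tangent[OF A pM E]]
        linear_0[OF coord_vec_linear[OF c p]] by metis
  qed
  show "\<forall>v\<in>tangent_space M p. A p v = 0"
  proof
    fix v assume v: "v \<in> tangent_space M p"
    have "A p v = A p (\<Sum>b\<in>Basis. (chart_comp x v \<bullet> b) *\<^sub>R coord_vec M U x b p)"
      using tangent_representation[OF c p v] by simp
    also have "\<dots> = (\<Sum>b\<in>Basis. A p ((chart_comp x v \<bullet> b) *\<^sub>R coord_vec M U x b p))"
      by (rule linear_over_sum[OF lin sub tangent_scaleR[OF pM E]])
    also have "\<dots> = 0"
      by (rule sum.neutral) (simp add: linear_over_scaleR[OF lin E] zero)
    finally show "A p v = 0" .
  qed
qed

text \<open>Some matrix entry is nonzero at \<open>p\<close> and by continuity stays so nearby. This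
  makes the zero set of \<open>A\<close> closed.\<close>

lemma tensor_nonzero_near:
  assumes A: "tensor11 M A" and p: "p \<in> pts M" and nz: "\<not> (\<forall>v\<in>tangent_space M p. A p v = 0)"
  obtains W where "openin (mtop M) W" "p \<in> W" "\<And>q. q \<in> W \<Longrightarrow> \<not> (\<forall>v\<in>tangent_space M q. A q v = 0)"
proof -
  obtain U x where c: "(U, x) \<in> charts M" "p \<in> U"
    using chart_at[OF p] by blast
  note U = chart_openin[OF c(1)]
  obtain i where i: "i \<in> Basis \<times> Basis" "tensor_coeff A U x i p \<noteq> 0"
    using nz tensor_zero_iff_coeff[OF A c] by blast
  let ?f = "tensor_coeff A U x i \<circ> inv_into U x"
  have "smooth_fun M U (tensor_coeff A U x i)"
    by (rule smooth_fun_tensor_coeff[OF A c(1)]) (use i(1) in auto)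
  then have "continuous_on (x ` U) ?f"
    using C_inf_continuous_on smooth_fun_chart[OF U _ c(1)] by fastforce
  moreover have "open (x ` U)" using chart_open_image[OF c(1) U] by simp
  ultimately have o: "open (x ` U \<inter> ?f -` (- {0}))"
    by (intro continuous_open_preimage) auto
  show thesis
  proof (rule that)
    show "openin (mtop M) {q \<in> U. x q \<in> x ` U \<inter> ?f -` (- {0})}"
      by (rule is_chart_openin_vimage[OF chart_is_chart[OF c(1)] o])
    show "p \<in> {q \<in> U. x q \<in> x ` U \<inter> ?f -` (- {0})}"
      using c(2) i(2) chart_inj[OF c(1)] by simp
    show "\<not> (\<forall>v\<in>tangent_space M q. A q v = 0)" if "q \<in> {q \<in> U. x q \<in> x ` U \<inter> ?f -` (- {0})}" for q
    proof -
      have q: "q \<in> U" using that by simp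
      have "tensor_coeff A U x i q \<noteq> 0"
        using that inv_into_f_f[OF chart_inj[OF c(1)] q] by simp
      then show ?thesis
        using i(1) tensor_zero_iff_coeff[OF A c(1) q] by blast
    qed
  qed
qed

lemma smooth_fun_bounded_near:
  assumes c: "(U, x) \<in> charts M" and p: "p \<in> U" and I: "finite I"
    and F: "\<And>i. i \<in> I \<Longrightarrow> smooth_fun M U (F i)"
  obtains r B where "r > 0" "ball (x p) r \<subseteq> x ` U"
    "\<And>i q. i \<in> I \<Longrightarrow> q \<in> U \<Longrightarrow> x q \<in> ball (x p) r \<Longrightarrow> \<bar>F i q\<bar> \<le> B"
proof -
  note U = chart_openin[OF c]
  have "open (x ` U)" using chart_open_image[OF c U] by simp
  then obtain r where r: "r > 0" "cball (x p) r \<subseteq> x ` U"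
    using p open_contains_cball by blast
  have "continuous_on (x ` U) (F i \<circ> inv_into U x)" if "i \<in> I" for i
    using C_inf_continuous_on[OF smooth_fun_chart[OF U F[OF that] c]] by simp
  \<comment> \<open>Bounding the sum of all absolute values on a compact ball gives one constant for
    all members of the family.\<close>
  then have "continuous_on (cball (x p) r) (\<lambda>y. \<Sum>i\<in>I. \<bar>(F i \<circ> inv_into U x) y\<bar>)"
    by (intro continuous_intros) (auto intro: continuous_on_subset[OF _ r(2)])
  then have "bounded ((\<lambda>y. \<Sum>i\<in>I. \<bar>(F i \<circ> inv_into U x) y\<bar>) ` cball (x p) r)"
    using compact_continuous_image[OF _ compact_cball] compact_imp_bounded by blast
  then obtain B where "\<forall>z\<in>(\<lambda>y. \<Sum>i\<in>I. \<bar>(F i \<circ> inv_into U x) y\<bar>) ` cball (x p) r. norm z \<le> B"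
    unfolding bounded_iff by blast
  then have B: "\<bar>\<Sum>i\<in>I. \<bar>(F i \<circ> inv_into U x) y\<bar>\<bar> \<le> B" if "y \<in> cball (x p) r" for y
    using that by (auto simp del: mem_cball)
  have "\<bar>F i q\<bar> \<le> B" if "i \<in> I" "q \<in> U" "x q \<in> ball (x p) r" for i q
  proof -
    have "\<bar>F i q\<bar> \<le> (\<Sum>i\<in>I. \<bar>F i q\<bar>)"
      by (rule member_le_sum[OF that(1) _ I]) simp
    also have "\<dots> \<le> B"
      using B[of "x q"] that(2,3) chart_inj[OF c] by simp
    finally show ?thesis .
  qed
  moreover have "ball (x p) r \<subseteq> x ` U" using r(2) ball_subset_cball by blast
  ultimately show thesis using that r(1) by blast
qed

end

context mfd_connection
begin

text \<open>\<open>G\<close> collects the Christoffel symbols. The value \<open>A (E b)\<close> is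
  expanded in the frame and differentiated by the Leibniz rule, while
  \<open>A (nabla (E i) (E b))\<close> is expanded by linearity. On the right every term is linear
  in the matrix entries and none of them is differentiated.\<close>

lemma recurrent_coeff_derivative:
  assumes A: "tensor11 M A"
    and rec: "\<forall>U X Y. openin (mtop M) U \<and> vector_field M U X \<and> vector_field M U Y \<longrightarrow>
      (\<forall>p\<in>U. nabla X (\<lambda>q. A q (Y q)) p - A p (nabla X Y p) = \<theta> p (X p) *\<^sub>R A p (Y p))"
    and c: "(U, x) \<in> charts M" and p: "p \<in> U" and b: "b \<in> Basis" and l: "l \<in> Basis"
  defines "E \<equiv> coord_vec M U x"
  defines "G \<equiv> \<lambda>i j k. chart_comp x (nabla (E i) (E j) p) \<bullet> k"
  shows "E i p (tensor_coeff A U x (b, l)) =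
    (\<Sum>k\<in>Basis. G i b k * tensor_coeff A U x (k, l) p) + \<theta> p (E i p) * tensor_coeff A U x (b, l) p
    - (\<Sum>k\<in>Basis. tensor_coeff A U x (b, k) p * G i k l)"
proof -
  let ?a = "tensor_coeff A U x"
  note U = chart_openin[OF c]
  have pM: "p \<in> pts M" using p chart_subset[OF c] by blast
  note lin = tensor11_linear[OF A pM] and sub = subspace_tangent_space[OF pM]
  have E: "vector_field M U (E i)" for i
    unfolding E_def by (rule vector_field_coord_vec[OF c])
  have ET: "E i q \<in> tangent_space M q" if "q \<in> U" for i q
    using vector_field_tangent[OF E that] .
  have AE: "vector_field M U (\<lambda>q. A q (E b q))"
    by (rule tensor11_vector_field[OF A U E])
  have rep: "A q (E b q) = (\<Sum>k\<in>Basis. ?a (b, k) q *\<^sub>R E k q)" if "q \<in> U" for q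
    using tangent_representation[OF c that vector_field_tangent[OF AE that]]
    by (simp add: tensor_coeff_def E_def)
  have a: "smooth_fun M U (?a (b, k))" if "k \<in> Basis" for k
    by (rule smooth_fun_tensor_coeff[OF A c]) (use that in simp)
  have "nabla (E i) (\<lambda>q. A q (E b q)) p = nabla (E i) (\<lambda>q. \<Sum>k\<in>Basis. ?a (b, k) q *\<^sub>R E k q) p"
    by (rule conn_cong_right[OF U E AE p rep])
  also have "\<dots> = (\<Sum>k\<in>Basis. nabla (E i) (\<lambda>q. ?a (b, k) q *\<^sub>R E k q) p)"
    by (rule conn_sum_right[OF U E _ p]) (rule vector_field_scaleR[OF U a E])
  also have "\<dots> = (\<Sum>k\<in>Basis. E i p (?a (b, k)) *\<^sub>R E k p + ?a (b, k) p *\<^sub>R nabla (E i) (E k) p)"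
    by (rule sum.cong[OF refl conn_scaleR_right[OF U E E p a]])
  finally have "chart_comp x (nabla (E i) (\<lambda>q. A q (E b q)) p) \<bullet> l =
    (\<Sum>k\<in>Basis. E i p (?a (b, k)) * (k \<bullet> l) + ?a (b, k) p * G i k l)"
    by (simp add: linear_sum[OF chart_comp_linear] chart_comp_add chart_comp_scaleR inner_sum_left
        inner_add_left G_def E_def chart_comp_coord_vec[OF c p])
  also have "\<dots> = E i p (?a (b, l)) + (\<Sum>k\<in>Basis. ?a (b, k) p * G i k l)"
  proof -
    have "(\<Sum>k\<in>Basis. E i p (?a (b, k)) * (k \<bullet> l)) = (\<Sum>k\<in>Basis. if k = l then E i p (?a (b, k)) else 0)"
      using l by (intro sum.cong) (auto simp: inner_Basis)
    then show ?thesis using l by (simp add: sum.distrib)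
  qed
  finally have lhs: "chart_comp x (nabla (E i) (\<lambda>q. A q (E b q)) p) \<bullet> l =
    E i p (?a (b, l)) + (\<Sum>k\<in>Basis. ?a (b, k) p * G i k l)" .
  have "nabla (E i) (E b) p = (\<Sum>k\<in>Basis. G i b k *\<^sub>R E k p)"
    using tangent_representation[OF c p vector_field_tangent[OF conn_vector_field[OF U E E] p]]
    by (simp add: G_def E_def)
  then have "A p (nabla (E i) (E b) p) = (\<Sum>k\<in>Basis. A p (G i b k *\<^sub>R E k p))"
    using linear_over_sum[OF lin sub tangent_scaleR[OF pM ET[OF p]]] by simp
  also have "\<dots> = (\<Sum>k\<in>Basis. G i b k *\<^sub>R A p (E k p))"
    by (rule sum.cong[OF refl linear_over_scaleR[OF lin ET[OF p]]])
  finally have "chart_comp x (A p (nabla (E i) (E b) p)) \<bullet> l = (\<Sum>k\<in>Basis. G i b k * ?a (k, l) p)"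
    by (simp add: linear_sum[OF chart_comp_linear] chart_comp_scaleR inner_sum_left
        tensor_coeff_def E_def)
  moreover have "nabla (E i) (\<lambda>q. A q (E b q)) p =
      A p (nabla (E i) (E b) p) + \<theta> p (E i p) *\<^sub>R A p (E b p)"
    using rec[THEN spec, THEN spec, THEN spec, THEN mp, THEN bspec, OF conjI[OF U conjI[OF E E]] p]
    by (simp add: diff_eq_eq add.commute)
  then have "chart_comp x (nabla (E i) (\<lambda>q. A q (E b q)) p) \<bullet> l =
      chart_comp x (A p (nabla (E i) (E b) p)) \<bullet> l + \<theta> p (E i p) * ?a (b, l) p"
    by (simp add: chart_comp_add chart_comp_scaleR inner_add_left tensor_coeff_def E_def)
  ultimately show ?thesis
    using lhs by simp
qed

text \<open>The Christoffel symbols and the components of \<open>\<theta>\<close> are bounded on a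
  small ball, so the derivatives of the matrix entries are dominated by the entries themselves, and
  \<open>zero_near_if_derivative_dominated\<close> applies.\<close>

lemma recurrent_zero_near:
  assumes A: "tensor11 M A" and \<theta>: "one_form M \<theta>"
    and rec: "\<forall>U X Y. openin (mtop M) U \<and> vector_field M U X \<and> vector_field M U Y \<longrightarrow>
      (\<forall>p\<in>U. nabla X (\<lambda>q. A q (Y q)) p - A p (nabla X Y p) = \<theta> p (X p) *\<^sub>R A p (Y p))"
    and p: "p \<in> pts M" and zero: "\<forall>v\<in>tangent_space M p. A p v = 0"
  obtains W where "openin (mtop M) W" "p \<in> W" "\<And>q. q \<in> W \<Longrightarrow> \<forall>v\<in>tangent_space M q. A q v = 0"
proof -
  obtain U x where c: "(U, x) \<in> charts M" "p \<in> U"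
    using chart_at[OF p] by blast
  note U = chart_openin[OF c(1)]
  define E where "E = coord_vec M U x"
  define a where "a = tensor_coeff A U x"
  define G where "G = (\<lambda>(i, j, k) q. chart_comp x (nabla (E i) (E j) q) \<bullet> k)"
  define t where "t i q = \<theta> q (E i q)" for i q
  define I :: "('e \<times> 'e) set" where "I = Basis \<times> Basis"
  have E: "vector_field M U (E i)" for i
    unfolding E_def by (rule vector_field_coord_vec[OF c(1)])
  have G: "smooth_fun M U (G ijk)" if "ijk \<in> Basis \<times> Basis \<times> Basis" for ijk
  proof -
    obtain i j k where [simp]: "ijk = (i, j, k)" by (cases ijk)
    have k: "k \<in> Basis" using that by simp
    show ?thesis
      using smooth_fun_chart_comp[OF c(1) U subset_refl conn_vector_field[OF U E E] k]
      by (simp add: G_def)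
  qed
  have t: "smooth_fun M U (t i)" for i
    using \<theta> U E unfolding t_def[abs_def] by (simp add: one_form_def)
  have a: "smooth_fun M U (a i)" if "i \<in> I" for i
    unfolding a_def by (rule smooth_fun_tensor_coeff[OF A c(1)]) (use that in \<open>auto simp: I_def\<close>)
  obtain r1 B1 where B1: "r1 > 0" "ball (x p) r1 \<subseteq> x ` U"
    "\<And>ijk q. ijk \<in> Basis \<times> Basis \<times> Basis \<Longrightarrow> q \<in> U \<Longrightarrow> x q \<in> ball (x p) r1 \<Longrightarrow> \<bar>G ijk q\<bar> \<le> B1"
    by (rule smooth_fun_bounded_near[OF c _ G]) auto
  obtain r2 B2 where B2: "r2 > 0" "ball (x p) r2 \<subseteq> x ` U"
    "\<And>i q. i \<in> Basis \<Longrightarrow> q \<in> U \<Longrightarrow> x q \<in> ball (x p) r2 \<Longrightarrow> \<bar>t i q\<bar> \<le> B2"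
    by (rule smooth_fun_bounded_near[where F=t, OF c finite_Basis t]) auto
  define r where "r = min r1 r2"
  \<comment> \<open>The maximum with 0 makes \<open>B\<close> nonnegative, as the monotonicity of
    the products below requires.\<close>
  define B where "B = max 0 (max B1 B2)"
  have r: "r > 0" "ball (x p) r \<subseteq> x ` U" using B1 B2 by (auto simp: r_def)
  have GB: "\<bar>G (i, j, k) q\<bar> \<le> B" and tB: "\<bar>t i q\<bar> \<le> B"
    if "i \<in> Basis" "j \<in> Basis" "k \<in> Basis" "q \<in> U" "x q \<in> ball (x p) r" for i j k q
    using B1(3)[of "(i, j, k)" q] B2(3)[of i q] that by (auto simp: B_def r_def)
  have B0: "0 \<le> B" by (simp add: B_def)
  define s where "s q = (\<Sum>i\<in>I. \<bar>a i q\<bar>)" for q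
  have s_eq: "s q = (\<Sum>b\<in>Basis. \<Sum>k\<in>Basis. \<bar>a (b, k) q\<bar>)" for q
    by (simp add: s_def I_def sum.cartesian_product split_beta)
  have row: "(\<Sum>k\<in>Basis. \<bar>a (b, k) q\<bar>) \<le> s q" if "b \<in> Basis" for b q
    unfolding s_eq by (rule member_le_sum[OF that]) (auto intro: sum_nonneg)
  have col: "(\<Sum>k\<in>Basis. \<bar>a (k, l) q\<bar>) \<le> s q" if "l \<in> Basis" for l q
    unfolding s_eq by (rule sum_mono, rule member_le_sum[OF that]) auto
  have entry: "\<bar>a (b, l) q\<bar> \<le> s q" if "b \<in> Basis" "l \<in> Basis" for b l q
    unfolding s_def by (rule member_le_sum) (use that in \<open>auto simp: I_def\<close>)
  \<comment> \<open>The factor 3 counts the terms of the coordinate equation: two sums with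
    Christoffel symbols and one term with \<open>\<theta>\<close>, each at most
    \<open>B * s q\<close>. A row or a column of the matrix is at most the sum of all its
    entries.\<close>
  have partial: "\<bar>E i q (a (b, l))\<bar> \<le> 3 * B * s q"
    if i: "i \<in> Basis" and b: "b \<in> Basis" and l: "l \<in> Basis" and q: "q \<in> U" "x q \<in> ball (x p) r" for i b l q
  proof -
    have "E i q (a (b, l)) = (\<Sum>k\<in>Basis. G (i, b, k) q * a (k, l) q) + t i q * a (b, l) q
        - (\<Sum>k\<in>Basis. a (b, k) q * G (i, k, l) q)"
      using recurrent_coeff_derivative[OF A rec c(1) q(1) b l, where i=i]
      by (simp add: E_def a_def G_def t_def)
    moreover have "\<bar>\<Sum>k\<in>Basis. G (i, b, k) q * a (k, l) q\<bar> \<le> B * s q"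
    proof -
      have "\<bar>\<Sum>k\<in>Basis. G (i, b, k) q * a (k, l) q\<bar> \<le> (\<Sum>k\<in>Basis. B * \<bar>a (k, l) q\<bar>)"
        by (rule order_trans[OF sum_abs sum_mono])
           (use GB[OF i b _ q] in \<open>auto simp: abs_mult intro: mult_right_mono\<close>)
      also have "\<dots> \<le> B * s q"
        unfolding sum_distrib_left[symmetric] by (rule mult_left_mono[OF col[OF l] B0])
      finally show ?thesis .
    qed
    moreover have "\<bar>\<Sum>k\<in>Basis. a (b, k) q * G (i, k, l) q\<bar> \<le> B * s q"
    proof -
      have "\<bar>\<Sum>k\<in>Basis. a (b, k) q * G (i, k, l) q\<bar> \<le> (\<Sum>k\<in>Basis. B * \<bar>a (b, k) q\<bar>)"
        by (rule order_trans[OF sum_abs sum_mono])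
           (use GB[OF i _ l q] in \<open>auto simp: abs_mult mult.commute[of B] intro: mult_left_mono\<close>)
      also have "\<dots> \<le> B * s q"
        unfolding sum_distrib_left[symmetric] by (rule mult_left_mono[OF row[OF b] B0])
      finally show ?thesis .
    qed
    moreover have "\<bar>t i q * a (b, l) q\<bar> \<le> B * s q"
      unfolding abs_mult by (rule mult_mono[OF tB[OF i i i q] entry[OF b l] B0]) simp
    ultimately show ?thesis by linarith
  qed
  define f where "f i = a i \<circ> inv_into U x" for i
  have Cf: "C_inf (x ` U) (f i)" if "i \<in> I" for i
    using smooth_fun_chart[OF U a[OF that] c(1)] by (simp add: f_def)
  have ix: "inv_into U x y \<in> U" "x (inv_into U x y) = y" if "y \<in> ball (x p) r" for y
    using that r(2) by (auto simp: inv_into_into f_inv_into_f subset_iff)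
  obtain d where d: "d > 0" "\<And>i y. i \<in> I \<Longrightarrow> y \<in> cball (x p) d \<Longrightarrow> f i y = 0"
  proof (rule zero_near_if_derivative_dominated[of I "ball (x p) r" "x p" f
        "\<lambda>i y. frechet_derivative (f i) (at y)" "DIM('e) * (3 * B)"])
    show "(f i has_derivative frechet_derivative (f i) (at y)) (at y)"
      if "i \<in> I" "y \<in> ball (x p) r" for i y
      using C_inf_has_derivative[OF Cf[OF that(1)]] that(2) r(2) by blast
    \<comment> \<open>A general direction \<open>w\<close> is a sum of \<open>DIM('e)\<close> basis
      directions with coefficients at most \<open>norm w\<close>; hence the factor
      \<open>DIM('e)\<close>.\<close>
    show "\<bar>frechet_derivative (f i) (at y) w\<bar> \<le> DIM('e) * (3 * B) * (\<Sum>k\<in>I. \<bar>f k y\<bar>) * norm w"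
      if i: "i \<in> I" and y: "y \<in> ball (x p) r" for i y w
    proof -
      obtain b l where bl: "i = (b, l)" "b \<in> Basis" "l \<in> Basis"
        using i by (auto simp: I_def)
      let ?q = "inv_into U x y" and ?D = "frechet_derivative (f i) (at y)"
      have D: "\<bar>?D k\<bar> \<le> 3 * B * s ?q" if "k \<in> Basis" for k
        using partial[OF that bl(2,3) ix(1)[OF y]] ix[OF y] y smooth_atI[OF U a[OF i] ix(1)[OF y]]
        by (simp add: E_def coord_vec_def f_def bl(1))
      have "linear ?D"
        using C_inf_differentiable[OF Cf[OF i]] y r(2) linear_frechet_derivative by blast
      then have "?D w = (\<Sum>k\<in>Basis. (w \<bullet> k) * ?D k)"
        using linear_sum[of ?D "\<lambda>k. (w \<bullet> k) *\<^sub>R k" Basis] linear_scale[of ?D]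
        by (simp add: euclidean_representation)
      then have "\<bar>?D w\<bar> \<le> (\<Sum>k\<in>Basis. \<bar>(w \<bullet> k) * ?D k\<bar>)"
        by simp
      also have "\<dots> \<le> (\<Sum>k\<in>(Basis::'e set). norm w * (3 * B * s ?q))"
        unfolding abs_mult using Basis_le_norm D by (intro sum_mono mult_mono) auto
      also have "\<dots> = DIM('e) * (3 * B) * s ?q * norm w"
        by simp
      finally show ?thesis by (simp add: s_def f_def)
    qed
    show "f i (x p) = 0" if "i \<in> I" for i
      using zero that chart_inj[OF c(1)] c(2)
      by (auto simp: tensor_zero_iff_coeff[OF A c] f_def a_def I_def)
  qed (use r(1) in \<open>auto simp: I_def\<close>)
  show thesis
  proof (rule that)
    show "openin (mtop M) {q \<in> U. x q \<in> ball (x p) d}"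
      by (rule is_chart_openin_vimage[OF chart_is_chart[OF c(1)] open_ball])
    show "p \<in> {q \<in> U. x q \<in> ball (x p) d}" using c(2) d(1) by simp
    show "\<forall>v\<in>tangent_space M q. A q v = 0" if "q \<in> {q \<in> U. x q \<in> ball (x p) d}" for q
    proof -
      have q: "q \<in> U" "x q \<in> cball (x p) d" using that by auto
      then have "a i q = 0" if "i \<in> I" for i
        using d(2)[OF that q(2)] chart_inj[OF c(1)] by (simp add: f_def)
      then show ?thesis
        by (simp add: tensor_zero_iff_coeff[OF A c(1) q(1)] a_def I_def)
    qed
  qed
qed

text \<open>The zero set is open by \<open>recurrent_zero_near\<close>, its complement is open by
  \<open>tensor_nonzero_near\<close>, and it contains \<open>p\<close>.\<close>

lemma recurrent_zero_everywhere:
  assumes conn: "connected_space (mtop M)" and A: "tensor11 M A" and rec: "recurrent M nabla A"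
    and p: "p \<in> pts M" and zero: "\<forall>v\<in>tangent_space M p. A p v = 0"
    and q: "q \<in> pts M" and v: "v \<in> tangent_space M q"
  shows "A q v = 0"
proof -
  obtain \<theta> where \<theta>: "one_form M \<theta>"
    and rec': "\<forall>U X Y. openin (mtop M) U \<and> vector_field M U X \<and> vector_field M U Y \<longrightarrow>
      (\<forall>p\<in>U. nabla X (\<lambda>q. A q (Y q)) p - A p (nabla X Y p) = \<theta> p (X p) *\<^sub>R A p (Y p))"
    using rec unfolding recurrent_def by (elim conjE exE)
  define Z where "Z = {q \<in> pts M. \<forall>v\<in>tangent_space M q. A q v = 0}"
  have "openin (mtop M) Z"
    unfolding openin_subopen[of _ Z]
  proof
    fix q assume "q \<in> Z"
    then have q: "q \<in> pts M" "\<forall>v\<in>tangent_space M q. A q v = 0" by (auto simp: Z_def)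
    obtain W where W: "openin (mtop M) W" "q \<in> W" "\<And>q. q \<in> W \<Longrightarrow> \<forall>v\<in>tangent_space M q. A q v = 0"
      by (rule recurrent_zero_near[OF A \<theta> rec' q]) (rule that)
    then show "\<exists>T. openin (mtop M) T \<and> q \<in> T \<and> T \<subseteq> Z"
      using openin_subset[OF W(1)] by (intro exI[of _ W]) (auto simp: Z_def)
  qed
  moreover have "openin (mtop M) (pts M - Z)"
    unfolding openin_subopen[of _ "pts M - Z"]
  proof
    fix q assume "q \<in> pts M - Z"
    then have q: "q \<in> pts M" "\<not> (\<forall>v\<in>tangent_space M q. A q v = 0)" by (auto simp: Z_def)
    obtain W where W: "openin (mtop M) W" "q \<in> W" "\<And>q. q \<in> W \<Longrightarrow> \<not> (\<forall>v\<in>tangent_space M q. A q v = 0)"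
      by (rule tensor_nonzero_near[OF A q]) (rule that)
    then show "\<exists>T. openin (mtop M) T \<and> q \<in> T \<and> T \<subseteq> pts M - Z"
      using openin_subset[OF W(1)] by (intro exI[of _ W]) (auto simp: Z_def)
  qed
  moreover have "p \<in> Z" using p zero by (simp add: Z_def)
  ultimately have "pts M - Z = {}"
    using conn unfolding connected_space_def by blast
  then show ?thesis using q v by (auto simp: Z_def)
qed

end

section \<open>Slice charts, the differential of the inclusion, and fields related by it\<close>

section \<open>Embedded submanifolds\<close>


lemma incl_add: "incl M p (u + v) = incl M p u + incl M p v"
  and incl_diff: "incl M p (u - v) = incl M p u - incl M p v"
  and incl_scaleR: "incl M p (r *\<^sub>R v) = r *\<^sub>R incl M p v"
  by (auto simp: incl_def fun_eq_iff scaleR_fun_def)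

lemma incl_apply: "smooth_at M p F \<Longrightarrow> incl M p v F = v F"
  by (simp add: incl_def)

locale submfd = M: smooth_mfd M + S: smooth_mfd S
  for M :: "('a, 'e::euclidean_space) mfd" and S :: "('a, 'f::euclidean_space) mfd" +
  assumes embedded: "embedded_submanifold M S"
begin

lemma pts_subset: "p \<in> pts S \<Longrightarrow> p \<in> pts M"
  using embedded by (auto simp: embedded_submanifold_def)

lemma openin_restrict: "openin (mtop M) V \<Longrightarrow> openin (mtop S) (V \<inter> pts S)"
  using embedded by (metis embedded_submanifold_def openin_subtopology_Int)

text \<open>\<open>inv j\<close> undoes \<open>j\<close> on the range of \<open>j\<close> only, so
  \<open>inv j \<circ> x\<close> serves as a coordinate map on the points of \<open>S\<close>
  alone.\<close>

definition slice_chart :: "'a set \<Rightarrow> ('a \<Rightarrow> 'e) \<Rightarrow> ('f \<Rightarrow> 'e) \<Rightarrow> bool" where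
  "slice_chart U x j \<longleftrightarrow> (U, x) \<in> charts M \<and> linear j \<and> inj j \<and>
    x ` (U \<inter> pts S) = x ` U \<inter> range j \<and> (U \<inter> pts S, inv j \<circ> x) \<in> charts S"

lemma slice_chart_at:
  assumes "p \<in> pts S"
  obtains U x j where "slice_chart U x j" "p \<in> U"
  using embedded assms unfolding embedded_submanifold_def slice_chart_def by blast

context
  fixes U x j
  assumes slice: "slice_chart U x j"
begin

lemma slice_ambient: "(U, x) \<in> charts M"
  and slice_linear: "linear j" and slice_inj: "inj j"
  and slice_intrinsic: "(U \<inter> pts S, inv j \<circ> x) \<in> charts S"
  using slice by (auto simp: slice_chart_def)

lemma slice_coord:
  assumes "q \<in> U \<inter> pts S"
  shows "j ((inv j \<circ> x) q) = x q"
proof -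
  have "x q \<in> range j"
    using slice imageI[OF assms, of x] unfolding slice_chart_def by blast
  then show ?thesis by (simp add: f_inv_into_f)
qed

lemma slice_inv_into: "q \<in> U \<inter> pts S \<Longrightarrow> inv_into (U \<inter> pts S) (inv j \<circ> x) ((inv j \<circ> x) q) = q"
  using inv_into_f_f[OF S.chart_inj[OF slice_intrinsic]] .

lemma slice_inv_into': "q \<in> U \<inter> pts S \<Longrightarrow> inv_into U x (j ((inv j \<circ> x) q)) = q"
  unfolding slice_coord using inv_into_f_f[OF M.chart_inj[OF slice_ambient]] by blast

lemma slice_coord_representation:
  assumes "y \<in> (inv j \<circ> x) ` (U \<inter> pts S)"
  shows "(F \<circ> inv_into (U \<inter> pts S) (inv j \<circ> x)) y = (F \<circ> inv_into U x) (j y)"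
  using assms slice_inv_into slice_inv_into' by auto

text \<open>In slice coordinates, restriction to \<open>S\<close> is composition with the linear map
  \<open>j\<close>.\<close>

lemma smooth_fun_restrict_slice:
  assumes V: "openin (mtop M) V" and F: "smooth_fun M V F"
  shows "C_inf ((inv j \<circ> x) ` (U \<inter> pts S \<inter> (V \<inter> pts S))) (F \<circ> inv_into (U \<inter> pts S) (inv j \<circ> x))"
proof -
  let ?z = "inv j \<circ> x" and ?T = "(inv j \<circ> x) ` (U \<inter> pts S \<inter> (V \<inter> pts S))"
  have oT: "open ?T"
    by (rule S.chart_open_image[OF slice_intrinsic openin_restrict[OF V]])
  have j: "C_inf ?T j"
    by (rule C_inf_bounded_linear) (use slice_linear linear_conv_bounded_linear in blast)
  have "j ` ?T \<subseteq> x ` (U \<inter> V)"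
    using slice_coord by auto
  then have "C_inf ?T (\<lambda>y. (F \<circ> inv_into U x) (j y))"
    by (rule C_inf_comp[OF oT j M.smooth_fun_chart[OF V F slice_ambient]])
  moreover have "C_inf ?T (F \<circ> inv_into (U \<inter> pts S) ?z) \<longleftrightarrow> C_inf ?T (\<lambda>y. (F \<circ> inv_into U x) (j y))"
    by (rule C_inf_cong[OF oT slice_coord_representation]) auto
  ultimately show ?thesis by simp
qed

end

lemma smooth_fun_restrict:
  assumes V: "openin (mtop M) V" and F: "smooth_fun M V F"
  shows "smooth_fun S (V \<inter> pts S) F"
proof (rule S.smooth_funI)
  fix p assume p: "p \<in> V \<inter> pts S"
  then obtain U x j where s: "slice_chart U x j" "p \<in> U"
    using slice_chart_at by blast
  show "\<exists>U x W. (U, x) \<in> charts S \<and> p \<in> U \<and> openin (mtop S) W \<and> p \<in> W \<and>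
      C_inf (x ` (U \<inter> W)) (F \<circ> inv_into U x)"
    using s p slice_intrinsic[OF s(1)] openin_restrict[OF V] smooth_fun_restrict_slice[OF s(1) V F]
    by (intro exI[of _ "U \<inter> pts S"] exI[of _ "inv j \<circ> x"] exI[of _ "V \<inter> pts S"]) simp
qed

lemma smooth_at_restrict:
  assumes "smooth_at M p F" "p \<in> pts S"
  shows "smooth_at S p F"
proof -
  obtain V where V: "openin (mtop M) V" "p \<in> V" "smooth_fun M V F"
    using assms(1) by (auto simp: smooth_at_def)
  show ?thesis
    by (rule S.smooth_atI[OF openin_restrict[OF V(1)] smooth_fun_restrict[OF V(1,3)]])
       (use V assms in simp)
qed

text \<open>In a slice chart the inclusion is the linear map \<open>j\<close> and hence its own
  differential. That \<open>incl\<close> maps into the tangent space of \<open>M\<close>, and is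
  injective, thereby become facts about \<open>j\<close>.\<close>

lemma incl_coord_vec:
  assumes s: "slice_chart U x j" and p: "p \<in> U \<inter> pts S"
  shows "incl M p (coord_vec S (U \<inter> pts S) (inv j \<circ> x) c p) = coord_vec M U x (j c) p"
proof
  fix F
  let ?z = "inv j \<circ> x"
  show "incl M p (coord_vec S (U \<inter> pts S) ?z c p) F = coord_vec M U x (j c) p F"
  proof (cases "smooth_at M p F")
    case True
    let ?D = "frechet_derivative (F \<circ> inv_into U x) (at (x p))"
    have o: "open (?z ` (U \<inter> pts S))"
      using S.chart_open_image[OF slice_intrinsic[OF s] S.chart_openin[OF slice_intrinsic[OF s]]] by simp
    have der: "((F \<circ> inv_into U x) has_derivative ?D) (at (j (?z p)))"
      unfolding slice_coord[OF s p]
      by (rule M.smooth_at_has_derivative[OF slice_ambient[OF s] _ True]) (use p in blast)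
    have j: "(j has_derivative j) (at (?z p))"
      using slice_linear[OF s] linear_conv_bounded_linear bounded_linear_imp_has_derivative by blast
    have "((\<lambda>y. (F \<circ> inv_into U x) (j y)) has_derivative (\<lambda>c. ?D (j c))) (at (?z p))"
      by (rule has_derivative_compose[OF j der])
    moreover have "((F \<circ> inv_into (U \<inter> pts S) ?z) has_derivative D) (at (?z p)) \<longleftrightarrow>
        ((\<lambda>y. (F \<circ> inv_into U x) (j y)) has_derivative D) (at (?z p))" for D
      by (rule has_derivative_cong_open[OF o _ slice_coord_representation[OF s]]) (use p in auto)
    ultimately have "((F \<circ> inv_into (U \<inter> pts S) ?z) has_derivative (\<lambda>c. ?D (j c))) (at (?z p))"
      by simp
    then have "frechet_derivative (F \<circ> inv_into (U \<inter> pts S) ?z) (at (?z p)) c = ?D (j c)"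
      by (rule frechet_derivative_eq)
    moreover have "smooth_at S p F" using smooth_at_restrict[OF True] p by simp
    ultimately show ?thesis using True unfolding incl_def coord_vec_def by simp
  next
    case False
    then show ?thesis by (simp add: incl_def coord_vec_def)
  qed
qed

lemma incl_tangent:
  assumes p: "p \<in> pts S" and v: "v \<in> tangent_space S p"
  shows "incl M p v \<in> tangent_space M p"
proof -
  obtain U x j where s: "slice_chart U x j" "p \<in> U"
    using slice_chart_at[OF p] by blast
  have pU: "p \<in> U \<inter> pts S" using s p by simp
  obtain c where "v = coord_vec S (U \<inter> pts S) (inv j \<circ> x) c p"
    using S.tangent_coord_vec[OF slice_intrinsic[OF s(1)] pU v] .
  then show ?thesis
    using M.coord_vec_in_tangent_space[OF slice_ambient[OF s(1)] s(2)] incl_coord_vec[OF s(1) pU] by simp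
qed

lemma incl_eq_0D:
  assumes p: "p \<in> pts S" and v: "v \<in> tangent_space S p" and 0: "incl M p v = 0"
  shows "v = 0"
proof -
  obtain U x j where s: "slice_chart U x j" "p \<in> U"
    using slice_chart_at[OF p] by blast
  have pU: "p \<in> U \<inter> pts S" using s p by simp
  obtain c where c: "v = coord_vec S (U \<inter> pts S) (inv j \<circ> x) c p"
    using S.tangent_coord_vec[OF slice_intrinsic[OF s(1)] pU v] .
  have "coord_vec M U x (j c) p = 0"
    using 0 incl_coord_vec[OF s(1) pU] c by simp
  then have "j c = 0"
    using M.chart_comp_coord_vec[OF slice_ambient[OF s(1)] s(2), of "j c"] linear_0[OF chart_comp_linear]
    by metis
  then have "c = 0"
    using slice_inj[OF s(1)] slice_linear[OF s(1)] linear_injective_0 by blast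
  then show ?thesis
    using c linear_0[OF S.coord_vec_linear[OF slice_intrinsic[OF s(1)] pU]] by simp
qed

text \<open>Tangency only gives a choice of \<open>X' p\<close> point by point. Smoothness follows
  because in a slice chart the components of \<open>X'\<close> are fixed linear combinations of the
  smooth components of \<open>X\<close>.\<close>

lemma tangent_lift:
  assumes X: "vector_field M (pts M) X" and tan: "tangent_to M S X"
  obtains X' where "vector_field S (pts S) X'" "\<And>p. p \<in> pts S \<Longrightarrow> incl M p (X' p) = X p"
proof -
  have "\<exists>v. v \<in> tangent_space S p \<and> incl M p v = X p" if "p \<in> pts S" for p
    using tan that unfolding tangent_to_def by (metis imageE)
  then obtain X' where X': "\<And>p. p \<in> pts S \<Longrightarrow> X' p \<in> tangent_space S p \<and> incl M p (X' p) = X p"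
    by metis
  have "vector_field S (pts S) X'"
  proof (rule S.vector_field_local)
    fix p assume p: "p \<in> pts S"
    obtain U x j where s: "slice_chart U x j" "p \<in> U"
      using slice_chart_at[OF p] by blast
    let ?US = "U \<inter> pts S" and ?z = "inv j \<circ> x"
    note cM = slice_ambient[OF s(1)] and cS = slice_intrinsic[OF s(1)]
    note oU = M.chart_openin[OF cM] and oUS = S.chart_openin[OF cS]
    \<comment> \<open>\<open>inv j\<close> is arbitrary off the range of \<open>j\<close>; a linear
      left inverse \<open>k\<close> makes the passage from components in \<open>M\<close> to
      components in \<open>S\<close> linear.\<close>
    obtain k where k: "linear k" "k \<circ> j = id"
      using linear_injective_left_inverse[OF slice_linear[OF s(1)] slice_inj[OF s(1)]] by blast
    define a where "a q = chart_comp x (X q)" for q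
    have rep: "X' q = coord_vec S ?US ?z (k (a q)) q" if q: "q \<in> ?US" for q
    proof -
      have X'q: "X' q \<in> tangent_space S q" "incl M q (X' q) = X q" using X' q by auto
      obtain c where c: "X' q = coord_vec S ?US ?z c q"
        using S.tangent_coord_vec[OF cS q X'q(1)] .
      have "a q = j c"
        using X'q(2) M.chart_comp_coord_vec[OF cM, of q "j c"] q
        unfolding a_def c incl_coord_vec[OF s(1) q] by simp
      then have "k (a q) = c" using k(2) by (simp add: fun_eq_iff)
      then show ?thesis using c by simp
    qed
    have XU: "vector_field M U X"
      by (rule vector_field_subset[OF X openin_subset[OF oU]])
    have comp: "smooth_fun S ?US (\<lambda>q. k (a q) \<bullet> b)" for b
    proof (rule iffD2[OF S.smooth_fun_cong[OF oUS]])
      show "smooth_fun S ?US (\<lambda>q. \<Sum>e\<in>Basis. (a q \<bullet> e) * (k e \<bullet> b))"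
        unfolding a_def
        by (intro smooth_fun_restrict[OF oU] M.smooth_fun_sum[OF oU] M.smooth_fun_mult[OF oU]
            M.smooth_fun_const M.smooth_fun_chart_comp[OF cM oU subset_refl XU])
      show "k (a q) \<bullet> b = (\<Sum>e\<in>Basis. (a q \<bullet> e) * (k e \<bullet> b))" for q
        using linear_sum[OF k(1), of "\<lambda>e. (a q \<bullet> e) *\<^sub>R e" Basis] linear_scale[OF k(1)]
        by (simp add: euclidean_representation inner_sum_left)
    qed
    have vf: "vector_field S ?US (\<lambda>q. \<Sum>b\<in>Basis. (k (a q) \<bullet> b) *\<^sub>R coord_vec S ?US ?z b q)"
      by (rule S.vector_field_sum[OF oUS S.vector_field_scaleR[OF oUS comp S.vector_field_coord_vec[OF cS]]])
    have eq: "X' q = (\<Sum>b\<in>Basis. (k (a q) \<bullet> b) *\<^sub>R coord_vec S ?US ?z b q)" if q: "q \<in> ?US" for q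
    proof -
      note lin = S.coord_vec_linear[OF cS q]
      have "X' q = coord_vec S ?US ?z (\<Sum>b\<in>Basis. (k (a q) \<bullet> b) *\<^sub>R b) q"
        unfolding euclidean_representation by (rule rep[OF q])
      then show ?thesis
        by (simp only: linear_sum[OF lin] linear_scale[OF lin])
    qed
    have "vector_field S ?US X'"
      by (rule iffD2[OF S.vector_field_cong[OF oUS eq] vf])
    then show "\<exists>W. openin (mtop S) W \<and> p \<in> W \<and> vector_field S W X'"
      using oUS s(2) p by (intro exI[of _ ?US]) simp
  qed
  with X' that show thesis by blast
qed

text \<open>The classical relation of vector fields by the inclusion: \<open>X\<close> is a local
  extension of the tangent field \<open>X'\<close> to \<open>M\<close>.\<close>

definition related :: "'a set \<Rightarrow> 'a vfield \<Rightarrow> 'a vfield \<Rightarrow> bool" where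
  "related U X X' \<longleftrightarrow> openin (mtop M) U \<and> vector_field M U X \<and> vector_field S (U \<inter> pts S) X' \<and>
    (\<forall>q\<in>U \<inter> pts S. X q = incl M q (X' q))"

lemma relatedD:
  assumes "related U X X'"
  shows "openin (mtop M) U" "openin (mtop S) (U \<inter> pts S)" "vector_field M U X"
    "vector_field S (U \<inter> pts S) X'" "q \<in> U \<inter> pts S \<Longrightarrow> X q = incl M q (X' q)"
  using assms openin_restrict unfolding related_def by blast+

lemma related_subset:
  assumes "related U X X'" "openin (mtop M) V" "V \<subseteq> U"
  shows "related V X X'"
  using assms vector_field_subset[of M U X V] vector_field_subset[of S "U \<inter> pts S" X' "V \<inter> pts S"]
  by (auto simp: related_def)

text \<open>Coordinate fields of a slice chart with constant coefficients extend \<open>v\<close> to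
  \<open>S\<close> and to \<open>M\<close> at once. A single \<open>U\<close> serves all
  \<open>v\<close>, so that several such fields can be used together.\<close>

lemma related_extension:
  assumes p: "p \<in> pts S"
  obtains U where "openin (mtop M) U" "p \<in> U"
    "\<forall>v\<in>tangent_space S p. \<exists>X X'. related U X X' \<and> X' p = v"
proof -
  obtain U x j where s: "slice_chart U x j" "p \<in> U"
    using slice_chart_at[OF p] by blast
  note cM = slice_ambient[OF s(1)] and cS = slice_intrinsic[OF s(1)]
  have "\<exists>X X'. related U X X' \<and> X' p = v" if v: "v \<in> tangent_space S p" for v
  proof -
    obtain c where "v = coord_vec S (U \<inter> pts S) (inv j \<circ> x) c p"
      by (rule S.tangent_coord_vec[OF cS _ v]) (use s p in auto)
    moreover have "related U (coord_vec M U x (j c)) (coord_vec S (U \<inter> pts S) (inv j \<circ> x) c)"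
      unfolding related_def
      using M.chart_openin[OF cM] M.vector_field_coord_vec[OF cM] S.vector_field_coord_vec[OF cS]
        incl_coord_vec[OF s(1)] by simp
    ultimately show ?thesis by metis
  qed
  with that M.chart_openin[OF cM] s(2) show thesis by blast
qed

text \<open>A vector tangent to \<open>S\<close> differentiates along \<open>S\<close> only, so it
  does not distinguish functions that agree on \<open>S\<close>, whatever they do elsewhere.\<close>

lemma incl_derivative:
  assumes V: "openin (mtop M) V" "p \<in> V" and p: "p \<in> pts S" and v: "v \<in> tangent_space S p"
    and F: "smooth_fun M V F" and eq: "\<And>q. q \<in> V \<inter> pts S \<Longrightarrow> F q = G q"
  shows "incl M p v F = v G"
proof -
  have "incl M p v F = v F"
    by (rule incl_apply[OF M.smooth_atI[OF V(1) F V(2)]])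
  also have "\<dots> = v G"
    by (rule S.tangent_cong[OF v openin_restrict[OF V(1)] _ eq]) (use V p in auto)
  finally show ?thesis .
qed

text \<open>Along \<open>S\<close> the functions obtained by applying \<open>Y\<close> and
  \<open>Y'\<close> to \<open>F\<close> coincide, and \<open>X\<close> differentiates them along
  \<open>S\<close> only. In particular the bracket of fields tangent to \<open>S\<close> is tangent
  to \<open>S\<close>.\<close>

lemma lie_bracket_related:
  assumes X: "related U X X'" and Y: "related U Y Y'" and p: "p \<in> U \<inter> pts S"
  shows "lie_bracket M X Y p = incl M p (lie_bracket S X' Y' p)"
proof
  fix F
  show "lie_bracket M X Y p F = incl M p (lie_bracket S X' Y' p) F"
  proof (cases "smooth_at M p F")
    case True
    then obtain V where V: "openin (mtop M) V" "p \<in> V" "smooth_fun M V F"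
      by (auto simp: smooth_at_def)
    note oU = relatedD(1)[OF X]
    define W where "W = U \<inter> V"
    have W: "openin (mtop M) W" "p \<in> W" "W \<subseteq> U" "W \<subseteq> V"
      using oU V p by (auto simp: W_def)
    have F: "smooth_fun M W F" by (rule M.smooth_fun_subset[OF V(3) W(4)])
    have *: "A p (\<lambda>q. B q F) = A' p (\<lambda>q. B' q F)" if A: "related U A A'" and B: "related U B B'" for A A' B B'
    proof -
      have "A p (\<lambda>q. B q F) = incl M p (A' p) (\<lambda>q. B q F)"
        using relatedD(5)[OF A p] by simp
      also have "\<dots> = A' p (\<lambda>q. B' q F)"
      proof (rule incl_derivative[OF W(1,2)])
        show "A' p \<in> tangent_space S p" by (rule vector_field_tangent[OF relatedD(4)[OF A] p])
        show "smooth_fun M W (\<lambda>q. B q F)" by (rule vector_field_smooth[OF relatedD(3)[OF B] W(1,3) F])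
        show "B q F = B' q F" if "q \<in> W \<inter> pts S" for q
        proof -
          have q: "q \<in> U \<inter> pts S" "q \<in> W" using that W by auto
          show ?thesis
            unfolding relatedD(5)[OF B q(1)] by (rule incl_apply[OF M.smooth_atI[OF W(1) F q(2)]])
        qed
      qed (use p in blast)
      finally show ?thesis .
    qed
    have "smooth_at S p F" using smooth_at_restrict[OF True] p by blast
    then show ?thesis
      using True *[OF X Y] *[OF Y X] by (simp add: lie_bracket_def incl_def)
  next
    case False
    then show ?thesis by (simp add: lie_bracket_def incl_def)
  qed
qed

end

section \<open>The induced metric and its Levi-Civita connection\<close>

locale riemannian_submfd = submfd M S + M: levi_civita_mfd M g nabla
  for M :: "('a, 'e::euclidean_space) mfd" and S :: "('a, 'f::euclidean_space) mfd"
    and g :: "'a metric_tensor" and nabla nablaS :: "'a conn" +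
  assumes riemannian: "riemannian_metric M g"
    and levi_civita_S: "levi_civita S (induced_metric M g) nablaS"

sublocale riemannian_submfd \<subseteq> S: levi_civita_mfd S "induced_metric M g" nablaS
proof
  fix p u v
  assume p: "p \<in> pts S" and u: "u \<in> tangent_space S p"
  note pM = pts_subset[OF p]
  show "linear_over (tangent_space S p) (induced_metric M g p u)"
    unfolding linear_over_def induced_metric_def incl_add incl_scaleR
    using M.metric_add_right[OF pM] M.metric_scaleR_right[OF pM] incl_tangent[OF p] u by simp
  show "induced_metric M g p u v = induced_metric M g p v u" if "v \<in> tangent_space S p"
    unfolding induced_metric_def using M.metric_sym[OF pM] incl_tangent[OF p] u that by blast
qed (rule levi_civita_S)

context riemannian_submfd
begin

text \<open>Metric derivatives and brackets of related fields agree along \<open>S\<close>, hence so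
  do the two Koszul formulas. Pairing with the tangent vector \<open>Z p\<close> leaves only the
  tangential part of \<open>nabla X Y\<close>.\<close>

lemma induced_connection:
  assumes X: "related U X X'" and Y: "related U Y Y'" and Z: "related U Z Z'" and p: "p \<in> U \<inter> pts S"
  shows "induced_metric M g p (nablaS X' Y' p) (Z' p) = g p (nabla X Y p) (Z p)"
proof -
  have pU: "p \<in> U" and pS: "p \<in> pts S" using p by auto
  have deriv: "A p (\<lambda>q. g q (B q) (C q)) = A' p (\<lambda>q. induced_metric M g q (B' q) (C' q))"
    if A: "related U A A'" and B: "related U B B'" and C: "related U C C'" for A A' B B' C C'
    unfolding relatedD(5)[OF A p]
  proof (rule incl_derivative[OF relatedD(1)[OF A] pU pS])
    show "A' p \<in> tangent_space S p" by (rule vector_field_tangent[OF relatedD(4)[OF A] p])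
    show "smooth_fun M U (\<lambda>q. g q (B q) (C q))"
      by (rule riemannian_metric_smooth[OF riemannian relatedD(1)[OF A] relatedD(3)[OF B] relatedD(3)[OF C]])
    show "g q (B q) (C q) = induced_metric M g q (B' q) (C' q)" if "q \<in> U \<inter> pts S" for q
      unfolding induced_metric_def relatedD(5)[OF B that] relatedD(5)[OF C that] ..
  qed
  have bracket: "g p (lie_bracket M A B p) (C p) = induced_metric M g p (lie_bracket S A' B' p) (C' p)"
    if A: "related U A A'" and B: "related U B B'" and C: "related U C C'" for A A' B B' C C'
    unfolding induced_metric_def lie_bracket_related[OF A B p] relatedD(5)[OF C p] ..
  have "2 * induced_metric M g p (nablaS X' Y' p) (Z' p) = 2 * g p (nabla X Y p) (Z p)"
    unfolding S.koszul[OF relatedD(2,4)[OF X] relatedD(4)[OF Y] relatedD(4)[OF Z] p]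
      M.koszul[OF relatedD(1,3)[OF X] relatedD(3)[OF Y] relatedD(3)[OF Z] pU]
      deriv[OF X Y Z] deriv[OF Y X Z] deriv[OF Z X Y] bracket[OF X Y Z] bracket[OF X Z Y]
      bracket[OF Y Z X] ..
  then show ?thesis by simp
qed

text \<open>Turns identities between products with tangent vectors into identities between tangent
  vectors.\<close>

lemma induced_nondegenerate:
  assumes p: "p \<in> pts S" and v: "v \<in> tangent_space S p"
    and 0: "\<And>w. w \<in> tangent_space S p \<Longrightarrow> induced_metric M g p v w = 0"
  shows "v = 0"
proof -
  have "g p (incl M p v) (incl M p v) = 0"
    using 0[OF v] by (simp add: induced_metric_def)
  then have "incl M p v = 0"
    using riemannian incl_tangent[OF p v] pts_subset[OF p] unfolding riemannian_metric_def
    by (metis less_irrefl)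
  then show ?thesis by (rule incl_eq_0D[OF p v])
qed

end

section \<open>The shape operator on \<xi> and the pointwise dichotomy\<close>

section \<open>Hypersurfaces of conformal Kenmotsu manifolds\<close>


locale conformal_kenmotsu_hypersurface = riemannian_submfd M S g nabla nablaS
  for M :: "('a, 'e::euclidean_space) mfd" and S :: "('a, 'f::euclidean_space) mfd"
    and g :: "'a metric_tensor" and nabla nablaS :: "'a conn" +
  fixes \<phi> :: "'a \<Rightarrow> 'a tvec \<Rightarrow> 'a tvec" and \<xi> :: "'a vfield" and \<eta> :: "'a \<Rightarrow> 'a tvec \<Rightarrow> real"
    and f :: "'a \<Rightarrow> real" and N Lee :: "'a vfield" and A :: "'a \<Rightarrow> 'a tvec \<Rightarrow> 'a tvec"
  assumes acm: "almost_contact_metric M \<phi> \<xi> \<eta> g"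
    and f_smooth: "smooth_fun M (pts M) f"
    and kenmotsu: "kenmotsu M \<phi> (\<lambda>p. exp (- f p / 2) *\<^sub>R \<xi> p) (\<lambda>p v. exp (f p / 2) * \<eta> p v)
      (\<lambda>p u v. exp (f p) * g p u v)"
    and normal: "unit_normal_field M S g N"
    and shape: "is_shape_operator M S nabla N A"
    and Lee: "is_gradient M g f Lee"
    and Lee_tangent: "tangent_to M S Lee"
begin

lemma xi_vector_field: "vector_field M (pts M) \<xi>"
  and eta_eq: "p \<in> pts M \<Longrightarrow> u \<in> tangent_space M p \<Longrightarrow> \<eta> p u = g p u (\<xi> p)"
  and eta_xi: "p \<in> pts M \<Longrightarrow> \<eta> p (\<xi> p) = 1"
  using acm by (simp_all add: almost_contact_metric_def)

lemma shape_tensor: "tensor11 S A"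
  using shape by (simp add: is_shape_operator_def)

lemma normal_tangent: "p \<in> pts S \<Longrightarrow> N p \<in> tangent_space M p"
  and normal_orthogonal: "p \<in> pts S \<Longrightarrow> v \<in> tangent_space S p \<Longrightarrow> g p (N p) (incl M p v) = 0"
  using normal by (simp_all add: unit_normal_field_def vector_field_along_def)

text \<open>This is where tangency of the Lee field enters: the derivative of \<open>f\<close> along
  \<open>N\<close> is the product of a tangent with a normal vector.\<close>

lemma normal_derivative_f:
  assumes p: "p \<in> pts S"
  shows "N p f = 0"
proof -
  obtain u where u: "u \<in> tangent_space S p" "Lee p = incl M p u"
    using Lee_tangent p unfolding tangent_to_def by (metis imageE)
  have "N p f = g p (Lee p) (N p)"
    using Lee normal_tangent[OF p] pts_subset[OF p] by (simp add: is_gradient_def)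
  also have "\<dots> = g p (N p) (incl M p u)"
    unfolding u(2) by (rule M.metric_sym[OF pts_subset[OF p] incl_tangent[OF p u(1)] normal_tangent[OF p]])
  also have "\<dots> = 0" by (rule normal_orthogonal[OF p u(1)])
  finally show ?thesis .
qed

lemma nabla_xi:
  assumes "openin (mtop M) U" "vector_field M U X" "vector_field M U Z" "p \<in> U"
  shows "g p (nabla X \<xi> p) (Z p) = exp (f p / 2) * (g p (X p) (Z p) - \<eta> p (X p) * \<eta> p (Z p))
    - \<xi> p f / 2 * g p (X p) (Z p) + \<eta> p (X p) * Z p f / 2"
  by (rule conformal_kenmotsu_nabla_xi[OF M.smooth_manifold acm f_smooth kenmotsu M.levi_civita assms])

context
  fixes \<xi>'
  assumes xi': "vector_field S (pts S) \<xi>'" "\<And>p. p \<in> pts S \<Longrightarrow> incl M p (\<xi>' p) = \<xi> p"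
begin

lemma related_xi: "openin (mtop M) U \<Longrightarrow> related U \<xi> \<xi>'"
  unfolding related_def
  using vector_field_subset[OF xi_vector_field] vector_field_subset[OF xi'(1)] xi'(2) openin_subset[of "mtop M" U]
  by auto

text \<open>In substance the symmetry of the second fundamental form. Pairing with a tangent
  \<open>w\<close> moves the derivative from the normal field to an extension \<open>Z\<close> of
  \<open>w\<close>; torsion-freeness exchanges \<xi> and \<open>Z\<close> at the cost of a tangent
  bracket; and the derivative of \<xi> along \<open>Z\<close> has no normal component.\<close>

lemma shape_xi:
  assumes p: "p \<in> pts S"
  shows "A p (\<xi>' p) = 0"
proof (rule induced_nondegenerate[OF p])
  note pM = pts_subset[OF p]
  have \<xi>'p: "\<xi>' p \<in> tangent_space S p" by (rule vector_field_tangent[OF xi'(1) p])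
  show A\<xi>: "A p (\<xi>' p) \<in> tangent_space S p"
    by (rule tensor11_tangent[OF shape_tensor p \<xi>'p])
  fix w assume w: "w \<in> tangent_space S p"
  obtain U0 where U0: "openin (mtop M) U0" "p \<in> U0"
    "\<forall>v\<in>tangent_space S p. \<exists>X X'. related U0 X X' \<and> X' p = v"
    using related_extension[OF p] .
  obtain Z Z' where Z0: "related U0 Z Z'" and Zp: "Z' p = w"
    using U0(3) w by blast
  have "cov_deriv_along M S nabla N p (\<xi>' p) (- incl M p (A p (\<xi>' p)))"
    using shape p \<xi>'p by (simp add: is_shape_operator_def)
  then obtain U1 X W where U1: "openin (mtop M) U1" "p \<in> U1" and X1: "vector_field M U1 X"
    and W1: "vector_field M U1 W" and Xp: "X p = incl M p (\<xi>' p)"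
    and WN: "\<forall>q\<in>U1 \<inter> pts S. W q = N q" and nXW: "- incl M p (A p (\<xi>' p)) = nabla X W p"
    unfolding cov_deriv_along_def by (elim exE conjE)
  define V where "V = U0 \<inter> U1"
  have V: "openin (mtop M) V" "p \<in> V" "V \<subseteq> U0" "V \<subseteq> U1" and pV: "p \<in> V \<inter> pts S"
    using U0(1,2) U1 p by (auto simp: V_def)
  note Z = related_subset[OF Z0 V(1,3)] and \<xi> = related_xi[OF V(1)]
  note X = vector_field_subset[OF X1 V(4)] and W = vector_field_subset[OF W1 V(4)]
  note vZ = relatedD(3)[OF Z] and v\<xi> = relatedD(3)[OF \<xi>]
  have WNq: "W q = N q" if "q \<in> V \<inter> pts S" for q using WN V(4) that by blast
  have orth: "g q (W q) (Z q) = 0" if q: "q \<in> V \<inter> pts S" for q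
    unfolding WNq[OF q] relatedD(5)[OF Z q]
    using normal_orthogonal vector_field_tangent[OF relatedD(4)[OF Z] q] q by blast
  \<comment> \<open>The definition of the shape operator supplies some extension \<open>X\<close> of
    the vector, not the field \<xi> itself; tensoriality in the direction permits the
    exchange.\<close>
  have "nabla \<xi> W p = nabla X W p"
    by (rule M.conn_tensorial[OF V(1,2) v\<xi> X W]) (simp add: Xp xi'(2)[OF p])
  then have n\<xi>W: "nabla \<xi> W p = - incl M p (A p (\<xi>' p))"
    using nXW by simp
  have "\<xi> p (\<lambda>q. g q (W q) (Z q)) = incl M p (\<xi>' p) (\<lambda>q. g q (W q) (Z q))"
    by (simp add: xi'(2)[OF p])
  \<comment> \<open>\<open>W\<close> and \<open>Z\<close> are orthogonal only along
    \<open>S\<close>, which is enough because \<xi> is tangent to \<open>S\<close>.\<close>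
  also have "\<dots> = \<xi>' p (\<lambda>q. 0)"
    by (rule incl_derivative[OF V(1,2) p \<xi>'p riemannian_metric_smooth[OF riemannian V(1) W vZ] orth])
  also have "\<dots> = 0"
    by (rule S.tangent_const[OF p \<xi>'p])
  finally have "g p (nabla \<xi> W p) (Z p) + g p (W p) (nabla \<xi> Z p) = 0"
    using M.metric_compatible[OF V(1) v\<xi> W V(2) vZ] by simp
  moreover have "g p (W p) (nabla \<xi> Z p) = 0"
  proof -
    note t = vector_field_tangent[OF _ V(2)]
    have nZ: "nabla Z \<xi> p \<in> tangent_space M p"
      by (rule t[OF M.conn_vector_field[OF V(1) vZ v\<xi>]])
    have br': "lie_bracket S \<xi>' Z' p \<in> tangent_space S p"
      by (rule S.lie_bracket_tangent[OF relatedD(2,4)[OF \<xi>] relatedD(4)[OF Z] pV])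
    \<comment> \<open>The exchange brings in the known derivative of \<xi>; the bracket is tangent
      to \<open>S\<close> and therefore orthogonal to \<open>N\<close>.\<close>
    have "nabla \<xi> Z p = nabla Z \<xi> p + incl M p (lie_bracket S \<xi>' Z' p)"
      using M.torsion_free[OF V(1) v\<xi> vZ V(2)] lie_bracket_related[OF \<xi> Z pV]
      by (simp add: diff_eq_eq add.commute)
    then have "g p (W p) (nabla \<xi> Z p) = g p (W p) (nabla Z \<xi> p) + g p (W p) (incl M p (lie_bracket S \<xi>' Z' p))"
      using M.metric_add_right[OF pM t[OF W] nZ incl_tangent[OF p br']] by simp
    also have "g p (W p) (incl M p (lie_bracket S \<xi>' Z' p)) = 0"
      unfolding WNq[OF pV] by (rule normal_orthogonal[OF p br'])
    also have "g p (W p) (nabla Z \<xi> p) = g p (nabla Z \<xi> p) (W p)"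
      by (rule M.metric_sym[OF pM t[OF W] nZ])
    \<comment> \<open>Each term of the formula for the derivative of \<xi> contains one of
      \<open>g p (Z p) (W p)\<close>, \<open>\<eta> p (W p)\<close> and \<open>W p f\<close>, all of
      which vanish for the normal vector \<open>W p\<close>.\<close>
    also have "\<dots> = 0"
    proof -
      have "g p (Z p) (W p) = 0"
        using M.metric_sym[OF pM t[OF vZ] t[OF W]] orth[OF pV] by simp
      moreover have "\<eta> p (W p) = 0"
        using eta_eq[OF pM t[OF W]] normal_orthogonal[OF p \<xi>'p] xi'(2)[OF p] WNq[OF pV] by simp
      moreover have "W p f = 0"
        using normal_derivative_f[OF p] WNq[OF pV] by simp
      ultimately show ?thesis
        unfolding nabla_xi[OF V(1) vZ W V(2)] by simp
    qed
    finally show ?thesis by simp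
  qed
  ultimately have "g p (nabla \<xi> W p) (Z p) = 0" by simp
  then have "g p (- incl M p (A p (\<xi>' p))) (incl M p w) = 0"
    unfolding n\<xi>W relatedD(5)[OF Z pV] Zp .
  then show "induced_metric M g p (A p (\<xi>' p)) w = 0"
    using M.metric_scaleR_left[OF pM incl_tangent[OF p w] incl_tangent[OF p A\<xi>], of "-1"]
    by (simp add: induced_metric_def)
qed

text \<open>Since \<open>A\<close> annihilates \<open>\<xi>'\<close> on all of \<open>U\<close> and
  not just at \<open>p\<close>, the derivative of \<open>A \<xi>'\<close> vanishes along with the
  recurrence term; only the term with the derivative of \<open>\<xi>'\<close> survives.\<close>

lemma recurrent_shape_nabla_xi:
  assumes rec: "recurrent S nablaS A"
    and U: "openin (mtop S) U" and X: "vector_field S U X" and p: "p \<in> U"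
  shows "A p (nablaS X \<xi>' p) = 0"
proof -
  obtain \<theta> where \<theta>: "\<forall>U X Y. openin (mtop S) U \<and> vector_field S U X \<and> vector_field S U Y \<longrightarrow>
      (\<forall>p\<in>U. nablaS X (\<lambda>q. A q (Y q)) p - A p (nablaS X Y p) = \<theta> p (X p) *\<^sub>R A p (Y p))"
    using rec unfolding recurrent_def by (elim exE conjE)
  have US: "U \<subseteq> pts S" by (rule openin_subset[OF U])
  note \<xi>' = vector_field_subset[OF xi'(1) US]
  have zero: "A q (\<xi>' q) = 0" if "q \<in> U" for q
    using shape_xi that US by blast
  have "nablaS X (\<lambda>q. 0) p = nablaS X (\<lambda>q. A q (\<xi>' q)) p"
    by (rule S.conn_cong_right[OF U X S.vector_field_zero[OF U] p]) (simp add: zero)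
  then have "nablaS X (\<lambda>q. A q (\<xi>' q)) p = 0"
    using S.conn_zero_right[OF U X p] by simp
  then show ?thesis
    using \<theta>[THEN spec, THEN spec, THEN spec, THEN mp, THEN bspec, OF conjI[OF U conjI[OF X \<xi>']] p] zero[OF p]
    by simp
qed

text \<open>For \<open>u\<close> orthogonal to \<xi> the terms with \<open>\<eta>\<close> drop out,
  and the induced derivative of \<open>\<xi>'\<close> along \<open>u\<close> is the scalar factor
  times \<open>u\<close>. Any \<open>v\<close> differs from such a \<open>u\<close> by a multiple of
  \<open>\<xi>'\<close>, which \<open>A\<close> kills.\<close>

lemma recurrent_shape_dichotomy:
  assumes rec: "recurrent S nablaS A" and p: "p \<in> pts S" and v: "v \<in> tangent_space S p"
  shows "(exp (f p / 2) - \<xi> p f / 2) *\<^sub>R A p v = 0"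
proof -
  define c where "c = exp (f p / 2) - \<xi> p f / 2"
  note pM = pts_subset[OF p] and lin = tensor11_linear[OF shape_tensor p]
  obtain U where U: "openin (mtop M) U" "p \<in> U"
    and ext: "\<forall>v\<in>tangent_space S p. \<exists>X X'. related U X X' \<and> X' p = v"
    using related_extension[OF p] .
  have pU: "p \<in> U \<inter> pts S" using U p by blast
  note \<xi> = related_xi[OF U(1)]
  have \<xi>'p: "\<xi>' p \<in> tangent_space S p" by (rule vector_field_tangent[OF xi'(1) p])
  have \<xi>p: "\<xi> p \<in> tangent_space M p" by (rule vector_field_tangent[OF xi_vector_field pM])
  have orthogonal: "c *\<^sub>R A p u = 0" if u: "u \<in> tangent_space S p" and u\<xi>: "g p (incl M p u) (\<xi> p) = 0" for u
  proof -
    obtain X X' where X: "related U X X'" "X' p = u" using ext u by blast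
    have nX: "nablaS X' \<xi>' p \<in> tangent_space S p"
      by (rule vector_field_tangent[OF S.conn_vector_field[OF relatedD(2,4)[OF X(1)] relatedD(4)[OF \<xi>]] pU])
    have cu: "c *\<^sub>R u \<in> tangent_space S p" by (rule S.tangent_scaleR[OF p u])
    \<comment> \<open>The induced connection is accessible only through products, so the equality is
      tested against every tangent \<open>w\<close>.\<close>
    have "nablaS X' \<xi>' p - c *\<^sub>R u = 0"
    proof (rule induced_nondegenerate[OF p S.tangent_diff[OF p nX cu]])
      fix w assume w: "w \<in> tangent_space S p"
      obtain Z Z' where Z: "related U Z Z'" "Z' p = w" using ext w by blast
      have Xp: "X p = incl M p u" and Zp: "Z p = incl M p w"
        using relatedD(5)[OF X(1) pU] relatedD(5)[OF Z(1) pU] X(2) Z(2) by simp_all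
      have "\<eta> p (X p) = 0"
        using eta_eq[OF pM incl_tangent[OF p u]] u\<xi> Xp by simp
      then have "g p (nabla X \<xi> p) (Z p) = c * g p (incl M p u) (incl M p w)"
        using nabla_xi[OF relatedD(1,3)[OF X(1)] relatedD(3)[OF Z(1)] U(2)]
        by (simp add: Xp Zp c_def algebra_simps)
      then have "induced_metric M g p (nablaS X' \<xi>' p) w = c * induced_metric M g p u w"
        using induced_connection[OF X(1) \<xi> Z(1) pU] Z(2) by (simp add: induced_metric_def)
      then show "induced_metric M g p (nablaS X' \<xi>' p - c *\<^sub>R u) w = 0"
        using S.metric_diff_left[OF p w nX cu] S.metric_scaleR_left[OF p w u] by simp
    qed
    then have "nablaS X' \<xi>' p = c *\<^sub>R u" by simp
    then show ?thesis
      using recurrent_shape_nabla_xi[OF rec relatedD(2,4)[OF X(1)] pU] linear_over_scaleR[OF lin u] by metis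
  qed
  \<comment> \<open>As \<xi> has unit length, this is the coefficient of the orthogonal projection
    of \<open>v\<close> onto it.\<close>
  define r where "r = g p (incl M p v) (\<xi> p)"
  have r\<xi>: "r *\<^sub>R \<xi>' p \<in> tangent_space S p" by (rule S.tangent_scaleR[OF p \<xi>'p])
  have "g p (incl M p (v - r *\<^sub>R \<xi>' p)) (\<xi> p) = g p (incl M p v) (\<xi> p) - r * g p (\<xi> p) (\<xi> p)"
    unfolding incl_diff incl_scaleR xi'(2)[OF p]
    by (simp add: M.metric_diff_left M.metric_scaleR_left M.tangent_scaleR pM \<xi>p incl_tangent[OF p v])
  also have "\<dots> = 0"
    using eta_eq[OF pM \<xi>p] eta_xi[OF pM] by (simp add: r_def)
  finally have "c *\<^sub>R A p (v - r *\<^sub>R \<xi>' p) = 0"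
    by (rule orthogonal[OF S.tangent_diff[OF p v r\<xi>]])
  moreover have "A p (v - r *\<^sub>R \<xi>' p) = A p v"
    using linear_over_diff[OF lin S.subspace_tangent_space[OF p] v r\<xi>] linear_over_scaleR[OF lin \<xi>'p]
      shape_xi[OF p] by simp
  ultimately show ?thesis by (simp add: c_def)
qed

end

end

theorem theorem6p2:
  fixes M :: "('a, 'e::euclidean_space) mfd"
    and S :: "('a, 'f::euclidean_space) mfd"
    and \<phi> :: "'a \<Rightarrow> 'a tvec \<Rightarrow> 'a tvec" and \<xi> :: "'a vfield"
    and \<eta> :: "'a \<Rightarrow> 'a tvec \<Rightarrow> real" and g :: "'a metric_tensor"
    and f :: "'a \<Rightarrow> real" and c :: real and n :: nat
    and nabla nablaS :: "'a conn" and N Lee :: "'a vfield"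
    and A :: "'a \<Rightarrow> 'a tvec \<Rightarrow> 'a tvec" and \<beta> :: "'a \<Rightarrow> real"
  assumes dim: "DIM('e) = 2 * n + 1"
    and space_form: "conformal_kenmotsu_space_form M \<phi> \<xi> \<eta> g f c"
    and hypersurface: "cr_hypersurface M S \<phi> \<xi> g"
    and connected: "connected_space (mtop S)"
    and nabla: "levi_civita M g nabla"
    and nablaS: "levi_civita S (induced_metric M g) nablaS"
    and normal: "unit_normal_field M S g N"
    and shape: "is_shape_operator M S nabla N A"
    and recurrent: "recurrent S nablaS A"
    and Lee: "is_gradient M g f Lee"
    and Lee_tangent: "tangent_to M S Lee"
    and beta: "\<And>p. p \<in> pts S \<Longrightarrow> \<beta> p = lee_form f p (\<xi> p)"
  shows "totally_geodesic S A \<or>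
    (\<forall>p\<in>pts S. 0 < \<beta> p \<and> f p = 2 * (ln (\<beta> p) - ln 2))"
proof -
  have M: "smooth_manifold M" and acm: "almost_contact_metric M \<phi> \<xi> \<eta> g"
    and f: "smooth_fun M (pts M) f"
    and ken: "kenmotsu M \<phi> (\<lambda>p. exp (- f p / 2) *\<^sub>R \<xi> p) (\<lambda>p v. exp (f p / 2) * \<eta> p v)
      (\<lambda>p u v. exp (f p) * g p u v)"
    using space_form by (simp_all add: conformal_kenmotsu_space_form_def Let_def)
  have rm: "riemannian_metric M g"
    using acm by (simp add: almost_contact_metric_def)
  have emb: "embedded_submanifold M S" and \<xi>: "tangent_to M S \<xi>"
    using hypersurface by (simp_all add: cr_hypersurface_def)
  then have S: "smooth_manifold S"
    by (simp add: embedded_submanifold_def)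
  interpret M: levi_civita_mfd M g nabla
    by (rule riemannian_levi_civita_mfd[OF M rm nabla])
  interpret conformal_kenmotsu_hypersurface M S g nabla nablaS \<phi> \<xi> \<eta> f N Lee A
    by unfold_locales (fact S emb rm nablaS acm f ken normal shape Lee Lee_tangent)+
  obtain \<xi>' where \<xi>': "vector_field S (pts S) \<xi>'" "\<And>p. p \<in> pts S \<Longrightarrow> incl M p (\<xi>' p) = \<xi> p"
    by (rule tangent_lift[OF xi_vector_field \<xi>]) (rule that)
  show ?thesis
  proof (cases "totally_geodesic S A")
    case False
    have "0 < \<beta> p \<and> f p = 2 * (ln (\<beta> p) - ln 2)" if p: "p \<in> pts S" for p
    proof -
      \<comment> \<open>A single zero of \<open>A\<close> would spread over the connected
        hypersurface, so failure to be totally geodesic forces a nonzero value at every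
        point.\<close>
      have "\<not> (\<forall>v\<in>tangent_space S p. A p v = 0)"
        using False S.recurrent_zero_everywhere[OF connected shape_tensor recurrent p]
        unfolding totally_geodesic_def by blast
      then obtain v where v: "v \<in> tangent_space S p" "A p v \<noteq> 0" by blast
      have "exp (f p / 2) - \<xi> p f / 2 = 0"
        using recurrent_shape_dichotomy[OF \<xi>' recurrent p v(1)] v(2) by simp
      \<comment> \<open>Being twice an exponential, \<open>\<beta> p\<close> is positive, so that
        its logarithm is the genuine one.\<close>
      then have \<beta>: "\<beta> p = 2 * exp (f p / 2)"
        using beta[OF p] by (simp add: lee_form_def)
      then have "ln (\<beta> p) = ln 2 + f p / 2"
        by (simp add: ln_mult)
      with \<beta> show ?thesis by simp
    qed
    then show ?thesis by blast
  qed blast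
qed

end
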